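(* Let $M$ be a smooth manifold and $r\ge 0$ an integer. For every $r$-Lagrangian $L$ on $M$, the following equality of horizontal $(r+1)$-forms on $J_{(r+1)}$ holds: $$\bar d L\,\mathcal D t_{(r+1)}=\chi_r\bigl(\delta[L\,\mathcal D t_{(r)}]\bigr).$$ Here $\bar dL=x^a_{r+1}\mathcal F_a(L)$ is the variational differential of $L$, $\delta$ is the vertical differential acting on classes of forms modulo horizontal coboundaries, and $\chi_r=\kappa_r\circ\rho$ is the composition of the canonical-representative map $\rho$ with the bidegree $(-1,1)$ map $\kappa_r$.
   Context: $\mathbb R^r$ has fixed standard coordinates $t^1,\dots,t^r$, and $x^a$ are local coordinates on $M$. $J_{(r)}$ is the space of infinite jets of sections of the trivial bundle $\mathbb R^r\times M\to\mathbb R^r$. It has local coordinates $t^i$, $x^a_\sigma$, with $\sigma$ running over symmetric multi-indices with entries in $\{1,\dots,r\}$, including the empty one. Sums over $\sigma$ below are over distinct symmetric multi-indices, and partial derivatives are with respect to the independent coordinates $x^a_\sigma$. All functions are smooth and of finite order, i.e. depend on finitely many coordinates. Repeated indices are summed. **Lagrangians and the variational differential.** $T^{\infty}_rM$ is the space of infinite jets at $0$ of maps $\mathbb R^r\to M$, with coordinates $x^a_\sigma$. An $r$-Lagrangian on $M$ is a smooth function of finite order $L=L(x^a,x^a_i,x^a_{ij},\dots)$ on $T^\infty_rM$. It is regarded as a function on $J_{(r)}$ via the natural projection $J_{(r)}\to T_r^\infty M$. The total derivatives are $D_i=\frac{\partial}{\partial t^i}+\sum_\sigma x^a_{i\sigma}\frac{\partial}{\partial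 x^a_\sigma}$, and $D_\sigma^{|\sigma|}=D_{i_1}\cdots D_{i_k}$ for $\sigma=i_1\dots i_k$. The variational derivative is $\mathcal F_a(L)=\sum_{\sigma}(-1)^{|\sigma|}D_\sigma^{|\sigma|}\frac{\partial L}{\partial x^a_\sigma}$. The variational differential of $L$ is the $(r+1)$-Lagrangian $\bar dL=x^a_{r+1}\mathcal F_a(L)$. **Bicomplex.** The Cartan forms are $\Gamma^a_{(r)\sigma}=dx^a_\sigma-\sum_{i=1}^r dt^i x^a_{i\sigma}$. $\Omega^{p,q}_{(r)}$ is the space of forms on $J_{(r)}$ of degree $p$ in the $\Gamma^a_{(r)\sigma}$ and degree $q$ in the $dt^i$ (wedge signs omitted). The exterior differential splits as $d=D+\delta$ with $D:\Omega^{p,q}_{(r)}\to\Omega^{p,q+1}_{(r)}$ and $\delta:\Omega^{p,q}_{(r)}\to\Omega^{p+1,q}_{(r)}$. On functions $Df=dt^iD_if$ and $\delta f=\sum_\sigma\Gamma^a_{(r)\sigma}\frac{\partial f}{\partial x^a_\sigma}$; moreover $\delta(dt^i)=0$, $\delta\Gamma^a_{(r)\sigma}=0$, $D(dt^i)=0$. Since $D\delta=-\delta D$, $\delta$ acts on classes $[\omega]\in\int\Omega^{p,r}_{(r)}:=\Omega^{p,r}_{(r)}/D(\Omega^{p,r-1}_{(r)})$ by $\delta[\omega]=[\delta\omega]$. The volume form is $\mathcal D t_{(r)}=dt^r dt^{r-1}\cdots dt^1$. **The map $\rho$.** $\rho:\int\Omega^{1,r}_{(r)}\to\Omega^{1,r}_{(r)}$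 sends the class of $\sum_\sigma\Gamma^a_{(r)\sigma}B^\sigma_a\,\mathcal D t_{(r)}$ to its canonical representative $\Gamma^a_{(r)}\sum_\sigma(-1)^{|\sigma|}D^{|\sigma|}_\sigma B^\sigma_a\,\mathcal D t_{(r)}$, where $\Gamma^a_{(r)}=dx^a-\sum_i dt^ix^a_i$. This is well defined on classes. **The map $\kappa_r$.** Let $p_r^*$ be pullback of forms along the projection $J_{(r+1)}\to J_{(r)}$ that forgets $t^{r+1}$ and all $x^a_\sigma$ with $\sigma$ containing the index $r+1$. The map $\kappa_r:\Omega^{p,q}_{(r)}\to\Omega^{p-1,q+1}_{(r+1)}$ sends $\omega$ to the component of bidegree $(p-1,q+1)$ of $p_r^*\omega$. Since $p_r^*\Gamma^a_{(r)\sigma}=\Gamma^a_{(r+1)\sigma}+dt^{r+1}x^a_{r+1,\sigma}$, explicitly $\kappa_r\omega=dt^{r+1}\sum_\sigma x^a_{r+1,\sigma}\frac{\partial\omega}{\partial\Gamma^a_{(r)\sigma}}$, with the remaining $\Gamma_{(r)}$'s replaced by the corresponding $\Gamma_{(r+1)}$'s. **The map $\chi_r$.** $\chi_r:=\kappa_r\circ\rho:\int\Omega^{1,r}_{(r)}\to\Omega^{0,r+1}_{(r+1)}$. *)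

theory Defs
  imports "HOL-Analysis.Analysis" "HOL-Library.Multiset"
begin

text \<open>
  Coordinates are indexed from 0: the coordinates of \<open>\<real>\<^sup>r\<close> are \<open>t i\<close> with \<open>i < r\<close> (so the additional
  coordinate of \<open>\<real>\<^sup>r\<^sup>+\<^sup>1\<close> has index \<open>r\<close>), local coordinates of an \<open>n\<close>-manifold are \<open>x a\<close> with
  \<open>a < n\<close>, and points of \<open>\<real>\<^sup>n\<close> are the points of the library topology
  \<^term>\<open>Euclidean_space n\<close>. Symmetric multi-indices are multisets of naturals.
  Sums over all multi-indices are finite at every point where they are used, because of the
  finite order conditions; they are written with \<^term>\<open>sum'\<close>, the sum over the indices with
  nonzero summand.
\<close>

section \<open>Partial derivatives and smooth functions of indexed variables\<close>

definition pd :: "'i \<Rightarrow> (('i \<Rightarrow> real) \<Rightarrow> real) \<Rightarrow> ('i \<Rightarrow> real) \<Rightarrow> real" where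
  "pd i f z = deriv (\<lambda>s. f (z(i := s))) (z i)"

text \<open>
  Used for sets \<open>S\<close> that are open in the directions of the coordinates in \<open>I\<close>, and, when \<open>I\<close> is
  infinite, only together with dependence on finitely many coordinates.
\<close>

definition smooth_on :: "'i set \<Rightarrow> ('i \<Rightarrow> real) set \<Rightarrow> (('i \<Rightarrow> real) \<Rightarrow> real) \<Rightarrow> bool" where
  "smooth_on I S f \<longleftrightarrow>
    (\<forall>is \<in> lists I. continuous_on S (foldr pd is f) \<and>
      (\<forall>i\<in>I. \<forall>z\<in>S. (\<lambda>s. foldr pd is f (z(i := s))) differentiable (at (z i))))"

section \<open>Smooth manifolds\<close>

type_synonym 'm chart = "'m set \<times> ('m \<Rightarrow> nat \<Rightarrow> real)"

record 'm mfd =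
  mdim :: nat
  mtop :: "'m topology"
  atlas :: "'m chart set"

definition smooth_manifold :: "'m mfd \<Rightarrow> bool" where
  "smooth_manifold M \<longleftrightarrow>
    Hausdorff_space (mtop M) \<and> second_countable (mtop M) \<and>
    (\<Union>(U, \<phi>) \<in> atlas M. U) = topspace (mtop M) \<and>
    (\<forall>(U, \<phi>) \<in> atlas M. openin (mtop M) U \<and>
      openin (Euclidean_space (mdim M)) (\<phi> ` U) \<and>
      homeomorphic_map (subtopology (mtop M) U)
        (subtopology (Euclidean_space (mdim M)) (\<phi> ` U)) \<phi>) \<and>
    (\<forall>(U, \<phi>) \<in> atlas M. \<forall>(V, \<psi>) \<in> atlas M. \<forall>b < mdim M.
      smooth_on {..<mdim M} (\<phi> ` (U \<inter> V)) (\<lambda>x. \<psi> (inv_into U \<phi> x) b))"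

section \<open>Jets\<close>

definition smooth_near :: "'m mfd \<Rightarrow> nat \<Rightarrow> (nat \<Rightarrow> real) \<Rightarrow> ((nat \<Rightarrow> real) \<Rightarrow> 'm) \<Rightarrow> bool" where
  "smooth_near M r t s \<longleftrightarrow>
    (\<exists>(U, \<phi>) \<in> atlas M. \<exists>W. openin (Euclidean_space r) W \<and> t \<in> W \<and> s ` W \<subseteq> U \<and>
      (\<forall>a < mdim M. smooth_on {..<r} W (\<lambda>u. \<phi> (s u) a)))"

definition germs :: "'m mfd \<Rightarrow> nat \<Rightarrow> ((nat \<Rightarrow> real) \<times> ((nat \<Rightarrow> real) \<Rightarrow> 'm)) set" where
  "germs M r = {(t, s). t \<in> topspace (Euclidean_space r) \<and> smooth_near M r t s}"

text \<open>The jet coordinates \<open>t\<^sup>i\<close> and \<open>x\<^sup>a\<^sub>\<sigma>\<close>; a point is \<open>coord \<Rightarrow> real\<close>, zero outside \<open>jcoords\<close>.\<close>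

datatype coord = T nat | X nat "nat multiset"

type_synonym pt = "coord \<Rightarrow> real"

definition mindices :: "nat \<Rightarrow> nat multiset set" where
  "mindices r = {\<sigma>. set_mset \<sigma> \<subseteq> {..<r}}"

definition jcoords :: "nat \<Rightarrow> nat \<Rightarrow> coord set" where
  "jcoords n r = T ` {..<r} \<union> (\<lambda>(a, \<sigma>). X a \<sigma>) ` ({..<n} \<times> mindices r)"

fun corder :: "coord \<Rightarrow> nat" where
  "corder (T i) = 0"
| "corder (X a \<sigma>) = size \<sigma>"

text \<open>The coordinates in a chart of the infinite jet at \<open>t\<close> of the section \<open>u \<mapsto> (u, s u)\<close>.\<close>

definition jet :: "'m mfd \<Rightarrow> nat \<Rightarrow> 'm chart \<Rightarrow> (nat \<Rightarrow> real) \<times> ((nat \<Rightarrow> real) \<Rightarrow> 'm) \<Rightarrow> pt" where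
  "jet M r c = (\<lambda>(t, s) y. case y of T i \<Rightarrow> t i
     | X a \<sigma> \<Rightarrow> if a < mdim M \<and> \<sigma> \<in> mindices r
          then foldr pd (sorted_list_of_multiset \<sigma>) (\<lambda>u. snd c (s u) a) t else 0)"

text \<open>
  The part of \<open>J\<^sub>(\<^sub>r\<^sub>)\<close> over a chart, and of \<open>T\<^sup>\<infinity>\<^sub>r M\<close> (the jets at 0), as sets of coordinate vectors.
  Objects on these spaces are families of coordinate expressions, one for each chart of the atlas,
  that represent the same object at every jet over an overlap of charts.
\<close>

definition J :: "'m mfd \<Rightarrow> nat \<Rightarrow> 'm chart \<Rightarrow> pt set" where
  "J M r c = {jet M r c (t, s) | t s. (t, s) \<in> germs M r \<and> s t \<in> fst c}"

definition TJ :: "'m mfd \<Rightarrow> nat \<Rightarrow> 'm chart \<Rightarrow> pt set" where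
  "TJ M r c = {jet M r c ((\<lambda>_. 0), s) | s. ((\<lambda>_. 0), s) \<in> germs M r \<and> s (\<lambda>_. 0) \<in> fst c}"

definition order_le :: "nat \<Rightarrow> pt set \<Rightarrow> (pt \<Rightarrow> real) \<Rightarrow> bool" where
  "order_le k S f \<longleftrightarrow>
    (\<forall>z\<in>S. \<forall>z'\<in>S. (\<forall>y. corder y \<le> k \<longrightarrow> z y = z' y) \<longrightarrow> f z = f z')"

definition transition :: "'m mfd \<Rightarrow> nat \<Rightarrow> 'm chart \<Rightarrow> 'm chart \<Rightarrow> pt \<Rightarrow> pt" where
  "transition M r c c' z = (THE z'. \<exists>t s. (t, s) \<in> germs M r \<and> s t \<in> fst c \<inter> fst c' \<and>
     z = jet M r c (t, s) \<and> z' = jet M r c' (t, s))"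

definition lagrangians :: "'m mfd \<Rightarrow> nat \<Rightarrow> ('m chart \<Rightarrow> pt \<Rightarrow> real) set" where
  "lagrangians M r = {L.
     (\<forall>c z. c \<notin> atlas M \<or> z \<notin> TJ M r c \<longrightarrow> L c z = 0) \<and>
     (\<exists>k. \<forall>c \<in> atlas M. order_le k (TJ M r c) (L c)) \<and>
     (\<forall>c \<in> atlas M. smooth_on {X a \<sigma> | a \<sigma>. a < mdim M \<and> \<sigma> \<in> mindices r} (TJ M r c) (L c)) \<and>
     (\<forall>c \<in> atlas M. \<forall>c' \<in> atlas M. \<forall>s. ((\<lambda>_. 0), s) \<in> germs M r \<longrightarrow>
        s (\<lambda>_. 0) \<in> fst c \<inter> fst c' \<longrightarrow>
        L c (jet M r c ((\<lambda>_. 0), s)) = L c' (jet M r c' ((\<lambda>_. 0), s)))}"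

text \<open>Pullback along the projection \<open>J\<^sub>(\<^sub>r\<^sub>) \<rightarrow> T\<^sup>\<infinity>\<^sub>r M\<close>, which forgets the coordinates \<open>t\<^sup>i\<close>.\<close>

definition on_J :: "('m chart \<Rightarrow> pt \<Rightarrow> real) \<Rightarrow> 'm chart \<Rightarrow> pt \<Rightarrow> real" where
  "on_J L c z = L c (\<lambda>y. case y of T i \<Rightarrow> 0 | X a \<sigma> \<Rightarrow> z (X a \<sigma>))"

text \<open>The projection \<open>p\<^sub>r : J\<^sub>(\<^sub>r\<^sub>+\<^sub>1\<^sub>) \<rightarrow> J\<^sub>(\<^sub>r\<^sub>)\<close> in coordinates.\<close>

definition proj :: "nat \<Rightarrow> nat \<Rightarrow> pt \<Rightarrow> pt" where
  "proj n r z = (\<lambda>y. if y \<in> jcoords n r then z y else 0)"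

section \<open>Total derivatives and the variational differential\<close>

definition Dtot :: "nat \<Rightarrow> nat \<Rightarrow> nat \<Rightarrow> (pt \<Rightarrow> real) \<Rightarrow> pt \<Rightarrow> real" where
  "Dtot n r i f z = pd (T i) f z +
     sum' (\<lambda>(a, \<sigma>). z (X a (add_mset i \<sigma>)) * pd (X a \<sigma>) f z) ({..<n} \<times> mindices r)"

definition Dtots :: "nat \<Rightarrow> nat \<Rightarrow> nat multiset \<Rightarrow> (pt \<Rightarrow> real) \<Rightarrow> pt \<Rightarrow> real" where
  "Dtots n r \<sigma> = foldr (Dtot n r) (sorted_list_of_multiset \<sigma>)"

definition var_deriv :: "nat \<Rightarrow> nat \<Rightarrow> nat \<Rightarrow> (pt \<Rightarrow> real) \<Rightarrow> pt \<Rightarrow> real" where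
  "var_deriv n r a f z =
     sum' (\<lambda>\<sigma>. (-1) ^ size \<sigma> * Dtots n r \<sigma> (pd (X a \<sigma>) f) z) (mindices r)"

text \<open>
  \<open>\<F>\<^sub>a(L)\<close> is a function on \<open>J\<^sub>(\<^sub>r\<^sub>)\<close>; at a jet at 0 of a map from \<open>\<real>\<^sup>r\<^sup>+\<^sup>1\<close> it is evaluated at
  the projection of this jet.
\<close>

definition var_diff :: "'m mfd \<Rightarrow> nat \<Rightarrow> ('m chart \<Rightarrow> pt \<Rightarrow> real) \<Rightarrow> 'm chart \<Rightarrow> pt \<Rightarrow> real" where
  "var_diff M r L c z =
    (if c \<in> atlas M \<and> z \<in> TJ M (Suc r) c
     then \<Sum>a<mdim M. z (X a {#r#}) * var_deriv (mdim M) r a (on_J L c) (proj (mdim M) r z)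
     else 0)"

section \<open>Differential forms\<close>

text \<open>
  In a chart, a form is given by its values \<open>\<omega> [g\<^sub>1, \<dots>, g\<^sub>k]\<close> on the frame dual to the coframe
  \<open>Dt i = dt\<^sup>i\<close>, \<open>Gam a \<sigma> = \<Gamma>\<^sup>a\<^sub>\<sigma>\<close> (the frame consists of \<open>D\<^sub>i\<close> and \<open>\<partial>/\<partial>x\<^sup>a\<^sub>\<sigma>\<close>). Thus
  \<open>\<omega> [g\<^sub>1, \<dots>, g\<^sub>k]\<close> is the coefficient of \<open>g\<^sub>1 \<and> \<dots> \<and> g\<^sub>k\<close> if the \<open>g\<^sub>i\<close> are distinct.
\<close>

datatype gen = Dt nat | Gam nat "nat multiset"

fun is_Dt :: "gen \<Rightarrow> bool" where
  "is_Dt (Dt i) = True"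
| "is_Dt (Gam a \<sigma>) = False"

type_synonym lform = "gen list \<Rightarrow> pt \<Rightarrow> real"

definition gens :: "nat \<Rightarrow> nat \<Rightarrow> gen set" where
  "gens n r = Dt ` {..<r} \<union> (\<lambda>(a, \<sigma>). Gam a \<sigma>) ` ({..<n} \<times> mindices r)"

text \<open>Left exterior multiplication by a generator, and the (left) derivative \<open>\<partial>\<omega>/\<partial>g\<close>.\<close>

definition wedge :: "gen \<Rightarrow> lform \<Rightarrow> lform" where
  "wedge g \<omega> gs z = (\<Sum>j | j < length gs \<and> gs ! j = g.
     (-1) ^ j * \<omega> (take j gs @ drop (Suc j) gs) z)"

definition gderiv :: "gen \<Rightarrow> lform \<Rightarrow> lform" where
  "gderiv g \<omega> gs = \<omega> (g # gs)"

definition fun_form :: "(pt \<Rightarrow> real) \<Rightarrow> lform" where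
  "fun_form f gs z = (if gs = [] then f z else 0)"

text \<open>\<open>f dt\<^sup>r \<and> \<dots> \<and> dt\<^sup>1\<close>\<close>

definition lvol :: "nat \<Rightarrow> (pt \<Rightarrow> real) \<Rightarrow> lform" where
  "lvol r f = foldr (\<lambda>i. wedge (Dt i)) (rev [0..<r]) (fun_form f)"

definition lvert :: "nat \<Rightarrow> nat \<Rightarrow> lform \<Rightarrow> lform" where
  "lvert n r \<omega> gs z = sum' (\<lambda>(a, \<sigma>). wedge (Gam a \<sigma>) (\<lambda>hs. pd (X a \<sigma>) (\<omega> hs)) gs z)
     ({..<n} \<times> mindices r)"

text \<open>
  From \<open>D\<delta> = - \<delta>D\<close> on the functions \<open>x\<^sup>a\<^sub>\<sigma>\<close> one gets \<open>D\<Gamma>\<^sup>a\<^sub>\<sigma> = dt\<^sup>i \<Gamma>\<^sup>a\<^sub>i\<^sub>\<sigma>\<close>. Hence \<open>D = dt\<^sup>i D\<^sub>i\<close>, where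
  \<open>D\<^sub>i\<close> is extended from functions to forms as the derivation (of degree 0) with
  \<open>D\<^sub>i dt\<^sup>j = 0\<close> and \<open>D\<^sub>i \<Gamma>\<^sup>a\<^sub>\<sigma> = \<Gamma>\<^sup>a\<^sub>i\<^sub>\<sigma>\<close>.
\<close>

definition Dtot_form :: "nat \<Rightarrow> nat \<Rightarrow> nat \<Rightarrow> lform \<Rightarrow> lform" where
  "Dtot_form n r i \<omega> gs z = Dtot n r i (\<omega> gs) z +
     sum' (\<lambda>(a, \<sigma>). wedge (Gam a (add_mset i \<sigma>)) (gderiv (Gam a \<sigma>) \<omega>) gs z)
       ({..<n} \<times> mindices r)"

definition lhor :: "nat \<Rightarrow> nat \<Rightarrow> lform \<Rightarrow> lform" where
  "lhor n r \<omega> gs z = (\<Sum>i<r. wedge (Dt i) (Dtot_form n r i \<omega>) gs z)"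

text \<open>
  The coefficient \<open>B\<^sup>\<sigma>\<^sub>a\<close> of \<open>\<omega> = \<Sum> \<Gamma>\<^sup>a\<^sub>\<sigma> B\<^sup>\<sigma>\<^sub>a dt\<^sup>r \<dots> dt\<^sup>1\<close> is the value of \<open>\<omega>\<close> on the
  frame vectors dual to \<open>\<Gamma>\<^sup>a\<^sub>\<sigma>, dt\<^sup>r, \<dots>, dt\<^sup>1\<close>.
\<close>

definition lcanon :: "nat \<Rightarrow> nat \<Rightarrow> lform \<Rightarrow> lform" where
  "lcanon n r \<omega> gs z = (\<Sum>a<n. wedge (Gam a {#}) (lvol r (\<lambda>z'.
     sum' (\<lambda>\<sigma>. (-1) ^ size \<sigma> * Dtots n r \<sigma> (\<omega> (Gam a \<sigma> # map Dt (rev [0..<r]))) z')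
       (mindices r))) gs z)"

text \<open>
  Since \<open>\<omega>\<close> vanishes on lists with entries outside \<open>gens n r\<close>, the remaining generators of
  \<open>\<Omega>\<^sub>(\<^sub>r\<^sub>)\<close> go to the generators of \<open>\<Omega>\<^sub>(\<^sub>r\<^sub>+\<^sub>1\<^sub>)\<close> of the same name.
\<close>

definition lkappa :: "nat \<Rightarrow> nat \<Rightarrow> lform \<Rightarrow> lform" where
  "lkappa n r \<omega> = wedge (Dt r) (\<lambda>gs z.
     sum' (\<lambda>(a, \<sigma>). z (X a (add_mset r \<sigma>)) * gderiv (Gam a \<sigma>) \<omega> gs (proj n r z))
       ({..<n} \<times> mindices r))"

type_synonym 'm form = "'m chart \<Rightarrow> lform"

text \<open>Families of expressions are set to 0 outside their domain, so that equality in HOL is equality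
  of forms.\<close>

definition cut :: "'m mfd \<Rightarrow> nat \<Rightarrow> 'm form \<Rightarrow> 'm form" where
  "cut M r \<omega> c gs z =
    (if c \<in> atlas M \<and> z \<in> J M r c \<and> gs \<in> lists (gens (mdim M) r) then \<omega> c gs z else 0)"

definition vol_form :: "'m mfd \<Rightarrow> nat \<Rightarrow> ('m chart \<Rightarrow> pt \<Rightarrow> real) \<Rightarrow> 'm form" where
  "vol_form M r f = cut M r (\<lambda>c. lvol r (f c))"

definition vert :: "'m mfd \<Rightarrow> nat \<Rightarrow> 'm form \<Rightarrow> 'm form" where
  "vert M r \<omega> = cut M r (\<lambda>c. lvert (mdim M) r (\<omega> c))"

definition hor :: "'m mfd \<Rightarrow> nat \<Rightarrow> 'm form \<Rightarrow> 'm form" where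
  "hor M r \<omega> = cut M r (\<lambda>c. lhor (mdim M) r (\<omega> c))"

definition canon :: "'m mfd \<Rightarrow> nat \<Rightarrow> 'm form \<Rightarrow> 'm form" where
  "canon M r \<omega> = cut M r (\<lambda>c. lcanon (mdim M) r (\<omega> c))"

definition kappa :: "'m mfd \<Rightarrow> nat \<Rightarrow> 'm form \<Rightarrow> 'm form" where
  "kappa M r \<omega> = cut M (Suc r) (\<lambda>c. lkappa (mdim M) r (\<omega> c))"

text \<open>
  Under a change of charts \<open>dt'\<^sup>i = dt\<^sup>i\<close> and \<open>\<Gamma>'\<^sup>b\<^sub>\<tau> = \<delta>x'\<^sup>b\<^sub>\<tau> = \<Sum> (\<partial>x'\<^sup>b\<^sub>\<tau>/\<partial>x\<^sup>a\<^sub>\<sigma>) \<Gamma>\<^sup>a\<^sub>\<sigma>\<close>;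
  \<open>jac\<close> is the coefficient of the generator \<open>g\<close> of the first chart in the generator \<open>h\<close> of the second.
\<close>

fun jac :: "'m mfd \<Rightarrow> nat \<Rightarrow> 'm chart \<Rightarrow> 'm chart \<Rightarrow> gen \<Rightarrow> gen \<Rightarrow> pt \<Rightarrow> real" where
  "jac M r c c' (Dt j) (Dt i) z = (if i = j then 1 else 0)"
| "jac M r c c' (Gam b \<tau>) (Gam a \<sigma>) z = pd (X a \<sigma>) (\<lambda>w. transition M r c c' w (X b \<tau>)) z"
| "jac M r c c' _ _ z = 0"

text \<open>\<open>\<Omega>\<^sup>p\<^sup>,\<^sup>q\<close> for integers \<open>p\<close>, \<open>q\<close>; it is zero if one of them is negative.\<close>

definition forms :: "'m mfd \<Rightarrow> nat \<Rightarrow> int \<Rightarrow> int \<Rightarrow> 'm form set" where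
  "forms M r p q = {\<omega>.
     cut M r \<omega> = \<omega> \<and>
     (\<forall>c gs z. \<omega> c gs z \<noteq> 0 \<longrightarrow>
        int (length (filter (Not \<circ> is_Dt) gs)) = p \<and> int (length (filter is_Dt gs)) = q) \<and>
     (\<forall>c gs g h hs z. \<omega> c (gs @ g # h # hs) z = - \<omega> c (gs @ h # g # hs) z) \<and>
     (\<exists>k. \<forall>c \<in> atlas M. \<forall>gs. order_le k (J M r c) (\<omega> c gs) \<and>
        (\<forall>z a \<sigma>. Gam a \<sigma> \<in> set gs \<and> \<omega> c gs z \<noteq> 0 \<longrightarrow> size \<sigma> \<le> k)) \<and>
     (\<forall>c \<in> atlas M. \<forall>gs. smooth_on (jcoords (mdim M) r) (J M r c) (\<omega> c gs)) \<and>
     (\<forall>c \<in> atlas M. \<forall>c' \<in> atlas M. \<forall>(t, s) \<in> germs M r. s t \<in> fst c \<inter> fst c' \<longrightarrow>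
        (\<forall>gs \<in> lists (gens (mdim M) r).
           \<omega> c gs (jet M r c (t, s)) =
             sum' (\<lambda>hs. \<omega> c' hs (jet M r c' (t, s)) *
                 (\<Prod>j<length gs. jac M r c c' (hs ! j) (gs ! j) (jet M r c (t, s))))
               {hs \<in> lists (gens (mdim M) r). length hs = length gs}))}"

section \<open>Forms modulo horizontal coboundaries\<close>

definition hrel :: "'m mfd \<Rightarrow> nat \<Rightarrow> int \<Rightarrow> ('m form \<times> 'm form) set" where
  "hrel M r p = {(\<omega>, \<omega>'). \<omega> \<in> forms M r p (int r) \<and> \<omega>' \<in> forms M r p (int r) \<and>
     (\<exists>\<eta> \<in> forms M r p (int r - 1). \<forall>c gs z. \<omega>' c gs z = \<omega> c gs z + hor M r \<eta> c gs z)}"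

definition hclass :: "'m mfd \<Rightarrow> nat \<Rightarrow> int \<Rightarrow> 'm form \<Rightarrow> 'm form set" where
  "hclass M r p \<omega> = hrel M r p `` {\<omega>}"

text \<open>
  Maps on classes are defined by representatives: \<^term>\<open>the_elem\<close> picks the common value on all
  representatives of the class.
\<close>

definition vert_class :: "'m mfd \<Rightarrow> nat \<Rightarrow> int \<Rightarrow> 'm form set \<Rightarrow> 'm form set" where
  "vert_class M r p C = the_elem ((\<lambda>\<omega>. hclass M r (p + 1) (vert M r \<omega>)) ` C)"

definition rho :: "'m mfd \<Rightarrow> nat \<Rightarrow> 'm form set \<Rightarrow> 'm form" where
  "rho M r C = the_elem (canon M r ` C)"

definition chi :: "'m mfd \<Rightarrow> nat \<Rightarrow> 'm form set \<Rightarrow> 'm form" where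
  "chi M r = kappa M r \<circ> rho M r"

end

theory Submission
  imports Defs
begin

text \<open>
  In a chart \<open>\<delta>(L \<D>t)\<close> has the coefficients \<open>\<partial>L/\<partial>x\<^sup>a\<^sub>\<sigma>\<close>, its canonical representative is therefore
  \<open>\<Gamma>\<^sup>a \<F>\<^sub>a(L) \<D>t\<close>, and \<open>\<kappa>\<^sub>r\<close> replaces \<open>\<Gamma>\<^sup>a\<close> by \<open>dt\<^sup>r\<^sup>+\<^sup>1 x\<^sup>a\<^sub>r\<^sub>+\<^sub>1\<close>. The work lies in showing that the maps on
  classes are well defined. This needs that \<open>\<delta>\<close> maps global forms to global forms (chain rule for the
  change of charts), that \<open>D\<delta> = - \<delta>D\<close>, and that the Euler operator annihilates total divergences. The
  last two rest on \<open>[\<partial>/\<partial>x\<^sup>a\<^sub>\<sigma>, D\<^sub>i] = \<partial>/\<partial>x\<^sup>a\<^sub>\<sigma>\<^sub>-\<^sub>i\<close> and on \<open>D\<^sub>iD\<^sub>j = D\<^sub>jD\<^sub>i\<close>. Every jet lies on the jet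
  prolongation of a section, along which \<open>D\<^sub>i\<close> is the partial derivative by \<open>t\<^sup>i\<close>, so that the
  commutation of total derivatives is the symmetry of second derivatives.
\<close>

section \<open>Calculus of indexed variables\<close>

text \<open>The obstacle is that a jet has infinitely many coordinates. A chart domain of the jet
  space is given only as the set of jets of germs, and its openness is established in the form
  \<open>coord_open\<close>: finitely many coordinates may be moved at a time. All analysis
  therefore runs on functions of finite order. On a jet domain such a function depends on finitely
  many variables, and continuity of its partial derivatives makes it totally differentiable in them.
  This gives the chain rule both along sections, where the total derivatives arise, and through
  changes of charts. The order bound \<open>k\<close> is carried along everywhere because a
  \<open>sum'\<close> has to be cut down to a finite sum before it can be differentiated or
  regrouped. The locale \<open>jet_domain\<close> isolates what is used of the jet space over a
  chart; it is applied also to the overlap of two charts, where the transition functions live. Since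
  \<open>the_elem\<close> is determined only on singletons, the theorem hinges on the images of
  whole classes.\<close>

definition near :: "'i set \<Rightarrow> real \<Rightarrow> ('i \<Rightarrow> real) \<Rightarrow> ('i \<Rightarrow> real) \<Rightarrow> bool" where
  "near F e z z' \<longleftrightarrow> (\<forall>i. i \<notin> F \<longrightarrow> z' i = z i) \<and> (\<forall>i\<in>F. \<bar>z' i - z i\<bar> < e)"

text \<open>Weaker than openness in the product topology: \<open>e\<close> may depend on the finite
  set \<open>F\<close>, and nothing is said about moving infinitely many coordinates at once. It
  suffices for derivatives along coordinate lines and for boxes with finitely many sides.\<close>

definition coord_open :: "'i set \<Rightarrow> ('i \<Rightarrow> real) set \<Rightarrow> bool" where
  "coord_open I S \<longleftrightarrow> (\<forall>z\<in>S. \<forall>F. finite F \<longrightarrow> F \<subseteq> I \<longrightarrow> (\<exists>e>0. \<forall>z'. near F e z z' \<longrightarrow> z' \<in> S))"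

definition depends_on :: "'i set \<Rightarrow> ('i \<Rightarrow> real) set \<Rightarrow> (('i \<Rightarrow> real) \<Rightarrow> real) \<Rightarrow> bool" where
  "depends_on K S f \<longleftrightarrow> (\<forall>z\<in>S. \<forall>z'\<in>S. (\<forall>i\<in>K. z i = z' i) \<longrightarrow> f z = f z')"

lemma depends_onD:
  "depends_on K S f \<Longrightarrow> z \<in> S \<Longrightarrow> z' \<in> S \<Longrightarrow> (\<And>i. i \<in> K \<Longrightarrow> z i = z' i) \<Longrightarrow> f z = f z'"
  unfolding depends_on_def by blast

lemma coord_openD:
  assumes "coord_open I S" "z \<in> S" "finite F" "F \<subseteq> I"
  obtains e where "e > 0" "\<forall>z'. near F e z z' \<longrightarrow> z' \<in> S"
  using assms unfolding coord_open_def by blast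

lemma coord_open_line:
  assumes "coord_open I S" "z \<in> S" "i \<in> I"
  shows "eventually (\<lambda>s. z(i := s) \<in> S) (nhds (z i))"
proof -
  obtain e where e: "e > 0" "\<forall>z'. near {i} e z z' \<longrightarrow> z' \<in> S"
    by (rule coord_openD[OF assms(1,2), of "{i}"]) (use assms(3) in auto)
  have "z(i := s) \<in> S" if "\<bar>s - z i\<bar> < e" for s
    using e(2) that by (simp add: near_def)
  then show ?thesis
    unfolding eventually_nhds_metric dist_real_def using e(1) by blast
qed

text \<open>A partial derivative sees only a short piece of the coordinate line, and this piece
  stays in \<open>S\<close>.\<close>

lemma pd_cong:
  assumes "coord_open I S" "z \<in> S" "i \<in> I" "\<And>z. z \<in> S \<Longrightarrow> f z = g z"
  shows "pd i f z = pd i g z"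
  unfolding pd_def
  by (rule deriv_cong_ev[OF _ refl])
     (use coord_open_line[OF assms(1-3)] in \<open>eventually_elim, use assms(4) in auto\<close>)

lemma differentiable_line_cong:
  fixes f g :: "('i \<Rightarrow> real) \<Rightarrow> real"
  assumes "coord_open I S" "z \<in> S" "i \<in> I" "\<And>z. z \<in> S \<Longrightarrow> f z = g z"
    and "(\<lambda>s. f (z(i := s))) differentiable (at (z i))"
  shows "(\<lambda>s. g (z(i := s))) differentiable (at (z i))"
proof -
  obtain D where D: "((\<lambda>s. f (z(i := s))) has_real_derivative D) (at (z i))"
    using assms(5) unfolding real_differentiable_def by (elim exE)
  have "eventually (\<lambda>s. f (z(i := s)) = g (z(i := s))) (nhds (z i))"
    using coord_open_line[OF assms(1-3)] by eventually_elim (rule assms(4))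
  note DERIV_cong_ev[OF refl this refl, THEN iffD1, OF D]
  then show ?thesis
    unfolding real_differentiable_def by (rule exI)
qed

lemma DERIV_pd:
  "(\<lambda>s. f (z(i := s))) differentiable (at (z i)) \<Longrightarrow>
    ((\<lambda>s. f (z(i := s))) has_real_derivative pd i f z) (at (z i))"
  unfolding pd_def by (simp add: DERIV_deriv_iff_real_differentiable)

lemma pd_eqI: "((\<lambda>s. f (z(i := s))) has_real_derivative D) (at (z i)) \<Longrightarrow> pd i f z = D"
  unfolding pd_def by (rule DERIV_imp_deriv)

lemma pd_indep:
  assumes "eventually (\<lambda>s. f (z(i := s)) = f z) (nhds (z i))"
  shows "pd i f z = 0"
proof (rule pd_eqI)
  show "((\<lambda>s. f (z(i := s))) has_real_derivative 0) (at (z i))"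
    by (rule DERIV_cong_ev[OF refl assms refl, THEN iffD2]) simp
qed

lemma pd_const: "pd i (\<lambda>z. c) z = 0"
  by (rule pd_eqI) simp

lemma pd_coord: "pd i (\<lambda>z. z j) z = (if i = j then 1 else 0)"
  by (rule pd_eqI) (auto simp: fun_upd_def)

subsection \<open>Finite differentiability classes\<close>

text \<open>The grading permits induction: a derivative of a product or composite of class k+1 is
  built from functions of class k. \<open>Ck 0\<close> already contains the existence of the first
  partial derivatives, but their continuity comes only with \<open>Ck 1\<close>; this is why the
  chain rule asks for \<open>Ck 1\<close>.\<close>

fun Ck :: "nat \<Rightarrow> 'i set \<Rightarrow> ('i \<Rightarrow> real) set \<Rightarrow> (('i \<Rightarrow> real) \<Rightarrow> real) \<Rightarrow> bool" where
  "Ck 0 I S f \<longleftrightarrow> continuous_on S f \<and>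
     (\<forall>i\<in>I. \<forall>z\<in>S. (\<lambda>s. f (z(i := s))) differentiable (at (z i)))"
| "Ck (Suc k) I S f \<longleftrightarrow> Ck 0 I S f \<and> (\<forall>i\<in>I. Ck k I S (pd i f))"

lemma Ck_0: "Ck k I S f \<Longrightarrow> Ck 0 I S f"
  by (cases k) auto

lemma Ck_Suc: "Ck (Suc k) I S f \<Longrightarrow> Ck k I S f"
  by (induction k arbitrary: f) auto

lemma Ck_iff: "Ck k I S f \<longleftrightarrow> (\<forall>is\<in>lists I. length is \<le> k \<longrightarrow> Ck 0 I S (foldr pd is f))"
proof (induction k arbitrary: f)
  case 0
  then show ?case by auto
next
  case (Suc k)
  show ?case
  proof
    assume f: "Ck (Suc k) I S f"
    show "\<forall>is\<in>lists I. length is \<le> Suc k \<longrightarrow> Ck 0 I S (foldr pd is f)"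
    proof (intro ballI impI)
      fix "is" assume "is \<in> lists I" "length is \<le> Suc k"
      then show "Ck 0 I S (foldr pd is f)"
      \<comment> \<open>\<open>foldr\<close> applies the last entry of the list first, and
        \<open>Ck\<close> also peels off the innermost derivative.\<close>
      proof (cases "is" rule: rev_cases)
        case Nil
        then show ?thesis using f by simp
      next
        case (snoc js j)
        then have "Ck k I S (pd j f)" "js \<in> lists I" "length js \<le> k"
          using f \<open>is \<in> lists I\<close> \<open>length is \<le> Suc k\<close> by auto
        then show ?thesis using Suc.IH snoc by auto
      qed
    qed
  next
    assume *: "\<forall>is\<in>lists I. length is \<le> Suc k \<longrightarrow> Ck 0 I S (foldr pd is f)"
    have "Ck 0 I S f" using *[rule_format, of "[]"] by simp
    moreover have "Ck k I S (pd i f)" if "i \<in> I" for i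
      unfolding Suc.IH
    proof (intro ballI impI)
      fix "is" assume "is \<in> lists I" "length is \<le> k"
      then show "Ck 0 I S (foldr pd is (pd i f))"
        using *[rule_format, of "is @ [i]"] that by auto
    qed
    ultimately show "Ck (Suc k) I S f" by simp
  qed
qed

lemma smooth_on_iff: "smooth_on I S f \<longleftrightarrow> (\<forall>k. Ck k I S f)"
proof
  assume "smooth_on I S f"
  then show "\<forall>k. Ck k I S f"
    unfolding Ck_iff[of _ I S f] smooth_on_def by simp
next
  assume *: "\<forall>k. Ck k I S f"
  have "Ck 0 I S (foldr pd is f)" if "is \<in> lists I" for "is"
    using *[rule_format, of "length is"] that unfolding Ck_iff[of _ I S f] by blast
  then show "smooth_on I S f" unfolding smooth_on_def by simp
qed

lemma smooth_onI: "(\<And>k. Ck k I S f) \<Longrightarrow> smooth_on I S f"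
  by (simp add: smooth_on_iff)

lemma smooth_onD: "smooth_on I S f \<Longrightarrow> Ck k I S f"
  by (simp add: smooth_on_iff)

lemma smooth_on_pd: "smooth_on I S f \<Longrightarrow> i \<in> I \<Longrightarrow> smooth_on I S (pd i f)"
  unfolding smooth_on_iff by (metis Ck.simps(2))

lemma smooth_on_pds: "smooth_on I S f \<Longrightarrow> is \<in> lists I \<Longrightarrow> smooth_on I S (foldr pd is f)"
  by (induction "is") (auto intro: smooth_on_pd)

lemma smooth_on_continuous: "smooth_on I S f \<Longrightarrow> continuous_on S f"
  using smooth_onD[of I S f 0] by simp

lemma smooth_on_DERIV:
  "smooth_on I S f \<Longrightarrow> i \<in> I \<Longrightarrow> z \<in> S \<Longrightarrow>
    ((\<lambda>s. f (z(i := s))) has_real_derivative pd i f z) (at (z i))"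
  using smooth_onD[of I S f 0] by (auto intro: DERIV_pd)

lemma smooth_on_DERIV_at:
  "smooth_on I S f \<Longrightarrow> i \<in> I \<Longrightarrow> z(i := x) \<in> S \<Longrightarrow>
    ((\<lambda>s. f (z(i := s))) has_real_derivative pd i f (z(i := x))) (at x)"
  using smooth_on_DERIV[of I S f i "z(i := x)"] by simp

lemma Ck_cong_imp:
  assumes "coord_open I S" "\<And>z. z \<in> S \<Longrightarrow> f z = g z" "Ck k I S f"
  shows "Ck k I S g"
  using assms(2,3)
proof (induction k arbitrary: f g)
  case 0
  then show ?case
    using differentiable_line_cong[OF assms(1), of _ _ f g] by (auto cong: continuous_on_cong)
next
  case (Suc k)
  have "Ck 0 I S g"
    using Suc.prems differentiable_line_cong[OF assms(1), of _ _ f g]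
    by (auto cong: continuous_on_cong)
  moreover have "Ck k I S (pd i g)" if "i \<in> I" for i
    by (rule Suc.IH[of "pd i f"])
       (use Suc.prems that pd_cong[OF assms(1) _ that, of _ f g] in auto)
  ultimately show ?case by simp
qed

lemma smooth_on_cong:
  assumes "coord_open I S" "\<And>z. z \<in> S \<Longrightarrow> f z = g z" "smooth_on I S f"
  shows "smooth_on I S g"
  using assms Ck_cong_imp unfolding smooth_on_iff by blast

lemma Ck_const: "Ck k I S (\<lambda>z. c)"
proof (induction k arbitrary: c)
  case (Suc k)
  have "pd i (\<lambda>z. c) = (\<lambda>z. 0)" for i :: 'a and c :: real by (intro ext pd_const)
  then show ?case using Suc by auto
qed auto

lemma smooth_on_const: "smooth_on I S (\<lambda>z. c)"
  by (simp add: smooth_onI Ck_const)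

lemma smooth_on_coord: "smooth_on I S (\<lambda>z. z j)"
proof (rule smooth_onI)
  fix k
  have "continuous_on S (\<lambda>z::'a \<Rightarrow> real. z j)"
    by (rule continuous_on_subset[OF continuous_on_product_coordinates subset_UNIV])
  moreover have "(\<lambda>s. (z(i := s)) j) differentiable (at (z i))" for i and z :: "'a \<Rightarrow> real"
    by (cases "i = j") auto
  moreover have "pd i (\<lambda>z. z j) = (\<lambda>z. if i = j then 1 else 0)" for i
    by (intro ext pd_coord)
  ultimately show "Ck k I S (\<lambda>z. z j)"
    using Ck_const[of _ I S 1] Ck_const[of _ I S 0] by (cases k) auto
qed

lemma Ck_pd: "Ck 0 I S f \<Longrightarrow> i \<in> I \<Longrightarrow> z \<in> S \<Longrightarrow>
    ((\<lambda>s. f (z(i := s))) has_real_derivative pd i f z) (at (z i))"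
  by (auto intro: DERIV_pd)

lemma pd_add:
  assumes "Ck 0 I S f" "Ck 0 I S g" "i \<in> I" "z \<in> S"
  shows "pd i (\<lambda>z. f z + g z) z = pd i f z + pd i g z"
  by (rule pd_eqI) (intro DERIV_add Ck_pd[OF assms(1,3,4)] Ck_pd[OF assms(2,3,4)])

lemma pd_mult:
  assumes "Ck 0 I S f" "Ck 0 I S g" "i \<in> I" "z \<in> S"
  shows "pd i (\<lambda>z. f z * g z) z = pd i f z * g z + f z * pd i g z"
  by (rule pd_eqI)
     (use DERIV_mult[OF Ck_pd[OF assms(1,3,4)] Ck_pd[OF assms(2,3,4)]] in \<open>simp add: algebra_simps\<close>)

lemma Ck_add:
  assumes "coord_open I S" "Ck k I S f" "Ck k I S g"
  shows "Ck k I S (\<lambda>z. f z + g z)"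
  using assms(2,3)
proof (induction k arbitrary: f g)
  case 0
  then show ?case by (auto intro: continuous_on_add differentiable_add)
next
  case (Suc k)
  have "Ck k I S (pd i (\<lambda>z. f z + g z))" if "i \<in> I" for i
    by (rule Ck_cong_imp[OF assms(1), of "\<lambda>z. pd i f z + pd i g z"])
       (use Suc that in \<open>auto simp: pd_add[where I=I and S=S]\<close>)
  with Suc.prems show ?case by (auto intro: continuous_on_add differentiable_add)
qed

lemma Ck_mult:
  assumes "coord_open I S" "Ck k I S f" "Ck k I S g"
  shows "Ck k I S (\<lambda>z. f z * g z)"
  using assms(2,3)
proof (induction k arbitrary: f g)
  case 0
  then show ?case by (auto intro: continuous_on_mult differentiable_mult)
next
  case (Suc k)
  have "Ck k I S (pd i (\<lambda>z. f z * g z))" if "i \<in> I" for i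
  proof (rule Ck_cong_imp[OF assms(1), of "\<lambda>z. pd i f z * g z + f z * pd i g z"])
    show "Ck k I S (\<lambda>z. pd i f z * g z + f z * pd i g z)"
      using Suc.prems that Ck_Suc by (intro Ck_add[OF assms(1)] Suc.IH) auto
  qed (use Suc.prems that in \<open>auto simp: pd_mult[where I=I and S=S]\<close>)
  with Suc.prems show ?case by (auto intro: continuous_on_mult differentiable_mult)
qed

lemma Ck_sum:
  assumes "coord_open I S" "finite A" "\<And>a. a \<in> A \<Longrightarrow> Ck k I S (f a)"
  shows "Ck k I S (\<lambda>z. \<Sum>a\<in>A. f a z)"
  using assms(2,3)
  by (induction A rule: finite_induct) (auto intro!: Ck_const Ck_add assms(1))

lemma smooth_on_add:
  "coord_open I S \<Longrightarrow> smooth_on I S f \<Longrightarrow> smooth_on I S g \<Longrightarrow> smooth_on I S (\<lambda>z. f z + g z)"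
  by (simp add: smooth_on_iff Ck_add)

lemma smooth_on_mult:
  "coord_open I S \<Longrightarrow> smooth_on I S f \<Longrightarrow> smooth_on I S g \<Longrightarrow> smooth_on I S (\<lambda>z. f z * g z)"
  by (simp add: smooth_on_iff Ck_mult)

lemma smooth_on_cmult:
  "coord_open I S \<Longrightarrow> smooth_on I S f \<Longrightarrow> smooth_on I S (\<lambda>z. c * f z)"
  using smooth_on_mult[OF _ smooth_on_const] by blast

lemma pd_cmult:
  assumes "Ck 0 I S f" "i \<in> I" "z \<in> S"
  shows "pd i (\<lambda>z. c * f z) z = c * pd i f z"
  by (rule pd_eqI) (intro DERIV_cmult Ck_pd[OF assms])

lemma pd_sum:
  assumes "\<And>a. a \<in> A \<Longrightarrow> Ck 0 I S (f a)" "i \<in> I" "z \<in> S"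
  shows "pd i (\<lambda>z. \<Sum>a\<in>A. f a z) z = (\<Sum>a\<in>A. pd i (f a) z)"
  by (rule pd_eqI) (rule DERIV_sum, rule Ck_pd[OF assms(1)], use assms in auto)

subsection \<open>Chain rule\<close>

text \<open>Link between the product topology and finite perturbations: a basic open box contains an
  interval around \<open>z i\<close> in each of the finitely many directions in \<open>F\<close>,
  and the other coordinates do not move.\<close>

lemma open_near:
  fixes z :: "'i \<Rightarrow> real"
  assumes "open A" "z \<in> A" "finite F"
  shows "\<exists>d>0. \<forall>z'. near F d z z' \<longrightarrow> z' \<in> A"
proof -
  have "\<exists>X. z \<in> Pi\<^sub>E UNIV X \<and> (\<forall>i. openin euclidean (X i)) \<and>
      finite {i. X i \<noteq> topspace euclidean} \<and> Pi\<^sub>E UNIV X \<subseteq> A"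
    by (rule product_topology_open_contains_basis[OF assms(1)[unfolded open_fun_def] assms(2)])
  then obtain X where X': "z \<in> Pi\<^sub>E UNIV X" "\<forall>i. openin euclidean (X i)"
    "finite {i. X i \<noteq> topspace euclidean}" "Pi\<^sub>E UNIV X \<subseteq> A"
    by (elim exE conjE) (rule that)
  have X: "z i \<in> X i" "open (X i)" for i
    using X'(1,2) by (auto simp: PiE_iff)
  have "\<exists>d>0. \<forall>i\<in>F. ball (z i) d \<subseteq> X i"
    using \<open>finite F\<close>
  proof (induction F rule: finite_induct)
    case (insert i F)
    then obtain d where "d > 0" "\<forall>i\<in>F. ball (z i) d \<subseteq> X i" by auto
    moreover obtain d' where "d' > 0" "ball (z i) d' \<subseteq> X i"
      using X(1,2) by (meson openE)
    ultimately show ?case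
      by (intro exI[of _ "min d d'"]) (auto simp: subset_eq)
  qed (auto intro: exI[of _ 1])
  then obtain d where d: "d > 0" "\<And>i. i \<in> F \<Longrightarrow> ball (z i) d \<subseteq> X i" by blast
  have "z' \<in> A" if z': "near F d z z'" for z'
  proof -
    have "z' i \<in> X i" for i
    proof (cases "i \<in> F")
      case True
      then have "z' i \<in> ball (z i) d" using z' by (simp add: near_def dist_real_def abs_minus_commute)
      then show ?thesis using d True by blast
    next
      case False
      then show ?thesis using z' X(1) by (auto simp: near_def)
    qed
    then show "z' \<in> A" using X'(4) by (auto simp: PiE_UNIV_domain)
  qed
  then show ?thesis using d(1) by blast
qed

lemma continuous_on_box:
  fixes g :: "('i \<Rightarrow> real) \<Rightarrow> real"
  assumes "continuous_on S g" "z \<in> S" "finite F" "e > 0"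
  obtains d where "d > 0" "\<forall>z'\<in>S. near F d z z' \<longrightarrow> \<bar>g z' - g z\<bar> < e"
proof -
  have "\<exists>A. open A \<and> z \<in> A \<and> (\<forall>y\<in>S. y \<in> A \<longrightarrow> g y \<in> ball (g z) e)"
    using assms(1)[unfolded continuous_on_topological, rule_format, OF assms(2) open_ball, of "g z" e]
      assms(4) by simp
  then obtain A where A: "open A" "z \<in> A" "\<forall>y\<in>S. y \<in> A \<longrightarrow> g y \<in> ball (g z) e"
    by (elim exE conjE)
  obtain d where d: "d > 0" "\<forall>z'. near F d z z' \<longrightarrow> z' \<in> A"
    using open_near[OF A(1,2) assms(3)] by blast
  show thesis
  proof (rule that[OF d(1)], intro ballI impI)
    fix z' assume "z' \<in> S" "near F d z z'"
    then have "g z' \<in> ball (g z) e" using d(2) A(3) by blast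
    then show "\<bar>g z' - g z\<bar> < e" by (simp add: dist_real_def abs_minus_commute)
  qed
qed

text \<open>Continuous partial derivatives imply total differentiability. The coordinates in
  \<open>F\<close> are changed one after the other; each change costs an error controlled by the
  mean value inequality and the continuity of the corresponding partial derivative at
  \<open>z\<close>.\<close>

lemma Ck1_linear_approx:
  fixes f :: "('i \<Rightarrow> real) \<Rightarrow> real"
  assumes S: "coord_open I S" "z \<in> S" and f: "Ck 1 I S f" and F: "finite F" "F \<subseteq> I" and e: "e > 0"
  shows "\<exists>d>0. \<forall>z'. near F d z z' \<longrightarrow>
    \<bar>f z' - f z - (\<Sum>i\<in>F. pd i f z * (z' i - z i))\<bar> \<le> e * (\<Sum>i\<in>F. \<bar>z' i - z i\<bar>)"
  using F
proof (induction F rule: finite_induct)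
  case empty
  then show ?case by (auto intro!: exI[of _ 1] simp: near_def fun_eq_iff[symmetric])
next
  case (insert j F)
  then obtain d1 where d1: "d1 > 0" "\<forall>z'. near F d1 z z' \<longrightarrow>
    \<bar>f z' - f z - (\<Sum>i\<in>F. pd i f z * (z' i - z i))\<bar> \<le> e * (\<Sum>i\<in>F. \<bar>z' i - z i\<bar>)"
    by auto
  have j: "j \<in> I" using insert by auto
  have finj: "finite (insert j F)" using insert.hyps by simp
  obtain d2 where d2: "d2 > 0"
    "\<forall>z'. near (insert j F) d2 z z' \<longrightarrow> z' \<in> S"
    by (rule coord_openD[OF S finj insert.prems])
  have cont: "continuous_on S (pd j f)" using f j by simp
  obtain d3 where d3: "d3 > 0"
    "\<forall>z'\<in>S. near (insert j F) d3 z z' \<longrightarrow> \<bar>pd j f z' - pd j f z\<bar> < e"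
    by (rule continuous_on_box[OF cont S(2) finj e])
  let ?d = "min d1 (min d2 d3)"
  show ?case
  proof (intro exI[of _ ?d] conjI allI impI)
    show "?d > 0" using d1 d2 d3 by simp
    fix z' assume "near (insert j F) ?d z z'"
    then have off: "\<forall>i. i \<notin> insert j F \<longrightarrow> z' i = z i" and on: "\<forall>i\<in>insert j F. \<bar>z' i - z i\<bar> < ?d"
      by (auto simp: near_def)
    \<comment> \<open>With coordinate \<open>j\<close> put back, \<open>w\<close> differs from
      \<open>z\<close> only inside \<open>F\<close> and falls under the induction hypothesis. What
      remains is the segment from \<open>w\<close> to \<open>z'\<close> in direction
      \<open>j\<close>.\<close>
    define w where "w = z'(j := z j)"
    have w: "\<bar>f w - f z - (\<Sum>i\<in>F. pd i f z * (w i - z i))\<bar> \<le> e * (\<Sum>i\<in>F. \<bar>w i - z i\<bar>)"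
      by (rule d1(2)[rule_format]) (use off on in \<open>auto simp: near_def w_def\<close>)
    have wz: "w i = z' i" if "i \<in> F" for i using that insert by (auto simp: w_def)
    define C where "C = {s. \<bar>s - z j\<bar> < ?d}"
    have C: "C = ball (z j) ?d" by (auto simp: C_def dist_real_def)
    have box: "z'(j := s) \<in> S" "\<bar>pd j f (z'(j := s)) - pd j f z\<bar> < e" if "s \<in> C" for s
    proof -
      show "z'(j := s) \<in> S"
        by (rule d2(2)[rule_format]) (use that off on in \<open>auto simp: near_def C_def\<close>)
      then show "\<bar>pd j f (z'(j := s)) - pd j f z\<bar> < e"
        by (rule d3(2)[rule_format]) (use that off on in \<open>auto simp: near_def C_def\<close>)
    qed
    \<comment> \<open>The linear part at \<open>z\<close> is subtracted, so the derivative of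
      \<open>h\<close> is the deviation of \<open>pd j f\<close> from its value at \<open>z\<close>,
      which is below \<open>e\<close> on \<open>C\<close>.\<close>
    define h where "h s = f (z'(j := s)) - pd j f z * s" for s
    have "norm (h (z' j) - h (z j)) \<le> e * norm (z' j - z j)"
    proof (rule field_differentiable_bound[where S = C])
      show "convex C" unfolding C by (rule convex_ball)
      fix s assume s: "s \<in> C"
      have "((\<lambda>s. f (z'(j := s))) has_real_derivative pd j f (z'(j := s))) (at s)"
        using Ck_pd[of I S f j "z'(j := s)"] f box(1)[OF s] j by simp
      then show "(h has_field_derivative pd j f (z'(j := s)) - pd j f z) (at s within C)"
        unfolding h_def by (auto intro!: derivative_eq_intros intro: has_field_derivative_at_within)
      show "norm (pd j f (z'(j := s)) - pd j f z) \<le> e" using box(2)[OF s] by simp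
    qed (use on d1 d2 d3 in \<open>auto simp: C_def\<close>)
    then have "\<bar>f z' - f w - pd j f z * (z' j - z j)\<bar> \<le> e * \<bar>z' j - z j\<bar>"
      by (simp add: h_def w_def algebra_simps)
    with w have "\<bar>f z' - f z - (pd j f z * (z' j - z j) + (\<Sum>i\<in>F. pd i f z * (z' i - z i)))\<bar>
        \<le> e * \<bar>z' j - z j\<bar> + e * (\<Sum>i\<in>F. \<bar>z' i - z i\<bar>)"
      using wz by simp
    then show "\<bar>f z' - f z - (\<Sum>i\<in>insert j F. pd i f z * (z' i - z i))\<bar>
        \<le> e * (\<Sum>i\<in>insert j F. \<bar>z' i - z i\<bar>)"
      using insert by (simp add: algebra_simps)
  qed
qed

text \<open>\<open>f\<close> is totally differentiable in the finitely many variables on which it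
  depends, and the difference quotients of the curve converge in these variables, so the linear
  approximation passes to the limit.\<close>

lemma chain_rule:
  fixes f :: "('i \<Rightarrow> real) \<Rightarrow> real" and \<gamma> :: "real \<Rightarrow> 'i \<Rightarrow> real"
  assumes S: "coord_open I S" and f: "Ck 1 I S f" and F: "finite F" "F \<subseteq> I" and dep: "depends_on F S f"
    and \<gamma>: "eventually (\<lambda>s. \<gamma> s \<in> S) (nhds x)"
    and D: "\<And>i. i \<in> F \<Longrightarrow> ((\<lambda>s. \<gamma> s i) has_real_derivative g i) (at x)"
  shows "((\<lambda>s. f (\<gamma> s)) has_real_derivative (\<Sum>i\<in>F. pd i f (\<gamma> x) * g i)) (at x)"
proof -
  let ?z = "\<gamma> x"
  have z: "?z \<in> S" using eventually_nhds_x_imp_x[OF \<gamma>] .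
  let ?q = "\<lambda>i s. (\<gamma> s i - \<gamma> x i) / (s - x)"
  have q: "(?q i \<longlongrightarrow> g i) (at x)" if "i \<in> F" for i
    using D[OF that] by (simp add: has_field_derivative_iff)
  \<comment> \<open>The curve may move in infinitely many coordinates, which
    \<open>coord_open\<close> does not control. \<open>\<gamma>'\<close> moves only in
    \<open>F\<close>, stays in \<open>S\<close> near \<open>x\<close>, and gives the same values of
    \<open>f\<close>.\<close>
  define \<gamma>' where "\<gamma>' s = (\<lambda>i. if i \<in> F then \<gamma> s i else ?z i)" for s
  obtain e0 where e0: "e0 > 0" "\<forall>z'. near F e0 ?z z' \<longrightarrow> z' \<in> S"
    by (rule coord_openD[OF S z F])
  have close: "eventually (\<lambda>s. \<forall>i\<in>F. \<bar>\<gamma>' s i - ?z i\<bar> < d) (at x)" if "d > 0" for d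
  proof -
    have "eventually (\<lambda>s. \<bar>\<gamma> s i - ?z i\<bar> < d) (at x)" if i: "i \<in> F" for i
    proof -
      have "((\<lambda>s. \<gamma> s i) \<longlongrightarrow> ?z i) (at x)"
        using DERIV_isCont[OF D[OF i]] by (simp add: isCont_def)
      from tendstoD[OF this \<open>d > 0\<close>] show ?thesis by (simp add: dist_real_def)
    qed
    then have "eventually (\<lambda>s. \<forall>i\<in>F. \<bar>\<gamma> s i - ?z i\<bar> < d) (at x)"
      using F(1) by (simp add: eventually_ball_finite)
    then show ?thesis by (simp add: \<gamma>'_def)
  qed
  have eq: "eventually (\<lambda>s. f (\<gamma> s) = f (\<gamma>' s)) (at x)"
    using close[OF e0(1)] \<gamma>[THEN filter_leD[OF at_within_le_nhds]]
  proof eventually_elim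
    case (elim s)
    have "\<gamma>' s \<in> S" by (rule e0(2)[rule_format]) (use elim in \<open>auto simp: near_def \<gamma>'_def\<close>)
    moreover have "\<forall>i\<in>F. \<gamma> s i = \<gamma>' s i" by (simp add: \<gamma>'_def)
    ultimately show ?case using dep[unfolded depends_on_def] elim(2) by blast
  qed
  have lim: "((\<lambda>s. (f (\<gamma> s) - f ?z) / (s - x) - (\<Sum>i\<in>F. pd i f ?z * ?q i s)) \<longlongrightarrow> 0) (at x)"
  proof (rule tendstoI)
    fix e :: real assume e: "e > 0"
    \<comment> \<open>The sum of the absolute difference quotients converges to the sum of the
      \<open>\<bar>g i\<bar>\<close>. The extra 1 keeps it eventually strictly below
      \<open>?C\<close> and makes \<open>?C\<close> positive even if all \<open>g i\<close>
      vanish.\<close>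
    let ?C = "(\<Sum>i\<in>F. \<bar>g i\<bar>) + 1"
    have C: "?C > 0" by (smt (verit) sum_nonneg abs_ge_zero)
    have bd: "eventually (\<lambda>s. (\<Sum>i\<in>F. \<bar>?q i s\<bar>) < ?C) (at x)"
    proof -
      have "((\<lambda>s. \<Sum>i\<in>F. \<bar>?q i s\<bar>) \<longlongrightarrow> (\<Sum>i\<in>F. \<bar>g i\<bar>)) (at x)"
        by (intro tendsto_sum tendsto_rabs q)
      then show ?thesis by (rule order_tendstoD) simp
    qed
    have "e / ?C > 0" using e C by simp
    from Ck1_linear_approx[OF S z f F this] obtain d where d: "d > 0"
      "\<forall>z'. near F d ?z z' \<longrightarrow>
        \<bar>f z' - f ?z - (\<Sum>i\<in>F. pd i f ?z * (z' i - ?z i))\<bar> \<le> e / ?C * (\<Sum>i\<in>F. \<bar>z' i - ?z i\<bar>)"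
      by blast
    have ne: "eventually (\<lambda>s. s \<noteq> x) (at x)" by (simp add: eventually_at_filter)
    show "eventually (\<lambda>s. dist ((f (\<gamma> s) - f ?z) / (s - x) - (\<Sum>i\<in>F. pd i f ?z * ?q i s)) 0 < e) (at x)"
      using eq bd close[OF d(1)] ne
    proof eventually_elim
      case (elim s)
      let ?A = "f (\<gamma> s) - f ?z - (\<Sum>i\<in>F. pd i f ?z * (\<gamma> s i - ?z i))"
      have "\<bar>f (\<gamma>' s) - f ?z - (\<Sum>i\<in>F. pd i f ?z * (\<gamma>' s i - ?z i))\<bar>
          \<le> e / ?C * (\<Sum>i\<in>F. \<bar>\<gamma>' s i - ?z i\<bar>)"
        by (rule d(2)[rule_format]) (use elim in \<open>auto simp: near_def \<gamma>'_def\<close>)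
      then have A: "\<bar>?A\<bar> \<le> e / ?C * (\<Sum>i\<in>F. \<bar>\<gamma> s i - ?z i\<bar>)"
        using elim(1) by (simp add: \<gamma>'_def)
      have "(\<Sum>i\<in>F. \<bar>\<gamma> s i - ?z i\<bar>) = (\<Sum>i\<in>F. \<bar>?q i s\<bar>) * \<bar>s - x\<bar>"
        using elim(4) by (simp add: sum_distrib_right)
      also have "\<dots> < ?C * \<bar>s - x\<bar>" using elim by (intro mult_strict_right_mono) auto
      finally have "e / ?C * (\<Sum>i\<in>F. \<bar>\<gamma> s i - ?z i\<bar>) < e / ?C * (?C * \<bar>s - x\<bar>)"
        using e C by (intro mult_strict_left_mono) auto
      also have "\<dots> = e * \<bar>s - x\<bar>" using C by simp
      finally have "\<bar>?A\<bar> < e * \<bar>s - x\<bar>" using A by linarith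
      then have "\<bar>?A / (s - x)\<bar> < e" using elim(4) by (simp add: abs_divide field_simps)
      moreover have "?A / (s - x) = (f (\<gamma> s) - f ?z) / (s - x) - (\<Sum>i\<in>F. pd i f ?z * ?q i s)"
        by (simp add: diff_divide_distrib sum_divide_distrib right_diff_distrib)
      ultimately show ?case by simp
    qed
  qed
  have "((\<lambda>s. \<Sum>i\<in>F. pd i f ?z * ?q i s) \<longlongrightarrow> (\<Sum>i\<in>F. pd i f ?z * g i)) (at x)"
    by (intro tendsto_sum tendsto_mult tendsto_const q)
  from tendsto_add[OF lim this] show ?thesis
    by (simp add: has_field_derivative_iff)
qed

lemma pd_comp:
  fixes f :: "('j \<Rightarrow> real) \<Rightarrow> real" and \<gamma> :: "('i \<Rightarrow> real) \<Rightarrow> 'j \<Rightarrow> real"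
  assumes S: "coord_open K S" and f: "Ck 1 K S f" and F: "finite F" "F \<subseteq> K" and dep: "depends_on F S f"
    and W: "coord_open I W" and \<gamma>: "\<And>u. u \<in> W \<Longrightarrow> \<gamma> u \<in> S"
    and D: "\<And>j. j \<in> F \<Longrightarrow> Ck 0 I W (\<lambda>u. \<gamma> u j)" and u: "u \<in> W" "i \<in> I"
  shows "((\<lambda>s. f (\<gamma> (u(i := s)))) has_real_derivative (\<Sum>j\<in>F. pd j f (\<gamma> u) * pd i (\<lambda>u. \<gamma> u j) u)) (at (u i))"
    and "pd i (\<lambda>u. f (\<gamma> u)) u = (\<Sum>j\<in>F. pd j f (\<gamma> u) * pd i (\<lambda>u. \<gamma> u j) u)"
proof -
  have "((\<lambda>s. f (\<gamma> (u(i := s)))) has_real_derivative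
      (\<Sum>j\<in>F. pd j f (\<gamma> (u(i := u i))) * pd i (\<lambda>u. \<gamma> u j) u)) (at (u i))"
  proof (rule chain_rule[OF S f F dep])
    show "eventually (\<lambda>s. \<gamma> (u(i := s)) \<in> S) (nhds (u i))"
      using coord_open_line[OF W u] by eventually_elim (rule \<gamma>)
  qed (rule Ck_pd[where f="\<lambda>u. \<gamma> u j" for j, OF D u(2,1)])
  then show 1: "((\<lambda>s. f (\<gamma> (u(i := s)))) has_real_derivative
      (\<Sum>j\<in>F. pd j f (\<gamma> u) * pd i (\<lambda>u. \<gamma> u j) u)) (at (u i))" by simp
  show "pd i (\<lambda>u. f (\<gamma> u)) u = (\<Sum>j\<in>F. pd j f (\<gamma> u) * pd i (\<lambda>u. \<gamma> u j) u)"
    by (rule pd_eqI[OF 1])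
qed

text \<open>For \<open>i\<close> in \<open>K\<close> both coordinate lines carry the same values of
  \<open>f\<close> at equal parameters; for \<open>i\<close> outside \<open>K\<close> the function
  is constant along the line and both derivatives are 0.\<close>

lemma depends_on_pd:
  assumes "coord_open I S" "depends_on K S f" "i \<in> I"
  shows "depends_on K S (pd i f)"
  unfolding depends_on_def
proof (intro ballI impI)
  fix z z' assume z: "z \<in> S" "z' \<in> S" and eq: "\<forall>i\<in>K. z i = z' i"
  note l = coord_open_line[OF assms(1) z(1) assms(3)] coord_open_line[OF assms(1) z(2) assms(3)]
  show "pd i f z = pd i f z'"
  proof (cases "i \<in> K")
    case True
    have "eventually (\<lambda>s. f (z(i := s)) = f (z'(i := s))) (nhds (z i))"
      using l(1) l(2)[folded eq[rule_format, OF True]]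
      by eventually_elim (rule depends_onD[OF assms(2)], use eq in auto)
    then show ?thesis unfolding pd_def by (rule deriv_cong_ev) (use eq True in auto)
  next
    case False
    have "pd i f z = 0" if "z \<in> S" for z
    proof (rule pd_indep)
      show "eventually (\<lambda>s. f (z(i := s)) = f z) (nhds (z i))"
        using coord_open_line[OF assms(1) that assms(3)]
        by eventually_elim (rule depends_onD[OF assms(2)], use that False in auto)
    qed
    then show ?thesis using z by simp
  qed
qed

lemma pd_depends_on_zero:
  assumes "coord_open I S" "depends_on K S f" "i \<in> I" "i \<notin> K" "z \<in> S"
  shows "pd i f z = 0"
proof (rule pd_indep)
  show "eventually (\<lambda>s. f (z(i := s)) = f z) (nhds (z i))"
    using coord_open_line[OF assms(1) assms(5,3)]
    by eventually_elim (rule depends_onD[OF assms(2)], use assms(4,5) in auto)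
qed

text \<open>Induction on \<open>k\<close> with \<open>f\<close> generalised: the chain rule
  expresses a derivative of the composite through \<open>pd j f\<close> composed with
  \<open>\<gamma>\<close>, and \<open>pd j f\<close> is again smooth and dependent on
  \<open>F\<close> only.\<close>

lemma Ck_comp:
  fixes f :: "('j \<Rightarrow> real) \<Rightarrow> real" and \<gamma> :: "('i \<Rightarrow> real) \<Rightarrow> 'j \<Rightarrow> real"
  assumes S: "coord_open K S" and F: "finite F" "F \<subseteq> K"
    and W: "coord_open I W" and \<gamma>: "\<And>u. u \<in> W \<Longrightarrow> \<gamma> u \<in> S" "continuous_on W \<gamma>"
    and f: "smooth_on K S f" "depends_on F S f"
    and D: "\<And>j. j \<in> F \<Longrightarrow> smooth_on I W (\<lambda>u. \<gamma> u j)"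
  shows "Ck k I W (\<lambda>u. f (\<gamma> u))"
  using f
proof (induction k arbitrary: f)
  case base: 0
  note pd = pd_comp(1)[OF S smooth_onD[OF base(1)] F base(2) W \<gamma>(1) smooth_onD[OF D]]
  show ?case
    using pd \<gamma> continuous_on_compose2[OF smooth_on_continuous[OF base(1)] \<gamma>(2)]
    by (auto simp: real_differentiable_def)
next
  case (Suc k)
  note pd = pd_comp[OF S smooth_onD[OF Suc.prems(1)] F Suc.prems(2) W \<gamma>(1) smooth_onD[OF D]]
  have "Ck k I W (pd i (\<lambda>u. f (\<gamma> u)))" if "i \<in> I" for i
  proof (rule Ck_cong_imp[OF W])
    show "Ck k I W (\<lambda>u. \<Sum>j\<in>F. pd j f (\<gamma> u) * pd i (\<lambda>u. \<gamma> u j) u)"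
    proof (intro Ck_sum Ck_mult W F(1))
      fix j assume j: "j \<in> F"
      show "Ck k I W (\<lambda>u. pd j f (\<gamma> u))"
        using j F(2) Suc.prems by (intro Suc.IH smooth_on_pd depends_on_pd[OF S]) auto
      show "Ck k I W (pd i (\<lambda>u. \<gamma> u j))"
        using D[OF j] that by (intro smooth_onD smooth_on_pd)
    qed
  qed (use pd(2) that in auto)
  moreover have "Ck 0 I W (\<lambda>u. f (\<gamma> u))" using Ck_0[OF Suc.IH[OF Suc.prems]] .
  ultimately show ?case by simp
qed

lemma smooth_on_comp:
  fixes f :: "('j \<Rightarrow> real) \<Rightarrow> real" and \<gamma> :: "('i \<Rightarrow> real) \<Rightarrow> 'j \<Rightarrow> real"
  assumes "coord_open K S" "finite F" "F \<subseteq> K"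
    and "coord_open I W" "\<And>u. u \<in> W \<Longrightarrow> \<gamma> u \<in> S" "continuous_on W \<gamma>"
    and "smooth_on K S f" "depends_on F S f"
    and "\<And>j. j \<in> F \<Longrightarrow> smooth_on I W (\<lambda>u. \<gamma> u j)"
  shows "smooth_on I W (\<lambda>u. f (\<gamma> u))"
  by (rule smooth_onI) (rule Ck_comp[OF assms])

subsection \<open>Symmetry of second derivatives\<close>

text \<open>Two applications of the mean value theorem, first in direction \<open>i\<close> and then
  in direction \<open>j\<close>. The second difference on the left is symmetric in the two
  directions, so exchanging them represents the same number by the other mixed derivative.\<close>

lemma second_difference:
  fixes f :: "('i \<Rightarrow> real) \<Rightarrow> real"
  assumes f: "smooth_on I S f" and ij: "i \<in> I" "j \<in> I" "i \<noteq> j" and h: "h > 0"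
    and box: "\<And>a b. \<bar>a - z i\<bar> \<le> h \<Longrightarrow> \<bar>b - z j\<bar> \<le> h \<Longrightarrow> z(i := a, j := b) \<in> S"
  obtains a b where "\<bar>a - z i\<bar> \<le> h" "\<bar>b - z j\<bar> \<le> h"
    "f (z(i := z i + h, j := z j + h)) - f (z(i := z i + h)) - f (z(j := z j + h)) + f z
      = h * h * pd j (pd i f) (z(i := a, j := b))"
proof -
  let ?g = "\<lambda>s. f (z(i := s, j := z j + h)) - f (z(i := s, j := z j))"
  have D1: "((\<lambda>s. f (z(i := s, j := b))) has_real_derivative pd i f (z(i := a, j := b))) (at a)"
    if "\<bar>a - z i\<bar> \<le> h" "\<bar>b - z j\<bar> \<le> h" for a b
    using smooth_on_DERIV_at[OF f ij(1), of "z(j := b)" a] box[OF that] ij(3)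
    by (simp add: fun_upd_twist)
  have "\<exists>a. z i < a \<and> a < z i + h \<and> ?g (z i + h) - ?g (z i) = (z i + h - z i) *
      (pd i f (z(i := a, j := z j + h)) - pd i f (z(i := a, j := z j)))"
    using h by (intro MVT2 DERIV_diff D1) auto
  then obtain a where a: "z i < a" "a < z i + h" "?g (z i + h) - ?g (z i) = h *
      (pd i f (z(i := a, j := z j + h)) - pd i f (z(i := a, j := z j)))"
    by auto
  have "\<exists>b. z j < b \<and> b < z j + h \<and> pd i f (z(i := a, j := z j + h)) - pd i f (z(i := a, j := z j)) =
      (z j + h - z j) * pd j (pd i f) (z(i := a, j := b))"
  proof (rule MVT2)
    fix b assume "z j \<le> b" "b \<le> z j + h"
    then show "((\<lambda>b. pd i f (z(i := a, j := b))) has_real_derivative pd j (pd i f) (z(i := a, j := b))) (at b)"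
      using a by (intro smooth_on_DERIV_at[OF smooth_on_pd[OF f ij(1)] ij(2)] box) auto
  qed (use h in auto)
  then obtain b where b: "z j < b" "b < z j + h"
    "pd i f (z(i := a, j := z j + h)) - pd i f (z(i := a, j := z j)) = h * pd j (pd i f) (z(i := a, j := b))"
    by auto
  show thesis
  proof
    show "\<bar>a - z i\<bar> \<le> h" "\<bar>b - z j\<bar> \<le> h" using a b by auto
    have "z(i := z i + h, j := z j) = z(i := z i + h)" using ij(3) by auto
    then show "f (z(i := z i + h, j := z j + h)) - f (z(i := z i + h)) - f (z(j := z j + h)) + f z
      = h * h * pd j (pd i f) (z(i := a, j := b))"
      using a(3) b(3) by simp
  qed
qed

text \<open>On a small square the second difference equals both mixed derivatives at some
  intermediate points, and continuity moves these points to \<open>z\<close>.\<close>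

lemma pd_commute:
  fixes f :: "('i \<Rightarrow> real) \<Rightarrow> real"
  assumes S: "coord_open I S" and f: "smooth_on I S f" and ij: "i \<in> I" "j \<in> I" and z: "z \<in> S"
  shows "pd i (pd j f) z = pd j (pd i f) z"
proof (rule ccontr)
  assume ne: "pd i (pd j f) z \<noteq> pd j (pd i f) z"
  then have neq: "i \<noteq> j" by auto
  \<comment> \<open>Half the gap between the two values: two numbers, each closer than
    \<open>e\<close> to one of them, cannot coincide.\<close>
  define e where "e = \<bar>pd i (pd j f) z - pd j (pd i f) z\<bar> / 2"
  have e: "e > 0" using ne by (simp add: e_def)
  have F: "finite {i, j}" and ij': "{i, j} \<subseteq> I" using ij by auto
  obtain d0 where d0: "d0 > 0" "\<forall>z'. near {i, j} d0 z z' \<longrightarrow> z' \<in> S"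
    by (rule coord_openD[OF S z F ij'])
  obtain d1 where d1: "d1 > 0" "\<forall>z'\<in>S. near {i, j} d1 z z' \<longrightarrow> \<bar>pd i (pd j f) z' - pd i (pd j f) z\<bar> < e"
    by (rule continuous_on_box[OF smooth_on_continuous[OF smooth_on_pd[OF smooth_on_pd[OF f ij(2)] ij(1)]] z F e])
  obtain d2 where d2: "d2 > 0" "\<forall>z'\<in>S. near {i, j} d2 z z' \<longrightarrow> \<bar>pd j (pd i f) z' - pd j (pd i f) z\<bar> < e"
    by (rule continuous_on_box[OF smooth_on_continuous[OF smooth_on_pd[OF smooth_on_pd[OF f ij(1)] ij(2)]] z F e])
  define h where "h = min d0 (min d1 d2) / 2"
  have h: "h > 0" "h < d0" "h < d1" "h < d2" using d0(1) d1(1) d2(1) by (auto simp: h_def)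
  have box: "z(i := a, j := b) \<in> S" if "\<bar>a - z i\<bar> \<le> h" "\<bar>b - z j\<bar> \<le> h" for a b
    by (rule d0(2)[rule_format]) (use that h neq in \<open>auto simp: near_def\<close>)
  have box': "z(j := a, i := b) \<in> S" if "\<bar>a - z j\<bar> \<le> h" "\<bar>b - z i\<bar> \<le> h" for a b
    using box[OF that(2,1)] neq by (simp add: fun_upd_twist)
  obtain a b where ab: "\<bar>a - z i\<bar> \<le> h" "\<bar>b - z j\<bar> \<le> h"
    "f (z(i := z i + h, j := z j + h)) - f (z(i := z i + h)) - f (z(j := z j + h)) + f z
      = h * h * pd j (pd i f) (z(i := a, j := b))"
    by (rule second_difference[where f=f and i=i and j=j and z=z and h=h, OF f ij neq h(1) box])
  obtain a' b' where ab': "\<bar>a' - z j\<bar> \<le> h" "\<bar>b' - z i\<bar> \<le> h"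
    "f (z(j := z j + h, i := z i + h)) - f (z(j := z j + h)) - f (z(i := z i + h)) + f z
      = h * h * pd i (pd j f) (z(j := a', i := b'))"
    by (rule second_difference[where f=f and i=j and j=i and z=z and h=h,
        OF f ij(2,1) neq[symmetric] h(1) box'])
  have "h * h * pd j (pd i f) (z(i := a, j := b)) = h * h * pd i (pd j f) (z(j := a', i := b'))"
    unfolding ab(3)[symmetric] ab'(3)[symmetric] using neq by (simp add: fun_upd_twist)
  then have "pd j (pd i f) (z(i := a, j := b)) = pd i (pd j f) (z(j := a', i := b'))"
    using h by simp
  moreover have "\<bar>pd j (pd i f) (z(i := a, j := b)) - pd j (pd i f) z\<bar> < e"
    by (rule d2(2)[rule_format, OF box]) (use ab h in \<open>auto simp: near_def\<close>)
  moreover have "\<bar>pd i (pd j f) (z(j := a', i := b')) - pd i (pd j f) z\<bar> < e"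
    by (rule d1(2)[rule_format, OF box']) (use ab' h in \<open>auto simp: near_def\<close>)
  ultimately show False unfolding e_def by (smt (verit) field_sum_of_halves)
qed

section \<open>Total derivatives on jet domains\<close>

lemma depends_on_mono: "depends_on K S f \<Longrightarrow> K \<subseteq> K' \<Longrightarrow> depends_on K' S f"
  unfolding depends_on_def by blast

lemma depends_onI:
  "(\<And>z z'. z \<in> S \<Longrightarrow> z' \<in> S \<Longrightarrow> \<forall>i\<in>K. z i = z' i \<Longrightarrow> f z = f z') \<Longrightarrow> depends_on K S f"
  unfolding depends_on_def by blast

lemma depends_on_cong:
  assumes "\<And>z. z \<in> S \<Longrightarrow> f z = g z" "depends_on K S f"
  shows "depends_on K S g"
proof (rule depends_onI)
  fix z z' assume z: "z \<in> S" "z' \<in> S" "\<forall>i\<in>K. z i = z' i"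
  have "f z = f z'" by (rule depends_onD[OF assms(2)]) (use z in auto)
  then show "g z = g z'" by (simp only: assms(1)[OF z(1)] assms(1)[OF z(2)])
qed

lemma depends_on_comp2:
  assumes "depends_on K S f" "depends_on K S g"
  shows "depends_on K S (\<lambda>z. h (f z) (g z))"
proof (rule depends_onI)
  fix z z' assume z: "z \<in> S" "z' \<in> S" "\<forall>i\<in>K. z i = z' i"
  have "f z = f z'" "g z = g z'"
    by (rule depends_onD[OF assms(1)] depends_onD[OF assms(2)]; use z in simp)+
  then show "h (f z) (g z) = h (f z') (g z')" by simp
qed

lemma order_le_iff: "order_le k S f \<longleftrightarrow> depends_on {y. corder y \<le> k} S f"
  unfolding order_le_def depends_on_def by simp

lemma order_le_mono: "order_le k S f \<Longrightarrow> k \<le> l \<Longrightarrow> order_le l S f"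
  unfolding order_le_iff by (erule depends_on_mono) auto

section \<open>Multi-indices and jet coordinates of bounded order\<close>

definition mindices_le :: "nat \<Rightarrow> nat \<Rightarrow> nat multiset set" where
  "mindices_le r k = {\<sigma> \<in> mindices r. size \<sigma> \<le> k}"

lemma finite_mindices_le: "finite (mindices_le r k)"
proof (rule finite_subset)
  show "mindices_le r k \<subseteq> mset ` {xs. set xs \<subseteq> {..<r} \<and> length xs \<le> k}"
  proof
    fix \<sigma> assume "\<sigma> \<in> mindices_le r k"
    then have "sorted_list_of_multiset \<sigma> \<in> {xs. set xs \<subseteq> {..<r} \<and> length xs \<le> k}"
      by (auto simp: mindices_le_def mindices_def simp flip: size_mset)
    then show "\<sigma> \<in> mset ` {xs. set xs \<subseteq> {..<r} \<and> length xs \<le> k}"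
      by (metis imageI mset_sorted_list_of_multiset)
  qed
qed (simp add: finite_lists_length_le)

lemma empty_in_mindices [simp]: "{#} \<in> mindices r"
  by (simp add: mindices_def)

lemma add_mset_in_mindices [simp]: "add_mset i \<sigma> \<in> mindices r \<longleftrightarrow> i < r \<and> \<sigma> \<in> mindices r"
  by (auto simp: mindices_def)

lemma minus_in_mindices: "\<sigma> \<in> mindices r \<Longrightarrow> \<sigma> - \<tau> \<in> mindices r"
  unfolding mindices_def by (auto dest: in_diffD)

lemma set_sorted_mindices: "\<sigma> \<in> mindices r \<Longrightarrow> set (sorted_list_of_multiset \<sigma>) \<subseteq> {..<r}"
  by (simp add: mindices_def)

lemma T_in_jcoords [simp]: "T i \<in> jcoords n r \<longleftrightarrow> i < r"
  by (auto simp: jcoords_def)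

lemma X_in_jcoords [simp]: "X a \<sigma> \<in> jcoords n r \<longleftrightarrow> a < n \<and> \<sigma> \<in> mindices r"
  by (auto simp: jcoords_def)

definition jcoords_le :: "nat \<Rightarrow> nat \<Rightarrow> nat \<Rightarrow> coord set" where
  "jcoords_le n r k = T ` {..<r} \<union> (\<lambda>(a, \<sigma>). X a \<sigma>) ` ({..<n} \<times> mindices_le r k)"

lemma jcoords_le_eq: "jcoords_le n r k = {y \<in> jcoords n r. corder y \<le> k}"
  by (auto simp: jcoords_le_def jcoords_def mindices_le_def)

lemma finite_jcoords_le: "finite (jcoords_le n r k)"
  by (simp add: jcoords_le_def finite_mindices_le)

lemma jcoords_le_subset: "jcoords_le n r k \<subseteq> jcoords n r"
  by (auto simp: jcoords_le_eq)

lemma sum_jcoords_le: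
  "(\<Sum>y\<in>jcoords_le n r k. g y) =
    (\<Sum>i<r. g (T i)) + (\<Sum>(a, \<sigma>)\<in>{..<n} \<times> mindices_le r k. g (X a \<sigma>))"
proof -
  have "(\<Sum>y\<in>jcoords_le n r k. g y) = (\<Sum>y\<in>T ` {..<r}. g y) +
      (\<Sum>y\<in>(\<lambda>(a, \<sigma>). X a \<sigma>) ` ({..<n} \<times> mindices_le r k). g y)"
    unfolding jcoords_le_def by (rule sum.union_disjoint) (auto simp: finite_mindices_le)
  also have "(\<Sum>y\<in>T ` {..<r}. g y) = (\<Sum>i<r. g (T i))"
    by (subst sum.reindex) (auto simp: inj_on_def)
  also have "(\<Sum>y\<in>(\<lambda>(a, \<sigma>). X a \<sigma>) ` ({..<n} \<times> mindices_le r k). g y) =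
      (\<Sum>(a, \<sigma>)\<in>{..<n} \<times> mindices_le r k. g (X a \<sigma>))"
    by (subst sum.reindex) (auto simp: inj_on_def split_def intro!: sum.cong)
  finally show ?thesis .
qed

text \<open>\<open>sum'\<close> is 0 by convention when infinitely many terms are nonzero, so its
  properties are obtained by naming a finite set that carries all nonzero terms. The finite order
  bounds always provide one.\<close>

lemma sum'_eq_sum:
  assumes "F \<subseteq> A" "finite F" "\<And>x. x \<in> A \<Longrightarrow> x \<notin> F \<Longrightarrow> f x = 0"
  shows "sum' f A = sum f F"
proof -
  have "sum' f F = sum' f A"
    by (rule sum.mono_neutral_left') (use assms in auto)
  then show ?thesis using assms(2) by simp
qed

lemma sum'_0: "(\<And>x. x \<in> A \<Longrightarrow> f x = 0) \<Longrightarrow> sum' f A = 0"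
  using sum'_eq_sum[of "{}" A f] by simp

text \<open>Commuting operators may be applied in any order; this frees iterated derivatives from the sorting
  in their definition.\<close>

lemma foldr_insort:
  fixes E :: "nat \<Rightarrow> ('a \<Rightarrow> real) \<Rightarrow> 'a \<Rightarrow> real"
  assumes P: "\<And>f i. P f \<Longrightarrow> i \<in> I \<Longrightarrow> P (E i f)"
    and comm: "\<And>f i j z. P f \<Longrightarrow> i \<in> I \<Longrightarrow> j \<in> I \<Longrightarrow> z \<in> S \<Longrightarrow> E i (E j f) z = E j (E i f) z"
    and cong: "\<And>f g i z. (\<And>z. z \<in> S \<Longrightarrow> f z = g z) \<Longrightarrow> i \<in> I \<Longrightarrow> z \<in> S \<Longrightarrow> E i f z = E i g z"
    and f: "P f" and i: "i \<in> I" "set xs \<subseteq> I" and z: "z \<in> S"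
  shows "foldr E (insort i xs) f z = E i (foldr E xs f) z"
  using i(2) z
proof (induction xs arbitrary: z)
  case (Cons x xs)
  have Pf: "P (foldr E xs f)"
    using Cons.prems(1) by (induction xs) (auto simp: f intro: P)
  have "E x (foldr E (insort i xs) f) z = E x (E i (foldr E xs f)) z"
    by (rule cong) (use Cons in auto)
  also have "\<dots> = E i (E x (foldr E xs f)) z"
    by (rule comm) (use Cons Pf i in auto)
  finally show ?case by simp
qed simp

text \<open>\<open>j\<close> behaves like the jet prolongation \<open>u \<mapsto> j\<^sub>u(s)\<close> of a section \<open>s\<close> over \<open>W\<close>.\<close>

definition holonomic :: "nat \<Rightarrow> nat \<Rightarrow> pt set \<Rightarrow> (nat \<Rightarrow> real) set \<Rightarrow> ((nat \<Rightarrow> real) \<Rightarrow> pt) \<Rightarrow> bool" where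
  "holonomic n r S W j \<longleftrightarrow> coord_open {..<r} W \<and> j ` W \<subseteq> S \<and> continuous_on W j \<and>
     (\<forall>y\<in>jcoords n r. smooth_on {..<r} W (\<lambda>u. j u y)) \<and>
     (\<forall>u\<in>W. \<forall>i<r. (\<forall>k<r. pd i (\<lambda>u. j u (T k)) u = (if i = k then 1 else 0)) \<and>
        (\<forall>a<n. \<forall>\<sigma>\<in>mindices r. pd i (\<lambda>u. j u (X a \<sigma>)) u = j u (X a (add_mset i \<sigma>))))"

text \<open>Abstracts from the jets over one chart and the jets over the overlap of two charts. The
  third assumption lets every identity between total derivatives at a point be checked on a section
  through that point.\<close>

locale jet_domain =
  fixes n r :: nat and S :: "pt set"
  assumes coord_open: "coord_open (jcoords n r) S"
    and zero: "z \<in> S \<Longrightarrow> y \<notin> jcoords n r \<Longrightarrow> z y = 0"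
    and ex_holonomic: "z \<in> S \<Longrightarrow> \<exists>W t j. t \<in> W \<and> j t = z \<and> holonomic n r S W j"
begin

text \<open>The order is kept as an explicit number because each total derivative raises it by one
  and because it tells where the sums over multi-indices may be cut.\<close>

definition reg :: "nat \<Rightarrow> (pt \<Rightarrow> real) \<Rightarrow> bool" where
  "reg k f \<longleftrightarrow> smooth_on (jcoords n r) S f \<and> order_le k S f"

lemma reg_smooth: "reg k f \<Longrightarrow> smooth_on (jcoords n r) S f"
  by (simp add: reg_def)

lemma reg_Ck: "reg k f \<Longrightarrow> Ck l (jcoords n r) S f"
  by (simp add: reg_def smooth_onD)

lemma reg_mono: "reg k f \<Longrightarrow> k \<le> l \<Longrightarrow> reg l f"
  unfolding reg_def by (elim conjE) (intro conjI, assumption, rule order_le_mono)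

text \<open>Infinitely many coordinate names have order at most \<open>k\<close>, but those outside
  \<open>jcoords n r\<close> vanish on \<open>S\<close>. The remaining finite set is what the chain
  rule requires.\<close>

lemma reg_depends:
  assumes f: "reg k f"
  shows "depends_on (jcoords_le n r k) S f"
proof (rule depends_onI)
  fix z z' assume z: "z \<in> S" "z' \<in> S" "\<forall>y\<in>jcoords_le n r k. z y = z' y"
  show "f z = f z'"
  proof (rule depends_onD[of "{y. corder y \<le> k}" S f z z'])
    show "depends_on {y. corder y \<le> k} S f" using f by (simp add: reg_def order_le_iff)
    show "z y = z' y" if "y \<in> {y. corder y \<le> k}" for y
      using that z zero[of z y] zero[of z' y] by (cases "y \<in> jcoords n r") (auto simp: jcoords_le_eq)
  qed (use z in auto)
qed

lemma reg_cong:
  assumes eq: "\<And>z. z \<in> S \<Longrightarrow> f z = g z" and f: "reg k f"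
  shows "reg k g"
  unfolding reg_def order_le_iff
proof
  show "smooth_on (jcoords n r) S g"
    by (rule smooth_on_cong[OF coord_open eq reg_smooth[OF f]])
  show "depends_on {y. corder y \<le> k} S g"
    by (rule depends_on_cong[OF eq]) (use f in \<open>auto simp: reg_def order_le_iff\<close>)
qed

lemma reg_const: "reg k (\<lambda>z. c)"
  by (simp add: reg_def smooth_on_const order_le_def)

lemma reg_coord: "corder y \<le> k \<Longrightarrow> reg k (\<lambda>z. z y)"
  by (simp add: reg_def smooth_on_coord order_le_def)

lemma reg_add: "reg k f \<Longrightarrow> reg k g \<Longrightarrow> reg k (\<lambda>z. f z + g z)"
  unfolding reg_def order_le_iff using smooth_on_add[OF coord_open, of f g]
    depends_on_comp2[of "{y. corder y \<le> k}" S f g "(+)"] by simp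

lemma reg_mult: "reg k f \<Longrightarrow> reg k g \<Longrightarrow> reg k (\<lambda>z. f z * g z)"
  unfolding reg_def order_le_iff using smooth_on_mult[OF coord_open, of f g]
    depends_on_comp2[of "{y. corder y \<le> k}" S f g "(*)"] by simp

lemma reg_cmult: "reg k f \<Longrightarrow> reg k (\<lambda>z. c * f z)"
  by (intro reg_mult reg_const)

lemma reg_sum: "finite A \<Longrightarrow> (\<And>a. a \<in> A \<Longrightarrow> reg k (f a)) \<Longrightarrow> reg k (\<lambda>z. \<Sum>a\<in>A. f a z)"
  by (induction A rule: finite_induct) (auto intro: reg_const reg_add)

lemma reg_pd: "reg k f \<Longrightarrow> y \<in> jcoords n r \<Longrightarrow> reg k (pd y f)"
  using smooth_on_pd depends_on_pd[OF coord_open] by (auto simp: reg_def order_le_iff)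

lemma pd_above_order:
  assumes "order_le k S f" "y \<in> jcoords n r" "corder y > k" "z \<in> S"
  shows "pd y f z = 0"
  by (rule pd_depends_on_zero[OF coord_open, of "{y. corder y \<le> k}"])
     (use assms in \<open>auto simp: order_le_iff\<close>)

lemma Dtot_eq:
  assumes "order_le k S f" "z \<in> S"
  shows "Dtot n r i f z = pd (T i) f z +
    (\<Sum>(a, \<sigma>)\<in>{..<n} \<times> mindices_le r k. z (X a (add_mset i \<sigma>)) * pd (X a \<sigma>) f z)"
  unfolding Dtot_def
proof (intro arg_cong2[where f = "(+)"] refl sum'_eq_sum)
  fix p assume p: "p \<in> {..<n} \<times> mindices r" "p \<notin> {..<n} \<times> mindices_le r k"
  have "pd (X (fst p) (snd p)) f z = 0"
    by (rule pd_above_order[OF assms(1) _ _ assms(2)]) (use p in \<open>auto simp: mindices_le_def\<close>)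
  then show "(case p of (a, \<sigma>) \<Rightarrow> z (X a (add_mset i \<sigma>)) * pd (X a \<sigma>) f z) = 0"
    by (simp add: split_def)
qed (simp_all add: finite_mindices_le, auto simp: mindices_le_def)

lemma Dtot_cong:
  assumes "\<And>z. z \<in> S \<Longrightarrow> f z = g z" "z \<in> S" "i < r"
  shows "Dtot n r i f z = Dtot n r i g z"
proof -
  have pd: "pd y f z = pd y g z" if "y \<in> jcoords n r" for y
    by (rule pd_cong[OF coord_open assms(2) that assms(1)])
  show ?thesis unfolding Dtot_def
    using pd assms(3) by (auto intro!: arg_cong2[where f = "(+)"] sum.cong')
qed

lemma reg_Dtot:
  assumes "reg k f" "i < r"
  shows "reg (Suc k) (Dtot n r i f)"
proof (rule reg_cong)
  show "pd (T i) f z + (\<Sum>(a, \<sigma>)\<in>{..<n} \<times> mindices_le r k. z (X a (add_mset i \<sigma>)) * pd (X a \<sigma>) f z)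
      = Dtot n r i f z" if "z \<in> S" for z
    using Dtot_eq[of k f z i] assms that by (simp add: reg_def)
  show "reg (Suc k) (\<lambda>z. pd (T i) f z +
      (\<Sum>(a, \<sigma>)\<in>{..<n} \<times> mindices_le r k. z (X a (add_mset i \<sigma>)) * pd (X a \<sigma>) f z))"
    unfolding split_def
    by (intro reg_add reg_sum reg_mult reg_coord reg_mono[OF reg_pd[OF assms(1)], of _ "Suc k"])
       (use assms in \<open>auto simp: finite_mindices_le mindices_le_def finite_mindices_le[unfolded mindices_le_def]\<close>)
qed

text \<open>Chain rule along the section: the derivatives of its coordinates t^k are 0 or 1 and that
  of x^a_\<sigma> is x^a_{i\<sigma>}, and these are exactly the coefficients of D_i.\<close>

lemma Dtot_holonomic:
  assumes "reg k f" "i < r" and j: "holonomic n r S W j" "u \<in> W"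
  shows "pd i (\<lambda>u. f (j u)) u = Dtot n r i f (j u)"
proof -
  have "pd i (\<lambda>u. f (j u)) u =
      (\<Sum>y\<in>jcoords_le n r k. pd y f (j u) * pd i (\<lambda>u. j u y) u)"
  proof (rule pd_comp(2)[OF coord_open reg_Ck[OF assms(1)] finite_jcoords_le jcoords_le_subset
        reg_depends[OF assms(1)], of "{..<r}" W])
    show "Ck 0 {..<r} W (\<lambda>u. j u y)" if "y \<in> jcoords_le n r k" for y
      using j(1) subsetD[OF jcoords_le_subset that] by (intro smooth_onD) (simp add: holonomic_def)
  qed (use j assms(2) in \<open>auto simp: holonomic_def\<close>)
  also have "\<dots> = (\<Sum>k<r. pd (T k) f (j u) * (if i = k then 1 else 0)) +
      (\<Sum>(a, \<sigma>)\<in>{..<n} \<times> mindices_le r k. pd (X a \<sigma>) f (j u) * j u (X a (add_mset i \<sigma>)))"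
    unfolding sum_jcoords_le
    by (intro arg_cong2[where f = "(+)"] sum.cong refl)
       (use j assms(2) in \<open>auto simp: holonomic_def mindices_le_def\<close>)
  also have "(\<Sum>k<r. pd (T k) f (j u) * (if i = k then 1 else 0)) = pd (T i) f (j u)"
    using assms(2) by (simp add: if_distrib cong: if_cong)
  also have "pd (T i) f (j u) + (\<Sum>(a, \<sigma>)\<in>{..<n} \<times> mindices_le r k. pd (X a \<sigma>) f (j u) * j u (X a (add_mset i \<sigma>)))
      = Dtot n r i f (j u)"
    using j assms(1,2) by (subst Dtot_eq[of k]) (auto simp: reg_def holonomic_def mult.commute)
  finally show ?thesis .
qed

lemma smooth_holonomic:
  assumes "reg k f" "holonomic n r S W j"
  shows "smooth_on {..<r} W (\<lambda>u. f (j u))"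
proof (rule smooth_on_comp[where f = f and \<gamma> = j, OF coord_open finite_jcoords_le jcoords_le_subset])
  show "smooth_on {..<r} W (\<lambda>u. j u y)" if "y \<in> jcoords_le n r k" for y
    using assms(2) subsetD[OF jcoords_le_subset that] by (simp add: holonomic_def)
  show "depends_on (jcoords_le n r k) S f" by (rule reg_depends[OF assms(1)])
  show "smooth_on (jcoords n r) S f" by (rule reg_smooth[OF assms(1)])
qed (use assms(2) in \<open>auto simp: holonomic_def\<close>)

lemma Dtot_commute:
  assumes f: "reg k f" and ij: "i < r" "j < r" and z: "z \<in> S"
  shows "Dtot n r i (Dtot n r j f) z = Dtot n r j (Dtot n r i f) z"
proof -
  obtain W t c where c: "t \<in> W" "c t = z" "holonomic n r S W c" using ex_holonomic[OF z] by blast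
  have W: "coord_open {..<r} W" using c(3) by (simp add: holonomic_def)
  have D: "Dtot n r i (Dtot n r j f) z = pd i (pd j (\<lambda>u. f (c u))) t" if ij: "i < r" "j < r" for i j
  proof -
    have "Dtot n r i (Dtot n r j f) z = pd i (\<lambda>u. Dtot n r j f (c u)) t"
      using Dtot_holonomic[OF reg_Dtot[OF f ij(2)] ij(1) c(3,1)] c(2) by simp
    \<comment> \<open>The identity for the inner derivative holds on all of \<open>W\<close>, not
      just at \<open>t\<close>, and may therefore be differentiated once more.\<close>
    also have "\<dots> = pd i (pd j (\<lambda>u. f (c u))) t"
      by (rule pd_cong[OF W c(1)]) (use ij Dtot_holonomic[OF f ij(2) c(3)] in auto)
    finally show ?thesis .
  qed
  show ?thesis
    unfolding D[OF ij] D[OF ij(2,1)]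
    by (rule pd_commute[OF W smooth_holonomic[OF f c(3)]]) (use ij c in auto)
qed

lemma Dtot_add:
  assumes "reg k f" "reg k g" "z \<in> S" "i < r"
  shows "Dtot n r i (\<lambda>z. f z + g z) z = Dtot n r i f z + Dtot n r i g z"
proof -
  have pd: "pd y (\<lambda>z. f z + g z) z = pd y f z + pd y g z" if "y \<in> jcoords n r" for y
    by (rule pd_add[OF reg_Ck reg_Ck]) (use assms that in auto)
  have "order_le k S f" "order_le k S g" "order_le k S (\<lambda>z. f z + g z)"
    using assms reg_add[OF assms(1,2)] by (auto simp: reg_def)
  note * = Dtot_eq[OF this(1) assms(3)] Dtot_eq[OF this(2) assms(3)] Dtot_eq[OF this(3) assms(3)]
  have "(\<Sum>(a, \<sigma>)\<in>{..<n} \<times> mindices_le r k. z (X a (add_mset i \<sigma>)) * pd (X a \<sigma>) (\<lambda>z. f z + g z) z) =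
    (\<Sum>(a, \<sigma>)\<in>{..<n} \<times> mindices_le r k. z (X a (add_mset i \<sigma>)) * pd (X a \<sigma>) f z) +
    (\<Sum>(a, \<sigma>)\<in>{..<n} \<times> mindices_le r k. z (X a (add_mset i \<sigma>)) * pd (X a \<sigma>) g z)"
    unfolding split_def sum.distrib[symmetric]
    by (rule sum.cong) (auto simp: pd mindices_le_def distrib_left)
  then show ?thesis unfolding * using pd assms(4) by simp
qed

lemma Dtot_cmult:
  assumes "reg k f" "z \<in> S" "i < r"
  shows "Dtot n r i (\<lambda>z. c * f z) z = c * Dtot n r i f z"
proof -
  have pd: "pd y (\<lambda>z. c * f z) z = c * pd y f z" if "y \<in> jcoords n r" for y
    by (rule pd_cmult[OF reg_Ck]) (use assms that in auto)
  have "order_le k S f" "order_le k S (\<lambda>z. c * f z)"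
    using assms reg_cmult[OF assms(1)] by (auto simp: reg_def)
  note * = Dtot_eq[OF this(1) assms(2)] Dtot_eq[OF this(2) assms(2)]
  have "(\<Sum>(a, \<sigma>)\<in>{..<n} \<times> mindices_le r k. z (X a (add_mset i \<sigma>)) * pd (X a \<sigma>) (\<lambda>z. c * f z) z) =
    c * (\<Sum>(a, \<sigma>)\<in>{..<n} \<times> mindices_le r k. z (X a (add_mset i \<sigma>)) * pd (X a \<sigma>) f z)"
    unfolding split_def sum_distrib_left
    by (rule sum.cong) (auto simp: pd mindices_le_def)
  then show ?thesis unfolding * using pd assms(3) by (simp add: distrib_left)
qed

lemma Dtot_const: "Dtot n r i (\<lambda>z. c) z = 0"
  by (simp add: Dtot_def pd_const sum'_0 split_def)

lemma Dtot_sum: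
  assumes "finite A" "\<And>a. a \<in> A \<Longrightarrow> reg k (f a)" "z \<in> S" "i < r"
  shows "Dtot n r i (\<lambda>z. \<Sum>a\<in>A. f a z) z = (\<Sum>a\<in>A. Dtot n r i (f a) z)"
  using assms(1,2)
proof (induction A rule: finite_induct)
  case (insert a A)
  then show ?case
    using Dtot_add[of k "f a" "\<lambda>z. \<Sum>a\<in>A. f a z"] reg_sum[of A k f] assms(3,4) by simp
qed (simp add: Dtot_const)

text \<open>The commutator comes from the coefficients of D_i alone:
  \<partial>/\<partial>x^a_\<sigma> of x^b_{i\<tau>} is 1 precisely if b = a and i\<tau> = \<sigma>.
  Everything else commutes by the symmetry of second derivatives.\<close>

lemma pd_Dtot:
  assumes f: "reg k f" and i: "i < r" and a: "a < n" "\<sigma> \<in> mindices r" and z: "z \<in> S"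
  shows "pd (X a \<sigma>) (Dtot n r i f) z = Dtot n r i (pd (X a \<sigma>) f) z +
    (if i \<in># \<sigma> then pd (X a (\<sigma> - {#i#})) f z else 0)"
proof -
  \<comment> \<open>Large enough for the order of \<open>f\<close> and for the pair
    \<open>(a, \<sigma> - {#i#})\<close> to lie in the finite range of summation.\<close>
  define l where "l = max k (size \<sigma>)"
  have f: "reg l f" by (rule reg_mono[OF f]) (simp add: l_def)
  let ?F = "{..<n} \<times> mindices_le r l"
  let ?y = "X a \<sigma>"
  have y: "?y \<in> jcoords n r" using a by simp
  have F: "finite ?F" by (simp add: finite_mindices_le)
  have b: "X (fst p) (snd p) \<in> jcoords n r" if "p \<in> ?F" for p
    using that by (auto simp: mindices_le_def)
  have Ti: "T i \<in> jcoords n r" using i by simp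
  let ?g = "\<lambda>p z. z (X (fst p) (add_mset i (snd p))) * pd (X (fst p) (snd p)) f z"
  have reg_g: "reg (Suc l) (?g p)" if "p \<in> ?F" for p
    by (intro reg_mult reg_coord reg_mono[OF reg_pd[OF f b[OF that]]]) (use that in \<open>auto simp: mindices_le_def\<close>)
  have "pd ?y (Dtot n r i f) z = pd ?y (\<lambda>z. pd (T i) f z + (\<Sum>p\<in>?F. ?g p z)) z"
    using Dtot_eq[of l f _ i] f
    by (intro pd_cong[OF coord_open z y]) (auto simp: reg_def split_def)
  also have "\<dots> = pd ?y (pd (T i) f) z + pd ?y (\<lambda>z. \<Sum>p\<in>?F. ?g p z) z"
    by (rule pd_add[OF reg_Ck[OF reg_pd[OF f Ti]] reg_Ck[OF reg_sum[OF F reg_g]] y z])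
  also have "pd ?y (\<lambda>z. \<Sum>p\<in>?F. ?g p z) z = (\<Sum>p\<in>?F. pd ?y (?g p) z)"
    by (rule pd_sum[OF reg_Ck[OF reg_g] y z])
  also have "\<dots> = (\<Sum>p\<in>?F. (if X (fst p) (add_mset i (snd p)) = ?y then pd (X (fst p) (snd p)) f z else 0)
      + z (X (fst p) (add_mset i (snd p))) * pd (X (fst p) (snd p)) (pd ?y f) z)"
  proof (rule sum.cong[OF refl])
    fix p assume p: "p \<in> ?F"
    have "pd ?y (?g p) z = pd ?y (\<lambda>z. z (X (fst p) (add_mset i (snd p)))) z * pd (X (fst p) (snd p)) f z
       + z (X (fst p) (add_mset i (snd p))) * pd ?y (pd (X (fst p) (snd p)) f) z"
      by (rule pd_mult[OF smooth_onD[OF smooth_on_coord] reg_Ck[OF reg_pd[OF f b[OF p]]] y z])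
    moreover have "pd ?y (pd (X (fst p) (snd p)) f) z = pd (X (fst p) (snd p)) (pd ?y f) z"
      by (rule pd_commute[OF coord_open reg_smooth[OF f] y b[OF p] z])
    ultimately show "pd ?y (?g p) z =
       (if X (fst p) (add_mset i (snd p)) = ?y then pd (X (fst p) (snd p)) f z else 0)
      + z (X (fst p) (add_mset i (snd p))) * pd (X (fst p) (snd p)) (pd ?y f) z"
      by (auto simp: pd_coord)
  qed
  also have "\<dots> = (\<Sum>p\<in>?F. if X (fst p) (add_mset i (snd p)) = ?y then pd (X (fst p) (snd p)) f z else 0)
      + (\<Sum>p\<in>?F. z (X (fst p) (add_mset i (snd p))) * pd (X (fst p) (snd p)) (pd ?y f) z)"
    by (rule sum.distrib)
  \<comment> \<open>Adding \<open>i\<close> is injective on multi-indices, so at most one pair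
    contributes, and it exists only if \<open>i\<close> occurs in \<open>\<sigma>\<close>.\<close>
  also have "(\<Sum>p\<in>?F. if X (fst p) (add_mset i (snd p)) = ?y then pd (X (fst p) (snd p)) f z else 0) =
      (\<Sum>p\<in>?F. if p = (a, \<sigma> - {#i#}) then (if i \<in># \<sigma> then pd (X a (\<sigma> - {#i#})) f z else 0) else 0)"
    by (rule sum.cong) (auto simp: )
  also have "\<dots> = (if i \<in># \<sigma> then pd (X a (\<sigma> - {#i#})) f z else 0)"
  proof -
    have "size (\<sigma> - {#i#}) \<le> l" using size_Diff1_le[of \<sigma> i] by (simp add: l_def)
    then have "(a, \<sigma> - {#i#}) \<in> ?F" using a by (auto simp: mindices_le_def minus_in_mindices)
    then show ?thesis by (simp only: sum.delta[OF F] if_True)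
  qed
  also have "pd ?y (pd (T i) f) z = pd (T i) (pd ?y f) z"
    by (rule pd_commute[OF coord_open reg_smooth[OF f] y Ti z])
  finally show ?thesis
    using Dtot_eq[of l "pd ?y f" z i] reg_pd[OF f y] z by (simp add: reg_def split_def)
qed

section \<open>Iterated total derivatives\<close>

lemma Dtots_empty [simp]: "Dtots n r {#} f = f"
  by (simp add: Dtots_def)

lemma Dtots_add:
  assumes "reg k f" "i < r" "\<sigma> \<in> mindices r" "z \<in> S"
  shows "Dtots n r (add_mset i \<sigma>) f z = Dtot n r i (Dtots n r \<sigma> f) z"
proof -
  have "foldr (Dtot n r) (insort i (sorted_list_of_multiset \<sigma>)) f z =
      Dtot n r i (foldr (Dtot n r) (sorted_list_of_multiset \<sigma>) f) z"
  proof (rule foldr_insort[where P = "\<lambda>f. \<exists>k. reg k f" and I = "{..<r}" and S = S])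
    show "\<exists>k. reg k (Dtot n r i f)" if "\<exists>k. reg k f" "i \<in> {..<r}" for f i
      using that reg_Dtot by blast
    show "Dtot n r i (Dtot n r j f) z = Dtot n r j (Dtot n r i f) z"
      if "\<exists>k. reg k f" "i \<in> {..<r}" "j \<in> {..<r}" "z \<in> S" for f i j z
      using that Dtot_commute by blast
    show "Dtot n r i f z = Dtot n r i g z" if "\<And>z. z \<in> S \<Longrightarrow> f z = g z" "i \<in> {..<r}" "z \<in> S" for f g i z
      by (rule Dtot_cong[OF that(1)]) (use that in auto)
    show "\<exists>k. reg k f" using assms(1) by blast
  qed (use assms set_sorted_mindices in auto)
  then show ?thesis by (simp add: Dtots_def)
qed

lemma Dtots_cong:
  assumes "\<And>z. z \<in> S \<Longrightarrow> f z = g z" "\<sigma> \<in> mindices r" "z \<in> S"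
  shows "Dtots n r \<sigma> f z = Dtots n r \<sigma> g z"
proof -
  have "foldr (Dtot n r) xs f z = foldr (Dtot n r) xs g z" if "set xs \<subseteq> {..<r}" "z \<in> S" for xs z
    using that
  proof (induction xs arbitrary: z)
    case (Cons x xs)
    then show ?case by (auto intro: Dtot_cong)
  qed (simp add: assms(1))
  then show ?thesis unfolding Dtots_def using set_sorted_mindices[OF assms(2)] assms(3) by blast
qed

lemma reg_Dtots:
  assumes "reg k f" "\<sigma> \<in> mindices r"
  shows "reg (k + size \<sigma>) (Dtots n r \<sigma> f)"
  using assms(2)
proof (induction \<sigma>)
  case (add i \<sigma>)
  show ?case
    by (rule reg_cong[of "Dtot n r i (Dtots n r \<sigma> f)"])
       (use add Dtots_add[OF assms(1)] reg_Dtot[of "k + size \<sigma>" "Dtots n r \<sigma> f" i] in auto)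
qed (use assms in simp)

text \<open>Counterpart of \<open>Dtots_add\<close> that splits off the innermost derivative. It is
  what \<open>euler_divergence\<close> meets, where D_i stands underneath D_\<sigma>.\<close>

lemma Dtots_add':
  assumes f: "reg k f" and "i < r" "\<sigma> \<in> mindices r" "z \<in> S"
  shows "Dtots n r (add_mset i \<sigma>) f z = Dtots n r \<sigma> (Dtot n r i f) z"
  using assms(3,4)
proof (induction \<sigma> arbitrary: z)
  case (add j \<sigma>)
  then have \<sigma>: "\<sigma> \<in> mindices r" and j: "j < r" by auto
  have "Dtots n r (add_mset i (add_mset j \<sigma>)) f z = Dtots n r (add_mset j (add_mset i \<sigma>)) f z"
    by (simp add: add_mset_commute)
  also have "\<dots> = Dtot n r j (Dtots n r (add_mset i \<sigma>) f) z"
    by (rule Dtots_add[OF f]) (use j \<sigma> add.prems assms(2) in auto)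
  also have "\<dots> = Dtot n r j (Dtots n r \<sigma> (Dtot n r i f)) z"
    by (rule Dtot_cong) (use add.IH \<sigma> add.prems j in auto)
  also have "\<dots> = Dtots n r (add_mset j \<sigma>) (Dtot n r i f) z"
    by (rule Dtots_add[symmetric, OF reg_Dtot[OF f]]) (use j \<sigma> add.prems assms(2) in auto)
  finally show ?case .
qed (use assms Dtots_add[OF f, of i "{#}"] in simp)

lemma Dtots_plus:
  assumes f: "reg k f" "reg k g" and "\<sigma> \<in> mindices r" "z \<in> S"
  shows "Dtots n r \<sigma> (\<lambda>z. f z + g z) z = Dtots n r \<sigma> f z + Dtots n r \<sigma> g z"
  using assms(3,4)
proof (induction \<sigma> arbitrary: z)
  case (add j \<sigma>)
  then have \<sigma>: "\<sigma> \<in> mindices r" and j: "j < r" by auto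
  have "Dtots n r (add_mset j \<sigma>) (\<lambda>z. f z + g z) z = Dtot n r j (Dtots n r \<sigma> (\<lambda>z. f z + g z)) z"
    by (rule Dtots_add[OF reg_add[OF f] j \<sigma> add.prems(2)])
  also have "\<dots> = Dtot n r j (\<lambda>z. Dtots n r \<sigma> f z + Dtots n r \<sigma> g z) z"
    by (rule Dtot_cong) (use add.IH \<sigma> add.prems j in auto)
  also have "\<dots> = Dtot n r j (Dtots n r \<sigma> f) z + Dtot n r j (Dtots n r \<sigma> g) z"
    by (rule Dtot_add[OF reg_Dtots[OF f(1) \<sigma>] reg_Dtots[OF f(2) \<sigma>] add.prems(2) j])
  finally show ?case
    using Dtots_add[OF f(1) j \<sigma> add.prems(2)] Dtots_add[OF f(2) j \<sigma> add.prems(2)] by simp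
qed simp

lemma Dtots_cmult:
  assumes f: "reg k f" and "\<sigma> \<in> mindices r" "z \<in> S"
  shows "Dtots n r \<sigma> (\<lambda>z. c * f z) z = c * Dtots n r \<sigma> f z"
  using assms(2,3)
proof (induction \<sigma> arbitrary: z)
  case (add j \<sigma>)
  then have \<sigma>: "\<sigma> \<in> mindices r" and j: "j < r" by auto
  have "Dtots n r (add_mset j \<sigma>) (\<lambda>z. c * f z) z = Dtot n r j (Dtots n r \<sigma> (\<lambda>z. c * f z)) z"
    by (rule Dtots_add[OF reg_cmult[OF f] j \<sigma> add.prems(2)])
  also have "\<dots> = Dtot n r j (\<lambda>z. c * Dtots n r \<sigma> f z) z"
    by (rule Dtot_cong) (use add.IH \<sigma> add.prems j in auto)
  also have "\<dots> = c * Dtot n r j (Dtots n r \<sigma> f) z"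
    by (rule Dtot_cmult[OF reg_Dtots[OF f(1) \<sigma>] add.prems(2) j])
  finally show ?case
    using Dtots_add[OF f(1) j \<sigma> add.prems(2)] by simp
qed simp

lemma Dtots_const_0: "\<sigma> \<in> mindices r \<Longrightarrow> z \<in> S \<Longrightarrow> Dtots n r \<sigma> (\<lambda>z. 0) z = 0"
  using Dtots_cmult[of 0 "\<lambda>z. 0" \<sigma> z 0] reg_const by simp

lemma Dtots_eq_0: "(\<And>z. z \<in> S \<Longrightarrow> f z = 0) \<Longrightarrow> \<sigma> \<in> mindices r \<Longrightarrow> z \<in> S \<Longrightarrow> Dtots n r \<sigma> f z = 0"
  using Dtots_cong[of f "\<lambda>z. 0"] Dtots_const_0 by simp

text \<open>For \<open>B \<sigma>\<close> = \<partial>f/\<partial>x^a_\<sigma> this is the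
  variational derivative of \<open>f\<close>; for the coefficients of Gamma^a_\<sigma> in a form of
  bidegree (1,r) it is the coefficient of the canonical representative.\<close>

definition euler :: "(nat multiset \<Rightarrow> pt \<Rightarrow> real) \<Rightarrow> pt \<Rightarrow> real" where
  "euler B z = sum' (\<lambda>\<sigma>. (-1) ^ size \<sigma> * Dtots n r \<sigma> (B \<sigma>) z) (mindices r)"

lemma euler_cong:
  assumes "\<And>\<sigma> z. \<sigma> \<in> mindices r \<Longrightarrow> z \<in> S \<Longrightarrow> B \<sigma> z = C \<sigma> z" "z \<in> S"
  shows "euler B z = euler C z"
  unfolding euler_def
proof (rule sum.cong'[OF refl])
  fix \<sigma> assume "\<sigma> \<in> mindices r"
  then show "(- 1) ^ size \<sigma> * Dtots n r \<sigma> (B \<sigma>) z = (- 1) ^ size \<sigma> * Dtots n r \<sigma> (C \<sigma>) z"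
    using Dtots_cong[of "B \<sigma>" "C \<sigma>" \<sigma> z] assms by simp
qed

lemma euler_eq:
  assumes "\<And>\<sigma> z. \<sigma> \<in> mindices r \<Longrightarrow> size \<sigma> > k \<Longrightarrow> z \<in> S \<Longrightarrow> B \<sigma> z = 0" "z \<in> S"
  shows "euler B z = (\<Sum>\<sigma>\<in>mindices_le r k. (-1) ^ size \<sigma> * Dtots n r \<sigma> (B \<sigma>) z)"
  unfolding euler_def
proof (rule sum'_eq_sum)
  fix \<sigma> assume "\<sigma> \<in> mindices r" "\<sigma> \<notin> mindices_le r k"
  then show "(- 1) ^ size \<sigma> * Dtots n r \<sigma> (B \<sigma>) z = 0"
    using Dtots_eq_0[of "B \<sigma>" \<sigma> z] assms by (simp add: mindices_le_def)
qed (auto simp: mindices_le_def finite_mindices_le[unfolded mindices_le_def])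

text \<open>If a form has vertical coefficients \<open>C \<sigma>\<close>, these are the
  coefficients of its D_i derivative, because D_i sends Gamma_\<sigma> to Gamma_{i\<sigma>}. The
  first term contributes D_{i\<sigma>} C_\<sigma> with sign (-1)^|\<sigma>|. In the second, writing
  \<sigma> = i\<tau> gives D_{i\<tau>} C_\<tau> with the opposite sign, since the length has grown
  by one.\<close>

lemma euler_divergence:
  assumes C: "\<And>\<sigma>. \<sigma> \<in> mindices r \<Longrightarrow> reg k (C \<sigma>)"
    and C0: "\<And>\<sigma> z. \<sigma> \<in> mindices r \<Longrightarrow> size \<sigma> > k \<Longrightarrow> z \<in> S \<Longrightarrow> C \<sigma> z = 0" and z: "z \<in> S" and i: "i < r"
  shows "euler (\<lambda>\<sigma> z. Dtot n r i (C \<sigma>) z + (if i \<in># \<sigma> then C (\<sigma> - {#i#}) z else 0)) z = 0"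
proof -
  let ?B = "\<lambda>\<sigma> z. Dtot n r i (C \<sigma>) z + (if i \<in># \<sigma> then C (\<sigma> - {#i#}) z else 0)"
  let ?C = "\<lambda>\<sigma> z. if i \<in># \<sigma> then C (\<sigma> - {#i#}) z else 0"
  have regC: "reg (Suc k) (?C \<sigma>)" if "\<sigma> \<in> mindices r" for \<sigma>
    using reg_mono[OF C[OF minus_in_mindices[OF that, of "{#i#}"]], of "Suc k"] reg_const[of "Suc k" 0]
    by (cases "i \<in># \<sigma>") simp_all
  have size_minus: "Suc (size (\<sigma> - {#i#})) = size \<sigma>" if "i \<in># \<sigma>" for \<sigma>
    using that by (metis insert_DiffM size_add_mset)
  have "euler ?B z = (\<Sum>\<sigma>\<in>mindices_le r (Suc k). (-1) ^ size \<sigma> * Dtots n r \<sigma> (?B \<sigma>) z)"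
  proof (rule euler_eq[OF _ z])
    fix \<sigma> w assume \<sigma>: "\<sigma> \<in> mindices r" "size \<sigma> > Suc k" and w: "w \<in> S"
    have "Dtot n r i (C \<sigma>) w = Dtot n r i (\<lambda>z. 0) w"
      by (rule Dtot_cong[OF _ w i]) (use C0 \<sigma> in auto)
    moreover have "C (\<sigma> - {#i#}) w = 0" if "i \<in># \<sigma>"
      by (rule C0) (use \<sigma> w size_minus[OF that] in \<open>auto simp: minus_in_mindices\<close>)
    ultimately show "?B \<sigma> w = 0" by (simp add: Dtot_const)
  qed
  also have "\<dots> = (\<Sum>\<sigma>\<in>mindices_le r (Suc k). (-1) ^ size \<sigma> * Dtots n r (add_mset i \<sigma>) (C \<sigma>) z) +
      (\<Sum>\<sigma>\<in>mindices_le r (Suc k). (-1) ^ size \<sigma> * Dtots n r \<sigma> (?C \<sigma>) z)"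
    unfolding sum.distrib[symmetric]
  proof (rule sum.cong[OF refl])
    fix \<sigma> assume "\<sigma> \<in> mindices_le r (Suc k)"
    then have \<sigma>: "\<sigma> \<in> mindices r" by (simp add: mindices_le_def)
    have "Dtots n r \<sigma> (?B \<sigma>) z = Dtots n r \<sigma> (Dtot n r i (C \<sigma>)) z + Dtots n r \<sigma> (?C \<sigma>) z"
      by (rule Dtots_plus[OF reg_Dtot[OF C[OF \<sigma>] i] regC[OF \<sigma>] \<sigma> z])
    then show "(- 1) ^ size \<sigma> * Dtots n r \<sigma> (?B \<sigma>) z = (-1) ^ size \<sigma> * Dtots n r (add_mset i \<sigma>) (C \<sigma>) z
        + (-1) ^ size \<sigma> * Dtots n r \<sigma> (?C \<sigma>) z"
      using Dtots_add'[OF C[OF \<sigma>] i \<sigma> z] by (simp add: distrib_left)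
  qed
  \<comment> \<open>The undifferentiated coefficients vanish above length \<open>k\<close>. After
    this cut the range agrees with that of the second sum, which reaches length k+1 before and
    length \<open>k\<close> after its index shift.\<close>
  also have "(\<Sum>\<sigma>\<in>mindices_le r (Suc k). (-1) ^ size \<sigma> * Dtots n r (add_mset i \<sigma>) (C \<sigma>) z) =
      (\<Sum>\<sigma>\<in>mindices_le r k. (-1) ^ size \<sigma> * Dtots n r (add_mset i \<sigma>) (C \<sigma>) z)"
  proof (rule sum.mono_neutral_right)
    show "\<forall>\<sigma>\<in>mindices_le r (Suc k) - mindices_le r k. (- 1) ^ size \<sigma> * Dtots n r (add_mset i \<sigma>) (C \<sigma>) z = 0"
    proof
      fix \<sigma> assume "\<sigma> \<in> mindices_le r (Suc k) - mindices_le r k"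
      then have "\<sigma> \<in> mindices r" "size \<sigma> > k" by (auto simp: mindices_le_def)
      then show "(- 1) ^ size \<sigma> * Dtots n r (add_mset i \<sigma>) (C \<sigma>) z = 0"
        using Dtots_eq_0[of "C \<sigma>" "add_mset i \<sigma>" z] C0 i z by simp
    qed
  qed (auto simp: mindices_le_def finite_mindices_le[unfolded mindices_le_def])
  \<comment> \<open>Only multi-indices that contain \<open>i\<close> contribute, and these are the
    images under adding \<open>i\<close>.\<close>
  also have "(\<Sum>\<sigma>\<in>mindices_le r (Suc k). (-1) ^ size \<sigma> * Dtots n r \<sigma> (?C \<sigma>) z) =
      (\<Sum>\<sigma>\<in>add_mset i ` mindices_le r k. (-1) ^ size \<sigma> * Dtots n r \<sigma> (?C \<sigma>) z)"
  proof (rule sum.mono_neutral_right)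
    show "add_mset i ` mindices_le r k \<subseteq> mindices_le r (Suc k)" using i by (auto simp: mindices_le_def)
    show "\<forall>\<sigma>\<in>mindices_le r (Suc k) - add_mset i ` mindices_le r k. (- 1) ^ size \<sigma> * Dtots n r \<sigma> (?C \<sigma>) z = 0"
    proof
      fix \<sigma> assume \<sigma>: "\<sigma> \<in> mindices_le r (Suc k) - add_mset i ` mindices_le r k"
      have "i \<notin># \<sigma>"
      proof
        assume i: "i \<in># \<sigma>"
        then have "\<sigma> - {#i#} \<in> mindices_le r k"
          using \<sigma> size_minus[OF i] by (auto simp: mindices_le_def minus_in_mindices)
        moreover have "\<sigma> = add_mset i (\<sigma> - {#i#})" using i by simp
        ultimately show False using \<sigma> by blast
      qed
      then show "(- 1) ^ size \<sigma> * Dtots n r \<sigma> (?C \<sigma>) z = 0"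
        using \<sigma> Dtots_const_0[of \<sigma> z] z by (simp add: mindices_le_def)
    qed
  qed (rule finite_mindices_le)
  also have "\<dots> = (\<Sum>\<sigma>\<in>mindices_le r k. - ((-1) ^ size \<sigma> * Dtots n r (add_mset i \<sigma>) (C \<sigma>) z))"
    by (subst sum.reindex) (auto simp: inj_on_def)
  finally show ?thesis by (simp add: sum_negf)
qed

end

section \<open>Exterior algebra\<close>

lemma wedge_Nil [simp]: "wedge g \<omega> [] z = 0"
  by (simp add: wedge_def)

text \<open>Contraction with the first frame vector is an antiderivation: it hits \<open>g\<close>
  or passes it with a sign. This turns the sum over positions into a recursion, so that identities
  are proved by induction on the argument list, with the form generalised.\<close>

lemma wedge_Cons:
  "wedge g \<omega> (h # hs) z = (if h = g then \<omega> hs z else 0) - wedge g (\<lambda>ys. \<omega> (h # ys)) hs z"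
proof -
  let ?A = "{j. j < length hs \<and> hs ! j = g}"
  let ?t = "\<lambda>j. (-1) ^ j * \<omega> (take j (h # hs) @ drop (Suc j) (h # hs)) z"
  have "{j. j < length (h # hs) \<and> (h # hs) ! j = g} = (if h = g then {0} else {}) \<union> Suc ` ?A"
  proof (rule set_eqI)
    fix j
    show "j \<in> {j. j < length (h # hs) \<and> (h # hs) ! j = g} \<longleftrightarrow> j \<in> (if h = g then {0} else {}) \<union> Suc ` ?A"
      by (cases j) (auto simp: image_iff)
  qed
  then have "wedge g \<omega> (h # hs) z = sum ?t ((if h = g then {0} else {}) \<union> Suc ` ?A)"
    by (simp add: wedge_def)
  also have "\<dots> = sum ?t (if h = g then {0} else {}) + sum ?t (Suc ` ?A)"
    by (rule sum.union_disjoint) auto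
  also have "sum ?t (Suc ` ?A) = - wedge g (\<lambda>ys. \<omega> (h # ys)) hs z"
    unfolding wedge_def by (subst sum.reindex) (auto simp: sum_negf)
  finally show ?thesis by simp
qed

lemma wedge_cong:
  assumes "\<And>j. j < length gs \<Longrightarrow> \<omega> (take j gs @ drop (Suc j) gs) z = \<omega>' (take j gs @ drop (Suc j) gs) z'"
  shows "wedge g \<omega> gs z = wedge g \<omega>' gs z'"
  unfolding wedge_def using assms by (intro sum.cong) auto

lemma take_drop_lists: "gs \<in> lists A \<Longrightarrow> take j gs @ drop (Suc j) gs \<in> lists A"
  by (auto dest: in_set_takeD in_set_dropD)

lemma mset_take_drop:
  "j < length gs \<Longrightarrow> mset gs = add_mset (gs ! j) (mset (take j gs @ drop (Suc j) gs))"
  by (metis id_take_nth_drop mset_append mset.simps(2) union_mset_add_mset_right)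

text \<open>Forgets positions and signs. Statements on degrees and supports need only the multiset
  of arguments.\<close>

lemma wedge_support:
  assumes "wedge g \<omega> gs z \<noteq> 0"
  obtains hs where "mset gs = add_mset g (mset hs)" "\<omega> hs z \<noteq> 0"
proof -
  obtain j where "j < length gs" "gs ! j = g" "(-1) ^ j * \<omega> (take j gs @ drop (Suc j) gs) z \<noteq> 0"
    using assms unfolding wedge_def by (metis (mono_tags, lifting) mem_Collect_eq sum.neutral)
  then show thesis using that[of "take j gs @ drop (Suc j) gs"] mset_take_drop[of j gs] by simp
qed

lemma wedge_zero_if: "(\<And>hs. mset gs = add_mset g (mset hs) \<Longrightarrow> \<omega> hs z = 0) \<Longrightarrow> wedge g \<omega> gs z = 0"
  using wedge_support by metis

lemma wedge_add: "wedge g (\<lambda>hs z. \<omega> hs z + \<omega>' hs z) gs z = wedge g \<omega> gs z + wedge g \<omega>' gs z"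
  by (simp add: wedge_def distrib_left sum.distrib)

lemma wedge_cmult: "wedge g (\<lambda>hs z. c z * \<omega> hs z) gs z = c z * wedge g \<omega> gs z"
  by (simp add: wedge_def sum_distrib_left mult.left_commute)

lemma wedge_minus: "wedge g (\<lambda>hs z. - \<omega> hs z) gs z = - wedge g \<omega> gs z"
  using wedge_cmult[of g "\<lambda>_. -1" \<omega>] by simp

lemma wedge_diff: "wedge g (\<lambda>hs z. \<omega> hs z - \<omega>' hs z) gs z = wedge g \<omega> gs z - wedge g \<omega>' gs z"
  by (simp add: wedge_def right_diff_distrib sum_subtractf)

lemma wedge_zero [simp]: "wedge g (\<lambda>hs z. 0) gs z = 0"
  by (simp add: wedge_def)

lemma wedge_sum: "wedge g (\<lambda>hs z. \<Sum>a\<in>A. \<omega> a hs z) gs z = (\<Sum>a\<in>A. wedge g (\<omega> a) gs z)"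
  unfolding wedge_def sum_distrib_left by (rule sum.swap)

definition alternating :: "lform \<Rightarrow> bool" where
  "alternating \<omega> \<longleftrightarrow> (\<forall>gs g h hs z. \<omega> (gs @ g # h # hs) z = - \<omega> (gs @ h # g # hs) z)"

lemma alternatingD: "alternating \<omega> \<Longrightarrow> \<omega> (gs @ g # h # hs) z = - \<omega> (gs @ h # g # hs) z"
  unfolding alternating_def by blast

lemma alternating_shift: "alternating \<omega> \<Longrightarrow> alternating (\<lambda>ys. \<omega> (x # ys))"
  unfolding alternating_def using alternatingD[of \<omega> "x # _"]
  by (metis append_Cons alternating_def)

lemma alternating_wedge:
  assumes "alternating \<omega>"
  shows "alternating (wedge g \<omega>)"
  unfolding alternating_def
proof (intro allI)
  fix gs a b hs z
  show "wedge g \<omega> (gs @ a # b # hs) z = - wedge g \<omega> (gs @ b # a # hs) z"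
    using assms
  proof (induction gs arbitrary: \<omega>)
    case Nil
    \<comment> \<open>Unfolding twice yields one term for \<open>g = a\<close>, one for
      \<open>g = b\<close> with the opposite sign, and a remainder. The first two exchange roles
      under the swap; the remainder changes sign with \<open>\<omega>\<close>.\<close>
    have "wedge g (\<lambda>ys. \<omega> (a # b # ys)) hs z = wedge g (\<lambda>ys z. - \<omega> (b # a # ys) z) hs z"
      by (rule wedge_cong) (use alternatingD[OF Nil, of "[]" a b] in simp)
    then show ?case by (simp add: wedge_Cons wedge_minus)
  next
    case (Cons x gs)
    have "wedge g (\<lambda>ys. \<omega> (x # ys)) (gs @ a # b # hs) z = - wedge g (\<lambda>ys. \<omega> (x # ys)) (gs @ b # a # hs) z"
      by (rule Cons.IH[OF alternating_shift[OF Cons.prems]])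
    moreover have "\<omega> (gs @ a # b # hs) z = - \<omega> (gs @ b # a # hs) z"
      by (rule alternatingD[OF Cons.prems])
    ultimately show ?case by (simp add: wedge_Cons)
  qed
qed

text \<open>Each side removes \<open>g\<close> and \<open>h\<close> from two positions of the list;
  removing them in the other order shifts one of the positions by one and flips the sign. In the
  recursion, the cases where the first entry is \<open>g\<close> or \<open>h\<close> trade
  places.\<close>

lemma wedge_anticommute:
  "wedge g (wedge h \<omega>) gs z = - wedge h (wedge g \<omega>) gs z"
proof (induction gs arbitrary: \<omega>)
  case (Cons x gs)
  have W: "wedge g (\<lambda>ys. wedge h \<omega> (x # ys)) gs z =
      (if x = h then wedge g \<omega> gs z else 0) - wedge g (wedge h (\<lambda>ys. \<omega> (x # ys))) gs z" for g h
  proof -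
    have "wedge g (\<lambda>ys. wedge h \<omega> (x # ys)) gs z =
        wedge g (\<lambda>ys z. (if x = h then \<omega> ys z else 0) - wedge h (\<lambda>ys. \<omega> (x # ys)) ys z) gs z"
      by (rule wedge_cong) (rule wedge_Cons)
    then show ?thesis by (simp add: wedge_diff)
  qed
  show ?case
    by (subst (1 2) wedge_Cons) (simp add: W Cons.IH[of "\<lambda>ys. \<omega> (x # ys)"])
qed simp

subsection \<open>Volume forms\<close>

text \<open>The coefficients of a constant wedge product of the dt^i: the sign of the permutation
  relating the two lists, or 0. The point of evaluation is arbitrary since the coefficients are
  constant.\<close>

definition lsign :: "nat list \<Rightarrow> gen list \<Rightarrow> real" where
  "lsign is gs = foldr (\<lambda>i. wedge (Dt i)) is (fun_form (\<lambda>_. 1)) gs (\<lambda>_. 0)"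

lemma lsign_eq: "foldr (\<lambda>i. wedge (Dt i)) is (fun_form f) gs z = lsign is gs * f z"
proof (induction "is" arbitrary: gs)
  case Nil
  then show ?case by (simp add: lsign_def fun_form_def)
next
  case (Cons i "is")
  have "foldr (\<lambda>i. wedge (Dt i)) (i # is) (fun_form f) gs z =
      (\<Sum>j | j < length gs \<and> gs ! j = Dt i. (-1) ^ j * (lsign is (take j gs @ drop (Suc j) gs) * f z))"
    by (simp add: wedge_def[of "Dt i"] Cons.IH)
  also have "\<dots> = lsign (i # is) gs * f z"
    unfolding lsign_def by (simp add: wedge_def[of "Dt i"] sum_distrib_right lsign_def mult.assoc)
  finally show ?case .
qed

lemma lvol_eq: "lvol r f gs z = lsign (rev [0..<r]) gs * f z"
  unfolding lvol_def by (rule lsign_eq)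

lemma lsign_Cons: "lsign (i # is) gs = wedge (Dt i) (\<lambda>hs _. lsign is hs) gs z"
  unfolding lsign_def by (simp add: wedge_def)

lemma lsign_support: "lsign is gs \<noteq> 0 \<Longrightarrow> mset gs = mset (map Dt is)"
proof (induction "is" arbitrary: gs)
  case Nil
  then show ?case by (simp add: lsign_def fun_form_def split: if_splits)
next
  case (Cons i "is")
  then obtain hs where "mset gs = add_mset (Dt i) (mset hs)" "lsign is hs \<noteq> 0"
    using wedge_support[of "Dt i" "\<lambda>hs _. lsign is hs" gs undefined] lsign_Cons[of i "is" gs undefined]
    by auto
  then show ?case using Cons.IH by simp
qed

lemma lsign_self: "distinct is \<Longrightarrow> lsign is (map Dt is) = 1"
proof (induction "is")
  case Nil
  then show ?case by (simp add: lsign_def fun_form_def)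
next
  case (Cons i "is")
  have "wedge (Dt i) (\<lambda>ys _. lsign is (Dt i # ys)) (map Dt is) undefined = 0"
  proof (rule wedge_zero_if)
    fix hs assume "mset (map Dt is) = add_mset (Dt i) (mset hs)"
    then have "Dt i \<in> set (map Dt is)" by (metis set_mset_mset union_single_eq_member)
    then show "lsign is (Dt i # hs) = 0" using Cons.prems by auto
  qed
  then show ?case
    using Cons by (simp add: lsign_Cons[of _ _ _ undefined] wedge_Cons)
qed

lemma alternating_fun_form: "alternating (fun_form f)"
  by (simp add: alternating_def fun_form_def)

lemma alternating_lvol: "alternating (lvol r f)"
proof -
  have "alternating (foldr (\<lambda>i. wedge (Dt i)) is (fun_form f))" for "is"
    by (induction "is") (auto intro: alternating_wedge alternating_fun_form)
  then show ?thesis by (simp add: lvol_def)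
qed

lemma Dt_in_gens [simp]: "Dt i \<in> gens n r \<longleftrightarrow> i < r"
  by (auto simp: gens_def)

lemma Gam_in_gens [simp]: "Gam a \<sigma> \<in> gens n r \<longleftrightarrow> a < n \<and> \<sigma> \<in> mindices r"
  by (auto simp: gens_def)

subsection \<open>Derivatives of exterior products\<close>

context jet_domain
begin

lemma reg_wedge:
  assumes "\<And>hs. reg k (\<omega> hs)"
  shows "reg k (wedge g \<omega> gs)"
  unfolding wedge_def[abs_def] by (intro reg_sum reg_cmult assms) auto

lemma pd_wedge:
  assumes "\<And>hs. reg k (\<omega> hs)" "y \<in> jcoords n r" "z \<in> S"
  shows "pd y (wedge g \<omega> gs) z = wedge g (\<lambda>hs. pd y (\<omega> hs)) gs z"
proof -
  let ?A = "{j. j < length gs \<and> gs ! j = g}"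
  have "pd y (wedge g \<omega> gs) z = pd y (\<lambda>z. \<Sum>j\<in>?A. (-1) ^ j * \<omega> (take j gs @ drop (Suc j) gs) z) z"
    unfolding wedge_def[abs_def] ..
  also have "\<dots> = (\<Sum>j\<in>?A. pd y (\<lambda>z. (-1) ^ j * \<omega> (take j gs @ drop (Suc j) gs) z) z)"
    by (rule pd_sum[OF reg_Ck[OF reg_cmult[OF assms(1)]] assms(2,3)])
  also have "\<dots> = (\<Sum>j\<in>?A. (-1) ^ j * pd y (\<omega> (take j gs @ drop (Suc j) gs)) z)"
    by (intro sum.cong refl pd_cmult[OF reg_Ck[OF assms(1)] assms(2,3)])
  finally show ?thesis by (simp add: wedge_def)
qed

lemma Dtot_wedge:
  assumes "\<And>hs. reg k (\<omega> hs)" "i < r" "z \<in> S"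
  shows "Dtot n r i (wedge g \<omega> gs) z = wedge g (\<lambda>hs. Dtot n r i (\<omega> hs)) gs z"
proof -
  let ?A = "{j. j < length gs \<and> gs ! j = g}"
  have "Dtot n r i (wedge g \<omega> gs) z = Dtot n r i (\<lambda>z. \<Sum>j\<in>?A. (-1) ^ j * \<omega> (take j gs @ drop (Suc j) gs) z) z"
    unfolding wedge_def[abs_def] ..
  also have "\<dots> = (\<Sum>j\<in>?A. Dtot n r i (\<lambda>z. (-1) ^ j * \<omega> (take j gs @ drop (Suc j) gs) z) z)"
    by (rule Dtot_sum[OF _ reg_cmult[OF assms(1)] assms(3,2)]) simp
  also have "\<dots> = (\<Sum>j\<in>?A. (-1) ^ j * Dtot n r i (\<omega> (take j gs @ drop (Suc j) gs)) z)"
    by (intro sum.cong refl Dtot_cmult[OF assms(1,3,2)])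
  finally show ?thesis by (simp add: wedge_def)
qed

lemma lvert_eq:
  assumes "\<And>hs. order_le k S (\<omega> hs)" "z \<in> S" "k \<le> l"
  shows "lvert n r \<omega> gs z =
    (\<Sum>(a, \<sigma>)\<in>{..<n} \<times> mindices_le r l. wedge (Gam a \<sigma>) (\<lambda>hs. pd (X a \<sigma>) (\<omega> hs)) gs z)"
  unfolding lvert_def
proof (rule sum'_eq_sum)
  fix p assume p: "p \<in> {..<n} \<times> mindices r" "p \<notin> {..<n} \<times> mindices_le r l"
  have "pd (X (fst p) (snd p)) (\<omega> hs) z = 0" for hs
    by (rule pd_above_order[OF assms(1) _ _ assms(2)]) (use p assms(3) in \<open>auto simp: mindices_le_def\<close>)
  then show "(case p of (a, \<sigma>) \<Rightarrow> wedge (Gam a \<sigma>) (\<lambda>hs. pd (X a \<sigma>) (\<omega> hs)) gs z) = 0"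
    by (simp add: split_def wedge_def)
qed (simp_all add: finite_mindices_le, auto simp: mindices_le_def)

lemma lvert_cong:
  assumes "\<And>hs z. hs \<in> lists (gens n r) \<Longrightarrow> z \<in> S \<Longrightarrow> \<omega> hs z = \<omega>' hs z"
    and "z \<in> S" "gs \<in> lists (gens n r)"
  shows "lvert n r \<omega> gs z = lvert n r \<omega>' gs z"
  unfolding lvert_def
proof (rule sum.cong'[OF refl])
  fix p assume p: "p \<in> {..<n} \<times> mindices r"
  have "wedge (Gam (fst p) (snd p)) (\<lambda>hs. pd (X (fst p) (snd p)) (\<omega> hs)) gs z =
      wedge (Gam (fst p) (snd p)) (\<lambda>hs. pd (X (fst p) (snd p)) (\<omega>' hs)) gs z"
    by (intro wedge_cong pd_cong[OF coord_open assms(2)] assms(1) take_drop_lists assms(3)) (use p in auto)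
  then show "(case p of (a, \<sigma>) \<Rightarrow> wedge (Gam a \<sigma>) (\<lambda>hs. pd (X a \<sigma>) (\<omega> hs)) gs z) =
      (case p of (a, \<sigma>) \<Rightarrow> wedge (Gam a \<sigma>) (\<lambda>hs. pd (X a \<sigma>) (\<omega>' hs)) gs z)"
    by (simp add: split_def)
qed

lemma reg_lvert:
  assumes "\<And>hs. reg k (\<omega> hs)"
  shows "reg k (lvert n r \<omega> gs)"
proof (rule reg_cong)
  show "(\<Sum>(a, \<sigma>)\<in>{..<n} \<times> mindices_le r k. wedge (Gam a \<sigma>) (\<lambda>hs. pd (X a \<sigma>) (\<omega> hs)) gs z) = lvert n r \<omega> gs z"
    if "z \<in> S" for z
    by (rule lvert_eq[symmetric, OF _ that]) (use assms in \<open>auto simp: reg_def\<close>)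
  show "reg k (\<lambda>z. \<Sum>(a, \<sigma>)\<in>{..<n} \<times> mindices_le r k. wedge (Gam a \<sigma>) (\<lambda>hs. pd (X a \<sigma>) (\<omega> hs)) gs z)"
    unfolding split_def
    by (intro reg_sum reg_wedge reg_pd assms) (simp add: finite_mindices_le, auto simp: mindices_le_def)
qed

text \<open>Reindexing by \<tau> \<mapsto> i\<tau>, a bijection onto the multi-indices that contain
  \<open>i\<close>. \<open>G\<close> receives the index before and after the shift, because the
  generator carries the one and the differentiated coordinate the other.\<close>

lemma sum'_shift:
  assumes "i < r"
  shows "sum' (\<lambda>(b, \<tau>). G b (add_mset i \<tau>) b \<tau>) ({..<n} \<times> mindices r) =
    sum' (\<lambda>(a, \<sigma>). if i \<in># \<sigma> then G a \<sigma> a (\<sigma> - {#i#}) else (0::real)) ({..<n} \<times> mindices r)"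
proof -
  let ?f = "\<lambda>(b, \<tau>). G b (add_mset i \<tau>) b \<tau>"
  let ?g = "\<lambda>(a, \<sigma>). if i \<in># \<sigma> then G a \<sigma> a (\<sigma> - {#i#}) else 0"
  let ?h = "\<lambda>(b, \<tau>). (b, add_mset i \<tau>)"
  let ?A = "{..<n} \<times> mindices r"
  have inj: "inj_on ?h B" for B :: "(nat \<times> nat multiset) set" by (auto simp: inj_on_def)
  have img: "?h ` {p \<in> ?A. ?f p \<noteq> 0} = {p \<in> ?A. ?g p \<noteq> 0}"
  proof (rule set_eqI)
    fix q :: "nat \<times> nat multiset"
    obtain a \<sigma> where q: "q = (a, \<sigma>)" by (cases q)
    show "q \<in> ?h ` {p \<in> ?A. ?f p \<noteq> 0} \<longleftrightarrow> q \<in> {p \<in> ?A. ?g p \<noteq> 0}"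
    proof
      assume "q \<in> {p \<in> ?A. ?g p \<noteq> 0}"
      then have "i \<in># \<sigma>" "(a, \<sigma> - {#i#}) \<in> {p \<in> ?A. ?f p \<noteq> 0}" "q = ?h (a, \<sigma> - {#i#})"
        unfolding q by (auto simp: minus_in_mindices split: if_splits)
      then show "q \<in> ?h ` {p \<in> ?A. ?f p \<noteq> 0}" by blast
    qed (use assms in \<open>auto simp: q\<close>)
  qed
  \<comment> \<open>The supports correspond bijectively, so if one is infinite both sums are 0 by
    convention.\<close>
  have fin: "finite {p \<in> ?A. ?g p \<noteq> 0} \<longleftrightarrow> finite {p \<in> ?A. ?f p \<noteq> 0}"
    unfolding img[symmetric] by (rule finite_image_iff[OF inj])
  have "sum ?g {p \<in> ?A. ?g p \<noteq> 0} = sum ?f {p \<in> ?A. ?f p \<noteq> 0}"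
    unfolding img[symmetric] by (subst sum.reindex[OF inj]) (auto intro!: sum.cong)
  then show ?thesis unfolding sum.G_def using fin by simp
qed

lemma Dtot_form_vertical_0:
  assumes "\<And>a \<sigma> hs. \<eta> (Gam a \<sigma> # hs) = (\<lambda>z. 0)"
  shows "Dtot_form n r i \<eta> gs z = Dtot n r i (\<eta> gs) z"
proof -
  have "gderiv (Gam a \<sigma>) \<eta> = (\<lambda>hs z. 0)" for a \<sigma> by (simp add: gderiv_def[abs_def] assms)
  then show ?thesis by (simp add: Dtot_form_def split_def sum'_0)
qed

text \<open>\<open>D\<close> and \<open>\<delta>\<close> anticommute on functions by \<open>pd_Dtot\<close>; the index shift in the commutator there is
  matched by \<open>D\<^sub>i \<Gamma>\<^sup>a\<^sub>\<sigma> = \<Gamma>\<^sup>a\<^sub>i\<^sub>\<sigma>\<close>.\<close>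

lemma lvert_lhor:
  assumes reg: "\<And>hs. reg k (\<eta> hs)" and vert0: "\<And>hs g. g \<in> set hs \<Longrightarrow> \<not> is_Dt g \<Longrightarrow> \<eta> hs = (\<lambda>z. 0)"
    and z: "z \<in> S"
  shows "lvert n r (lhor n r \<eta>) gs z = - lhor n r (lvert n r \<eta>) gs z"
proof -
  let ?F = "{..<n} \<times> mindices_le r (Suc k)"
  have F: "finite ?F" by (simp add: finite_mindices_le)
  have Gam0: "\<eta> (Gam a \<sigma> # hs) = (\<lambda>z. 0)" for a \<sigma> hs by (rule vert0[of "Gam a \<sigma>"]) auto
  have y: "X (fst p) (snd p) \<in> jcoords n r" if "p \<in> ?F" for p using that by (auto simp: mindices_le_def)
  \<comment> \<open>The derivative of \<open>Dtot n r i (\<eta> hs)\<close> by the coordinate with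
    index \<open>p\<close>, commutator term included. Both sides of the claim reduce to double sums
    of this expression and differ only in the order of the two exterior factors.\<close>
  define \<Psi> where "\<Psi> p i hs z = Dtot n r i (pd (X (fst p) (snd p)) (\<eta> hs)) z +
    (if i \<in># snd p then pd (X (fst p) (snd p - {#i#})) (\<eta> hs) z else 0)" for p i hs z
  have lhor: "lhor n r \<eta> = (\<lambda>hs z. \<Sum>i<r. wedge (Dt i) (\<lambda>hs. Dtot n r i (\<eta> hs)) hs z)"
  proof (intro ext)
    fix hs z
    have "Dtot_form n r i \<eta> = (\<lambda>hs. Dtot n r i (\<eta> hs))" for i
      by (intro ext) (simp add: Dtot_form_vertical_0 Gam0)
    then show "lhor n r \<eta> hs z = (\<Sum>i<r. wedge (Dt i) (\<lambda>hs. Dtot n r i (\<eta> hs)) hs z)"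
      by (simp add: lhor_def)
  qed
  have regD: "reg (Suc k) (Dtot n r i (\<eta> hs))" if "i < r" for i hs by (rule reg_Dtot[OF reg that])
  have regl: "reg (Suc k) (lhor n r \<eta> hs)" for hs
    unfolding lhor by (intro reg_sum reg_wedge regD) auto
  have pdl: "pd (X (fst p) (snd p)) (lhor n r \<eta> hs) z = (\<Sum>i<r. wedge (Dt i) (\<Psi> p i) hs z)"
    if p: "p \<in> ?F" for p hs
  proof -
    have "pd (X (fst p) (snd p)) (lhor n r \<eta> hs) z =
        (\<Sum>i<r. pd (X (fst p) (snd p)) (wedge (Dt i) (\<lambda>hs. Dtot n r i (\<eta> hs)) hs) z)"
      unfolding lhor by (rule pd_sum[OF reg_Ck[OF reg_wedge[OF regD]] y[OF p] z]) simp
    also have "\<dots> = (\<Sum>i<r. wedge (Dt i) (\<Psi> p i) hs z)"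
    proof (rule sum.cong[OF refl])
      fix i assume i: "i \<in> {..<r}"
      have "pd (X (fst p) (snd p)) (wedge (Dt i) (\<lambda>hs. Dtot n r i (\<eta> hs)) hs) z =
          wedge (Dt i) (\<lambda>hs. pd (X (fst p) (snd p)) (Dtot n r i (\<eta> hs))) hs z"
        by (rule pd_wedge[OF regD y[OF p] z]) (use i in simp)
      also have "\<dots> = wedge (Dt i) (\<Psi> p i) hs z"
        unfolding \<Psi>_def
        by (rule wedge_cong, rule pd_Dtot[OF reg]) (use i p z in \<open>auto simp: mindices_le_def\<close>)
      finally show "pd (X (fst p) (snd p)) (wedge (Dt i) (\<lambda>hs. Dtot n r i (\<eta> hs)) hs) z =
          wedge (Dt i) (\<Psi> p i) hs z" .
    qed
    finally show ?thesis .
  qed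
  have "lvert n r (lhor n r \<eta>) gs z =
      (\<Sum>p\<in>?F. wedge (Gam (fst p) (snd p)) (\<lambda>hs. pd (X (fst p) (snd p)) (lhor n r \<eta> hs)) gs z)"
    using lvert_eq[of "Suc k" "lhor n r \<eta>" z "Suc k" gs] regl z by (simp add: reg_def split_def)
  also have "\<dots> = (\<Sum>p\<in>?F. wedge (Gam (fst p) (snd p)) (\<lambda>hs z. \<Sum>i<r. wedge (Dt i) (\<Psi> p i) hs z) gs z)"
    by (intro sum.cong refl wedge_cong pdl)
  also have "\<dots> = (\<Sum>p\<in>?F. \<Sum>i<r. - wedge (Dt i) (wedge (Gam (fst p) (snd p)) (\<Psi> p i)) gs z)"
    unfolding wedge_sum by (intro sum.cong refl wedge_anticommute)
  also have "\<dots> = - (\<Sum>i<r. \<Sum>p\<in>?F. wedge (Dt i) (wedge (Gam (fst p) (snd p)) (\<Psi> p i)) gs z)"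
    unfolding sum_negf by (subst sum.swap) simp
  finally have L: "lvert n r (lhor n r \<eta>) gs z =
      - (\<Sum>i<r. \<Sum>p\<in>?F. wedge (Dt i) (wedge (Gam (fst p) (snd p)) (\<Psi> p i)) gs z)" .

  have "Dtot_form n r i (lvert n r \<eta>) hs z = (\<Sum>p\<in>?F. wedge (Gam (fst p) (snd p)) (\<Psi> p i) hs z)"
    if i: "i < r" for i hs
  proof -
    have v: "lvert n r \<eta> hs w = (\<Sum>p\<in>?F. wedge (Gam (fst p) (snd p)) (\<lambda>hs. pd (X (fst p) (snd p)) (\<eta> hs)) hs w)"
      if "w \<in> S" for hs w
      using lvert_eq[of k \<eta> w "Suc k" hs] reg that by (simp add: reg_def split_def)
    have "Dtot n r i (lvert n r \<eta> hs) z =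
        Dtot n r i (\<lambda>w. \<Sum>p\<in>?F. wedge (Gam (fst p) (snd p)) (\<lambda>hs. pd (X (fst p) (snd p)) (\<eta> hs)) hs w) z"
      by (rule Dtot_cong[OF v z i])
    also have "\<dots> = (\<Sum>p\<in>?F. Dtot n r i (wedge (Gam (fst p) (snd p)) (\<lambda>hs. pd (X (fst p) (snd p)) (\<eta> hs)) hs) z)"
      by (rule Dtot_sum[OF F reg_wedge[OF reg_pd[OF reg y]] z i])
    also have "\<dots> = (\<Sum>p\<in>?F. wedge (Gam (fst p) (snd p)) (\<lambda>hs. Dtot n r i (pd (X (fst p) (snd p)) (\<eta> hs))) hs z)"
      by (intro sum.cong refl Dtot_wedge[OF reg_pd[OF reg y] i z])
    finally have 1: "Dtot n r i (lvert n r \<eta> hs) z =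
        (\<Sum>p\<in>?F. wedge (Gam (fst p) (snd p)) (\<lambda>hs. Dtot n r i (pd (X (fst p) (snd p)) (\<eta> hs))) hs z)" .
    \<comment> \<open>Contracting \<delta>\<eta> with a vertical frame vector returns the partial
      derivative, because \<open>\<eta>\<close> itself has no vertical arguments.\<close>
    have g: "gderiv (Gam b \<tau>) (lvert n r \<eta>) ys z = pd (X b \<tau>) (\<eta> ys) z" if b: "b < n" "\<tau> \<in> mindices r" for b \<tau> ys
    proof -
      have "gderiv (Gam b \<tau>) (lvert n r \<eta>) ys z =
          sum' (\<lambda>(a, \<sigma>). if (a, \<sigma>) = (b, \<tau>) then pd (X b \<tau>) (\<eta> ys) z else 0) ({..<n} \<times> mindices r)"
        unfolding gderiv_def lvert_def
      proof (rule sum.cong'[OF refl])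
        fix p :: "nat \<times> nat multiset"
        have "wedge (Gam (fst p) (snd p)) (\<lambda>hs. pd (X (fst p) (snd p)) (\<eta> (Gam b \<tau> # hs))) ys z = 0"
          by (simp add: Gam0 pd_const wedge_def)
        then show "(case p of (a, \<sigma>) \<Rightarrow> wedge (Gam a \<sigma>) (\<lambda>hs. pd (X a \<sigma>) (\<eta> hs)) (Gam b \<tau> # ys) z) =
          (case p of (a, \<sigma>) \<Rightarrow> if (a, \<sigma>) = (b, \<tau>) then pd (X b \<tau>) (\<eta> ys) z else 0)"
          by (auto simp: split_def wedge_Cons)
      qed
      also have "\<dots> = sum (\<lambda>(a, \<sigma>). if (a, \<sigma>) = (b, \<tau>) then pd (X b \<tau>) (\<eta> ys) z else 0) {(b, \<tau>)}"
        by (rule sum'_eq_sum) (use b in \<open>auto split: if_splits\<close>)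
      finally show ?thesis by simp
    qed
    have "sum' (\<lambda>(b, \<tau>). wedge (Gam b (add_mset i \<tau>)) (gderiv (Gam b \<tau>) (lvert n r \<eta>)) hs z) ({..<n} \<times> mindices r)
      = sum' (\<lambda>(b, \<tau>). wedge (Gam b (add_mset i \<tau>)) (\<lambda>ys. pd (X b \<tau>) (\<eta> ys)) hs z) ({..<n} \<times> mindices r)"
      by (rule sum.cong'[OF refl]) (auto intro!: wedge_cong g)
    also have "\<dots> = sum' (\<lambda>(a, \<sigma>). if i \<in># \<sigma> then wedge (Gam a \<sigma>) (\<lambda>ys. pd (X a (\<sigma> - {#i#})) (\<eta> ys)) hs z else 0)
        ({..<n} \<times> mindices r)"
      by (rule sum'_shift[where G = "\<lambda>a \<sigma> b \<tau>. wedge (Gam a \<sigma>) (\<lambda>ys. pd (X b \<tau>) (\<eta> ys)) hs z", OF i])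
    also have "\<dots> = (\<Sum>(a, \<sigma>)\<in>?F. if i \<in># \<sigma> then wedge (Gam a \<sigma>) (\<lambda>ys. pd (X a (\<sigma> - {#i#})) (\<eta> ys)) hs z else 0)"
    proof (rule sum'_eq_sum[OF _ F])
      fix p assume p: "p \<in> {..<n} \<times> mindices r" "p \<notin> ?F"
      have "wedge (Gam (fst p) (snd p)) (\<lambda>ys. pd (X (fst p) (snd p - {#i#})) (\<eta> ys)) hs z = 0" if "i \<in># snd p"
      proof -
        have "Suc (size (snd p - {#i#})) = size (snd p)"
          using that by (metis insert_DiffM size_add_mset)
        then have "pd (X (fst p) (snd p - {#i#})) (\<eta> ys) z = 0" for ys
          by (intro pd_above_order[of k]) (use reg p z in \<open>auto simp: reg_def mindices_le_def minus_in_mindices\<close>)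
        then show ?thesis by (simp add: wedge_def)
      qed
      then show "(case p of (a, \<sigma>) \<Rightarrow> if i \<in># \<sigma> then wedge (Gam a \<sigma>) (\<lambda>ys. pd (X a (\<sigma> - {#i#})) (\<eta> ys)) hs z else 0) = 0"
        by (simp add: split_def)
    qed (auto simp: mindices_le_def)
    finally have 2: "sum' (\<lambda>(b, \<tau>). wedge (Gam b (add_mset i \<tau>)) (gderiv (Gam b \<tau>) (lvert n r \<eta>)) hs z) ({..<n} \<times> mindices r)
      = (\<Sum>p\<in>?F. if i \<in># snd p then wedge (Gam (fst p) (snd p)) (\<lambda>ys. pd (X (fst p) (snd p - {#i#})) (\<eta> ys)) hs z else 0)"
      by (simp add: split_def)
    have "wedge (Gam (fst p) (snd p)) (\<Psi> p i) hs z =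
        wedge (Gam (fst p) (snd p)) (\<lambda>hs. Dtot n r i (pd (X (fst p) (snd p)) (\<eta> hs))) hs z +
        (if i \<in># snd p then wedge (Gam (fst p) (snd p)) (\<lambda>ys. pd (X (fst p) (snd p - {#i#})) (\<eta> ys)) hs z else 0)" for p
      unfolding \<Psi>_def by (simp add: wedge_add)
    then show ?thesis unfolding Dtot_form_def 1 2 by (simp add: sum.distrib)
  qed
  then have "lhor n r (lvert n r \<eta>) gs z =
      (\<Sum>i<r. wedge (Dt i) (\<lambda>hs z. \<Sum>p\<in>?F. wedge (Gam (fst p) (snd p)) (\<Psi> p i) hs z) gs z)"
    unfolding lhor_def by (intro sum.cong refl wedge_cong) simp
  then show ?thesis unfolding L by (simp add: wedge_sum)
qed

subsection \<open>The canonical representative\<close>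

definition vcoeff :: "lform \<Rightarrow> nat \<Rightarrow> nat multiset \<Rightarrow> pt \<Rightarrow> real" where
  "vcoeff \<omega> a \<sigma> = \<omega> (Gam a \<sigma> # map Dt (rev [0..<r]))"

lemma lcanon_eq:
  "lcanon n r \<omega> gs z = (\<Sum>a<n. wedge (Gam a {#}) (lvol r (euler (vcoeff \<omega> a))) gs z)"
  unfolding lcanon_def euler_def[abs_def] vcoeff_def ..

lemma euler_add:
  assumes "\<And>\<sigma>. \<sigma> \<in> mindices r \<Longrightarrow> reg k (B \<sigma>)" "\<And>\<sigma>. \<sigma> \<in> mindices r \<Longrightarrow> reg k (C \<sigma>)"
    and "\<And>\<sigma> z. \<sigma> \<in> mindices r \<Longrightarrow> size \<sigma> > k \<Longrightarrow> z \<in> S \<Longrightarrow> B \<sigma> z = 0"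
    and "\<And>\<sigma> z. \<sigma> \<in> mindices r \<Longrightarrow> size \<sigma> > k \<Longrightarrow> z \<in> S \<Longrightarrow> C \<sigma> z = 0" and "z \<in> S"
  shows "euler (\<lambda>\<sigma> z. B \<sigma> z + C \<sigma> z) z = euler B z + euler C z"
proof -
  have "euler (\<lambda>\<sigma> z. B \<sigma> z + C \<sigma> z) z =
      (\<Sum>\<sigma>\<in>mindices_le r k. (-1) ^ size \<sigma> * Dtots n r \<sigma> (\<lambda>z. B \<sigma> z + C \<sigma> z) z)"
    by (rule euler_eq[OF _ assms(5)]) (simp add: assms(3,4))
  also have "\<dots> = (\<Sum>\<sigma>\<in>mindices_le r k. (-1) ^ size \<sigma> * Dtots n r \<sigma> (B \<sigma>) z + (-1) ^ size \<sigma> * Dtots n r \<sigma> (C \<sigma>) z)"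
  proof (rule sum.cong[OF refl])
    fix \<sigma> assume "\<sigma> \<in> mindices_le r k"
    then have \<sigma>: "\<sigma> \<in> mindices r" by (simp add: mindices_le_def)
    show "(-1) ^ size \<sigma> * Dtots n r \<sigma> (\<lambda>z. B \<sigma> z + C \<sigma> z) z =
        (-1) ^ size \<sigma> * Dtots n r \<sigma> (B \<sigma>) z + (-1) ^ size \<sigma> * Dtots n r \<sigma> (C \<sigma>) z"
      using Dtots_plus[OF assms(1,2)[OF \<sigma>] \<sigma> assms(5)] by (simp add: distrib_left)
  qed
  also have "\<dots> = euler B z + euler C z"
    using euler_eq[OF assms(3) assms(5)] euler_eq[OF assms(4) assms(5)] by (simp add: sum.distrib)
  finally show ?thesis .
qed

lemma euler_const_0: "z \<in> S \<Longrightarrow> euler (\<lambda>\<sigma> z. 0) z = 0"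
  using euler_eq[of 0 "\<lambda>\<sigma> z. 0" z] Dtots_const_0 by (simp add: mindices_le_def)

lemma euler_sum_eq_0:
  assumes "finite A" "\<And>a \<sigma>. a \<in> A \<Longrightarrow> \<sigma> \<in> mindices r \<Longrightarrow> reg k (B a \<sigma>)"
    and "\<And>a \<sigma> z. a \<in> A \<Longrightarrow> \<sigma> \<in> mindices r \<Longrightarrow> size \<sigma> > k \<Longrightarrow> z \<in> S \<Longrightarrow> B a \<sigma> z = 0"
    and "z \<in> S" "\<And>a. a \<in> A \<Longrightarrow> euler (B a) z = 0"
  shows "euler (\<lambda>\<sigma> z. \<Sum>a\<in>A. B a \<sigma> z) z = 0"
  using assms(1,2,3,5)
proof (induction A rule: finite_induct)
  case empty
  then show ?case using euler_const_0[OF assms(4)] by simp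
next
  case (insert a A)
  have "euler (\<lambda>\<sigma> z. B a \<sigma> z + (\<Sum>a\<in>A. B a \<sigma> z)) z = euler (B a) z + euler (\<lambda>\<sigma> z. \<Sum>a\<in>A. B a \<sigma> z) z"
    by (rule euler_add[where k = k]) (use insert assms(4) in \<open>auto intro!: reg_sum\<close>)
  then show ?case using insert by simp
qed

lemma euler_cmult:
  assumes "\<And>\<sigma>. \<sigma> \<in> mindices r \<Longrightarrow> reg k (B \<sigma>)" "z \<in> S" "euler B z = 0"
    and "\<And>\<sigma> z. \<sigma> \<in> mindices r \<Longrightarrow> size \<sigma> > k \<Longrightarrow> z \<in> S \<Longrightarrow> B \<sigma> z = 0"
  shows "euler (\<lambda>\<sigma> z. c * B \<sigma> z) z = 0"
proof -
  have "euler (\<lambda>\<sigma> z. c * B \<sigma> z) z = (\<Sum>\<sigma>\<in>mindices_le r k. (-1) ^ size \<sigma> * Dtots n r \<sigma> (\<lambda>z. c * B \<sigma> z) z)"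
    by (rule euler_eq[OF _ assms(2)]) (simp add: assms(4))
  also have "\<dots> = (\<Sum>\<sigma>\<in>mindices_le r k. c * ((-1) ^ size \<sigma> * Dtots n r \<sigma> (B \<sigma>) z))"
  proof (rule sum.cong[OF refl])
    fix \<sigma> assume "\<sigma> \<in> mindices_le r k"
    then have \<sigma>: "\<sigma> \<in> mindices r" by (simp add: mindices_le_def)
    show "(-1) ^ size \<sigma> * Dtots n r \<sigma> (\<lambda>z. c * B \<sigma> z) z = c * ((-1) ^ size \<sigma> * Dtots n r \<sigma> (B \<sigma>) z)"
      using Dtots_cmult[OF assms(1)[OF \<sigma>] \<sigma> assms(2)] by simp
  qed
  also have "\<dots> = c * euler B z"
    unfolding sum_distrib_left[symmetric] using euler_eq[OF assms(4,2)] by simp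
  finally show ?thesis using assms(3) by simp
qed

text \<open>D_i annihilates every dt^j and sends Gamma^a_\<tau> to Gamma^a_{i\<tau>}. Hence the
  derivation reaches the single vertical argument only from \<tau> = \<sigma> - i.\<close>

lemma Dtot_form_one_vertical:
  assumes ys: "\<And>g. g \<in> set ys \<Longrightarrow> is_Dt g" and a: "a < n" "\<sigma> \<in> mindices r"
  shows "Dtot_form n r i \<eta> (Gam a \<sigma> # ys) z = Dtot n r i (\<eta> (Gam a \<sigma> # ys)) z +
    (if i \<in># \<sigma> then \<eta> (Gam a (\<sigma> - {#i#}) # ys) z else 0)"
proof -
  let ?t = "\<lambda>(b, \<tau>). wedge (Gam b (add_mset i \<tau>)) (gderiv (Gam b \<tau>) \<eta>) (Gam a \<sigma> # ys) z"
  have t: "?t p = (if fst p = a \<and> add_mset i (snd p) = \<sigma> then \<eta> (Gam a (snd p) # ys) z else 0)" for p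
  proof -
    have "wedge (Gam (fst p) (add_mset i (snd p))) (\<lambda>hs. gderiv (Gam (fst p) (snd p)) \<eta> (Gam a \<sigma> # hs)) ys z = 0"
    proof (rule wedge_zero_if)
      fix hs assume "mset ys = add_mset (Gam (fst p) (add_mset i (snd p))) (mset hs)"
      then have "Gam (fst p) (add_mset i (snd p)) \<in> set ys" by (metis set_mset_mset union_single_eq_member)
      then show "gderiv (Gam (fst p) (snd p)) \<eta> (Gam a \<sigma> # hs) z = 0" using ys by fastforce
    qed
    then show ?thesis by (auto simp: split_def wedge_Cons gderiv_def)
  qed
  have "sum' ?t ({..<n} \<times> mindices r) = sum ?t (if i \<in># \<sigma> then {(a, \<sigma> - {#i#})} else {})"
  proof (rule sum'_eq_sum)
    show "?t p = 0" if "p \<notin> (if i \<in># \<sigma> then {(a, \<sigma> - {#i#})} else {})" for p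
      unfolding t using that by (cases p) (auto split: if_splits)
  qed (use a in \<open>auto simp: minus_in_mindices\<close>)
  also have "\<dots> = (if i \<in># \<sigma> then \<eta> (Gam a (\<sigma> - {#i#}) # ys) z else 0)"
    unfolding t by simp
  finally show ?thesis by (simp add: Dtot_form_def)
qed

text \<open>A coefficient of D\<eta> is a signed sum of expressions as in
  \<open>euler_divergence\<close>, one for each dt^i split off from the volume form.
  \<open>B\<close> is this sum; it comes with the regularity and order bounds under which
  \<open>euler\<close> is additive.\<close>

lemma euler_lhor:
  assumes reg: "\<And>hs. reg k (\<eta> hs)"
    and order: "\<And>a \<sigma> hs z. size \<sigma> > k \<Longrightarrow> \<eta> (Gam a \<sigma> # hs) z = 0"
    and a: "a < n" and z: "z \<in> S"
  shows "\<exists>B. (\<forall>\<sigma>\<in>mindices r. reg (Suc k) (B \<sigma>)) \<and>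
    (\<forall>\<sigma>\<in>mindices r. \<forall>z\<in>S. B \<sigma> z = vcoeff (lhor n r \<eta>) a \<sigma> z) \<and>
    (\<forall>\<sigma>\<in>mindices r. size \<sigma> > Suc k \<longrightarrow> (\<forall>z\<in>S. B \<sigma> z = 0)) \<and> euler B z = 0"
proof -
  let ?ds = "map Dt (rev [0..<r])"
  \<comment> \<open>Pairs of a direction \<open>i\<close> and the position \<open>j\<close> of
    \<open>Dt i\<close> in the argument list. \<open>C j\<close> below is the coefficient of
    \<open>\<eta>\<close> with exactly this argument left out.\<close>
  define P where "P = (SIGMA i:{..<r}. {j. j < length ?ds \<and> ?ds ! j = Dt i})"
  define C where "C j \<sigma> = \<eta> (Gam a \<sigma> # (take j ?ds @ drop (Suc j) ?ds))" for j \<sigma>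
  define B0 where "B0 p \<sigma> z = Dtot n r (fst p) (C (snd p) \<sigma>) z +
    (if fst p \<in># \<sigma> then C (snd p) (\<sigma> - {#fst p#}) z else 0)" for p :: "nat \<times> nat" and \<sigma> z
  \<comment> \<open>The minus sign arises from moving dt^i past the vertical argument in front, the
    power of -1 from the \<open>j\<close> horizontal arguments before it.\<close>
  define B where "B \<sigma> z = (\<Sum>p\<in>P. - ((-1) ^ snd p) * B0 p \<sigma> z)" for \<sigma> z
  have P: "finite P" unfolding P_def by (intro finite_SigmaI) auto
  have regC: "reg k (C j \<sigma>)" for j \<sigma> unfolding C_def by (rule reg)
  have C0: "C j \<sigma> z = 0" if "size \<sigma> > k" for j \<sigma> z unfolding C_def by (rule order[OF that])
  have regB0: "reg (Suc k) (B0 p \<sigma>)" if p: "p \<in> P" for p \<sigma>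
  proof -
    have 1: "reg (Suc k) (Dtot n r (fst p) (C (snd p) \<sigma>))" using p by (intro reg_Dtot regC) (auto simp: P_def)
    have 2: "reg (Suc k) (\<lambda>z. if fst p \<in># \<sigma> then C (snd p) (\<sigma> - {#fst p#}) z else 0)"
      using reg_mono[OF regC, of "Suc k"] reg_const[of "Suc k" 0] by (cases "fst p \<in># \<sigma>") simp_all
    show ?thesis unfolding B0_def[abs_def] by (rule reg_add[OF 1 2])
  qed
  have B00: "B0 p \<sigma> w = 0" if p: "p \<in> P" and \<sigma>: "\<sigma> \<in> mindices r" "size \<sigma> > Suc k" and w: "w \<in> S" for p \<sigma> w
  proof -
    have "Dtot n r (fst p) (C (snd p) \<sigma>) w = Dtot n r (fst p) (\<lambda>z. 0) w"
      by (rule Dtot_cong[OF C0 w]) (use p \<sigma> in \<open>auto simp: P_def\<close>)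
    moreover have "C (snd p) (\<sigma> - {#fst p#}) w = 0" if "fst p \<in># \<sigma>"
    proof (rule C0)
      have "Suc (size (\<sigma> - {#fst p#})) = size \<sigma>" using that by (metis insert_DiffM size_add_mset)
      then show "size (\<sigma> - {#fst p#}) > k" using \<sigma> by simp
    qed
    ultimately show ?thesis by (simp add: B0_def Dtot_const)
  qed
  have eB0: "euler (B0 p) z = 0" if "p \<in> P" for p
    unfolding B0_def[abs_def]
    by (rule euler_divergence[OF regC C0 z]) (use that in \<open>auto simp: P_def\<close>)
  have eB: "euler B z = 0"
    unfolding B_def[abs_def]
  proof (rule euler_sum_eq_0[OF P, where k = "Suc k"])
    show "euler (\<lambda>\<sigma> z. - ((- 1) ^ snd p) * B0 p \<sigma> z) z = 0" if "p \<in> P" for p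
      by (rule euler_cmult[OF regB0[OF that] z eB0[OF that] B00[OF that]])
    show "reg (Suc k) (\<lambda>z. - ((- 1) ^ snd p) * B0 p \<sigma> z)" if "p \<in> P" for p \<sigma>
      by (rule reg_cmult[OF regB0[OF that]])
  qed (auto simp: B00 z)
  have eq: "B \<sigma> w = vcoeff (lhor n r \<eta>) a \<sigma> w" if \<sigma>: "\<sigma> \<in> mindices r" for \<sigma> w
  proof -
    have "vcoeff (lhor n r \<eta>) a \<sigma> w = (\<Sum>i<r. - wedge (Dt i) (\<lambda>ys. Dtot_form n r i \<eta> (Gam a \<sigma> # ys)) ?ds w)"
      by (simp add: vcoeff_def lhor_def wedge_Cons)
    also have "\<dots> = (\<Sum>i<r. \<Sum>j | j < length ?ds \<and> ?ds ! j = Dt i. - ((-1) ^ j) * B0 (i, j) \<sigma> w)"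
    proof (rule sum.cong[OF refl])
      fix i
      have "Dtot_form n r i \<eta> (Gam a \<sigma> # take j ?ds @ drop (Suc j) ?ds) w = B0 (i, j) \<sigma> w" for j
        unfolding B0_def C_def fst_conv snd_conv
        by (rule Dtot_form_one_vertical) (use a \<sigma> in \<open>auto dest!: in_set_takeD in_set_dropD\<close>)
      then show "- wedge (Dt i) (\<lambda>ys. Dtot_form n r i \<eta> (Gam a \<sigma> # ys)) ?ds w =
          (\<Sum>j | j < length ?ds \<and> ?ds ! j = Dt i. - ((-1) ^ j) * B0 (i, j) \<sigma> w)"
        by (simp add: wedge_def sum_negf)
    qed
    also have "\<dots> = B \<sigma> w"
      unfolding B_def P_def by (subst sum.Sigma) (auto simp: split_def)
    finally show ?thesis by simp
  qed
  show ?thesis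
  proof (intro exI[of _ B] conjI ballI impI eB eq)
    show "reg (Suc k) (B \<sigma>)" for \<sigma>
      unfolding B_def[abs_def] by (intro reg_sum[OF P] reg_cmult regB0)
    show "B \<sigma> w = 0" if "\<sigma> \<in> mindices r" "size \<sigma> > Suc k" "w \<in> S" for \<sigma> w
      unfolding B_def using B00 that by simp
  qed
qed

lemma euler_vcoeff_add_lhor:
  assumes \<omega>: "\<And>hs. reg k (\<omega> hs)" "\<And>a \<sigma> hs z. size \<sigma> > k \<Longrightarrow> \<omega> (Gam a \<sigma> # hs) z = 0"
    and \<eta>: "\<And>hs. reg k (\<eta> hs)" "\<And>a \<sigma> hs z. size \<sigma> > k \<Longrightarrow> \<eta> (Gam a \<sigma> # hs) z = 0"
    and \<omega>': "\<And>gs z. gs \<in> lists (gens n r) \<Longrightarrow> z \<in> S \<Longrightarrow> \<omega>' gs z = \<omega> gs z + lhor n r \<eta> gs z"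
    and a: "a < n" and z: "z \<in> S"
  shows "euler (vcoeff \<omega>' a) z = euler (vcoeff \<omega> a) z"
proof -
  obtain B where B: "\<And>\<sigma>. \<sigma> \<in> mindices r \<Longrightarrow> reg (Suc k) (B \<sigma>)"
    "\<And>\<sigma> z. \<sigma> \<in> mindices r \<Longrightarrow> z \<in> S \<Longrightarrow> B \<sigma> z = vcoeff (lhor n r \<eta>) a \<sigma> z"
    "\<And>\<sigma> z. \<sigma> \<in> mindices r \<Longrightarrow> size \<sigma> > Suc k \<Longrightarrow> z \<in> S \<Longrightarrow> B \<sigma> z = 0" "euler B z = 0"
    using euler_lhor[where \<eta> = \<eta> and k = k, OF \<eta> a z] by blast
  have "euler (vcoeff \<omega>' a) z = euler (\<lambda>\<sigma> z. vcoeff \<omega> a \<sigma> z + B \<sigma> z) z"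
  proof (rule euler_cong[OF _ z])
    fix \<sigma> w assume \<sigma>: "\<sigma> \<in> mindices r" and w: "w \<in> S"
    show "vcoeff \<omega>' a \<sigma> w = vcoeff \<omega> a \<sigma> w + B \<sigma> w"
      unfolding B(2)[OF \<sigma> w] unfolding vcoeff_def
      by (rule \<omega>'[OF _ w]) (use a \<sigma> in auto)
  qed
  also have "\<dots> = euler (vcoeff \<omega> a) z + euler B z"
  proof (rule euler_add[where k = "Suc k"])
    show "reg (Suc k) (vcoeff \<omega> a \<sigma>)" for \<sigma> unfolding vcoeff_def by (rule reg_mono[OF \<omega>(1)]) simp
    show "vcoeff \<omega> a \<sigma> z = 0" if "size \<sigma> > Suc k" for \<sigma> z
      unfolding vcoeff_def by (rule \<omega>(2)) (use that in simp)
  qed (use B z in auto)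
  finally show ?thesis using B(4) by simp
qed

end

section \<open>Open subsets of Euclidean space\<close>

lemma openin_Euclidean_space_iff:
  "openin (Euclidean_space n) W \<longleftrightarrow> (\<exists>A. open A \<and> W = A \<inter> {x. \<forall>i\<ge>n. x i = 0})"
  unfolding Euclidean_space_def openin_subtopology euclidean_product_topology by simp

lemma coord_open_Euclidean:
  assumes "openin (Euclidean_space n) W"
  shows "coord_open {..<n} W"
  unfolding coord_open_def
proof (intro ballI allI impI)
  fix z F assume z: "z \<in> W" and F: "finite F" "F \<subseteq> {..<n}"
  obtain A where A: "open A" "W = A \<inter> {x. \<forall>i\<ge>n. x i = 0}"
    using assms[unfolded openin_Euclidean_space_iff] by (elim exE conjE) (rule that)
  obtain e where e: "e > 0" "\<forall>z'. near F e z z' \<longrightarrow> z' \<in> A"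
    using open_near[OF A(1) _ F(1), of z] z A(2) by blast
  have "z' \<in> W" if "near F e z z'" for z'
  proof -
    have "z' i = 0" if "i \<ge> n" for i
    proof -
      have "i \<notin> F" using that F(2) by auto
      then show ?thesis using \<open>near F e z z'\<close> z A(2) that by (auto simp: near_def)
    qed
    then show ?thesis using that e(2) A(2) by auto
  qed
  then show "\<exists>e>0. \<forall>z'. near F e z z' \<longrightarrow> z' \<in> W" using e(1) by blast
qed

lemma openin_Euclidean_zero: "openin (Euclidean_space n) W \<Longrightarrow> z \<in> W \<Longrightarrow> i \<ge> n \<Longrightarrow> z i = 0"
  by (auto simp: openin_Euclidean_space_iff)

lemma depends_on_Euclidean:
  assumes "openin (Euclidean_space n) W"
  shows "depends_on {..<n} W f"
proof (rule depends_onI)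
  fix z z' assume z: "z \<in> W" "z' \<in> W" "\<forall>i\<in>{..<n}. z i = z' i"
  have "z i = z' i" for i
    using z openin_Euclidean_zero[OF assms z(1), of i] openin_Euclidean_zero[OF assms z(2), of i]
    by (cases "i < n") auto
  then have "z = z'" by (rule ext)
  then show "f z = f z'" by simp
qed

text \<open>\<open>Euclidean_space n\<close> is the subspace of sequences vanishing from index
  \<open>n\<close> on. The values of \<open>\<gamma>\<close> lie in it, so only the open set of the
  ambient product has to be pulled back.\<close>

lemma openin_Euclidean_preimage:
  assumes "openin (Euclidean_space r) W" "continuous_on W \<gamma>"
    and "\<And>u i. u \<in> W \<Longrightarrow> i \<ge> n \<Longrightarrow> \<gamma> u i = 0" and "openin (Euclidean_space n) V"
  shows "openin (Euclidean_space r) {u \<in> W. \<gamma> u \<in> V}"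
proof -
  obtain A where A: "open A" "W = A \<inter> {x. \<forall>i\<ge>r. x i = 0}"
    using assms(1)[unfolded openin_Euclidean_space_iff] by (elim exE conjE) (rule that)
  obtain B where B: "open B" "V = B \<inter> {x. \<forall>i\<ge>n. x i = 0}"
    using assms(4)[unfolded openin_Euclidean_space_iff] by (elim exE conjE) (rule that)
  have "\<exists>C. open C \<and> W \<inter> \<gamma> -` B = W \<inter> C"
    using continuous_openin_preimage_gen[OF assms(2) B(1)] unfolding openin_open .
  then obtain C where C: "open C" "W \<inter> \<gamma> -` B = W \<inter> C"
    by (elim exE conjE) (rule that)
  have "{u \<in> W. \<gamma> u \<in> V} = W \<inter> \<gamma> -` B" unfolding B(2) using assms(3) by auto
  also have "\<dots> = (A \<inter> C) \<inter> {x. \<forall>i\<ge>r. x i = 0}" using C(2) A(2) by blast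
  finally show ?thesis
    unfolding openin_Euclidean_space_iff
    by (intro exI[of _ "A \<inter> C"] conjI open_Int[OF A(1) C(1)])
qed

section \<open>Iterated partial derivatives of restricted, perturbed and translated
  functions\<close>

lemma smooth_on_subset:
  assumes "smooth_on I S f" "S' \<subseteq> S"
  shows "smooth_on I S' f"
  unfolding smooth_on_def
proof (intro ballI conjI)
  fix "is" assume isl: "is \<in> lists I"
  note f = bspec[OF assms(1)[unfolded smooth_on_def] isl]
  show "continuous_on S' (foldr pd is f)"
    using f assms(2) by (elim conjE) (rule continuous_on_subset)
  fix i z assume "i \<in> I" "z \<in> S'"
  then show "(\<lambda>s. foldr pd is f (z(i := s))) differentiable (at (z i))"
    using f assms(2) by auto
qed

lemma pds_cong:
  assumes "coord_open I S" "set is \<subseteq> I" "z \<in> S" "\<And>z. z \<in> S \<Longrightarrow> f z = g z"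
  shows "foldr pd is f z = foldr pd is g z"
  using assms(2,3)
proof (induction "is" arbitrary: z)
  case (Cons i "is")
  then show ?case by (auto intro!: pd_cong[OF assms(1)])
qed (simp add: assms(4))

lemma pds_add_cmult:
  assumes "coord_open I S" "smooth_on I S f" "smooth_on I S g" "set is \<subseteq> I" "z \<in> S"
  shows "foldr pd is (\<lambda>z. f z + e * g z) z = foldr pd is f z + e * foldr pd is g z"
  using assms(4,5)
proof (induction "is" arbitrary: z)
  case (Cons i "is")
  have i: "i \<in> I" and isl: "is \<in> lists I" using Cons.prems by auto
  note f = smooth_onD[OF smooth_on_pds[OF assms(2) isl]]
  note g = smooth_onD[OF smooth_on_pds[OF assms(3) isl]]
  have "pd i (foldr pd is (\<lambda>z. f z + e * g z)) z = pd i (\<lambda>z. foldr pd is f z + e * foldr pd is g z) z"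
    by (rule pd_cong[OF assms(1) Cons.prems(2) i]) (use Cons in auto)
  also have "\<dots> = pd i (foldr pd is f) z + pd i (\<lambda>z. e * foldr pd is g z) z"
    by (rule pd_add[OF f Ck_mult[OF assms(1) Ck_const g] i Cons.prems(2)])
  also have "pd i (\<lambda>z. e * foldr pd is g z) z = e * pd i (foldr pd is g) z"
    by (rule pd_cmult[OF g i Cons.prems(2)])
  finally show ?case by simp
qed simp

lemma pd_translate: "pd i (\<lambda>u. f (\<lambda>k. u k + h k)) u = pd i f (\<lambda>k. u k + h k)"
proof -
  have "(\<lambda>s. f (\<lambda>k. (u(i := s)) k + h k)) = (\<lambda>s. (\<lambda>s. f ((\<lambda>k. u k + h k)(i := s))) (s + h i))"
    by (auto simp: fun_eq_iff intro!: arg_cong[where f = f])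
  then show ?thesis
    unfolding pd_def by (simp add: deriv_def DERIV_shift)
qed

lemma pds_translate:
  "foldr pd is (\<lambda>u. f (\<lambda>k. u k + h k)) u = foldr pd is f (\<lambda>k. u k + h k)"
proof (induction "is" arbitrary: u)
  case (Cons i "is")
  have "foldr pd is (\<lambda>u. f (\<lambda>k. u k + h k)) = (\<lambda>u. foldr pd is f (\<lambda>k. u k + h k))"
    using Cons by (rule ext)
  then show ?case by (simp add: pd_translate)
qed simp

text \<open>Freezing a coordinate commutes with derivatives in the other directions. This describes
  the jets of a section restricted to a slice in \<open>proj_in_J\<close>.\<close>

lemma pd_restrict:
  assumes "i \<noteq> j"
  shows "pd i (\<lambda>u. f (u(j := x))) u = pd i f (u(j := x))"
proof -
  have "(\<lambda>s. f ((u(i := s))(j := x))) = (\<lambda>s. f ((u(j := x))(i := s)))"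
    by (intro ext arg_cong[where f = f] fun_upd_twist assms)
  then show ?thesis unfolding pd_def fun_upd_other[OF assms] by simp
qed

lemma pds_restrict:
  assumes "j \<notin> set is"
  shows "foldr pd is (\<lambda>u. f (u(j := x))) u = foldr pd is f (u(j := x))"
  using assms
proof (induction "is" arbitrary: u)
  case (Cons i "is")
  have "foldr pd is (\<lambda>u. f (u(j := x))) = (\<lambda>u. foldr pd is f (u(j := x)))"
    by (rule ext, rule Cons.IH) (use Cons.prems in simp)
  then have "foldr pd (i # is) (\<lambda>u. f (u(j := x))) u = pd i (\<lambda>u. foldr pd is f (u(j := x))) u"
    by (simp only: foldr.simps o_apply)
  also have "\<dots> = pd i (foldr pd is f) (u(j := x))"
    by (rule pd_restrict) (use Cons.prems in auto)
  finally show ?case by (simp only: foldr.simps o_apply)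
qed simp

subsection \<open>Monomials\<close>

text \<open>The Taylor monomial at \<open>t\<close>. The factorials make these functions dual to the
  iterated derivatives at \<open>t\<close>: the derivative with index \<tau> is 1 for \<tau> =
  \<sigma> and 0 otherwise (\<open>pds_monomial_at\<close>).\<close>

definition monomial :: "nat \<Rightarrow> (nat \<Rightarrow> real) \<Rightarrow> nat multiset \<Rightarrow> (nat \<Rightarrow> real) \<Rightarrow> real" where
  "monomial r t \<sigma> u = (\<Prod>j<r. (u j - t j) ^ count \<sigma> j / fact (count \<sigma> j))"

lemma DERIV_monomial:
  assumes "i < r"
  shows "((\<lambda>s. monomial r t \<sigma> (u(i := s))) has_real_derivative
    (if i \<in># \<sigma> then monomial r t (\<sigma> - {#i#}) u else 0)) (at (u i))"
proof -
  let ?R = "\<Prod>j\<in>{..<r} - {i}. (u j - t j) ^ count \<sigma> j / fact (count \<sigma> j)"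
  have eq: "monomial r t \<sigma> (u(i := s)) = (s - t i) ^ count \<sigma> i / fact (count \<sigma> i) * ?R" for s
    unfolding monomial_def by (subst prod.remove[of _ i]) (use assms in \<open>auto intro!: prod.cong\<close>)
  have "((\<lambda>s. (s - t i) ^ count \<sigma> i / fact (count \<sigma> i) * ?R) has_real_derivative
      real (count \<sigma> i) * (u i - t i) ^ (count \<sigma> i - 1) / fact (count \<sigma> i) * ?R) (at (u i))"
    by (auto intro!: derivative_eq_intros)
  also have "real (count \<sigma> i) * (u i - t i) ^ (count \<sigma> i - 1) / fact (count \<sigma> i) * ?R =
      (if i \<in># \<sigma> then monomial r t (\<sigma> - {#i#}) u else 0)"
  proof (cases "i \<in># \<sigma>")
    case True
    then obtain m where m: "count \<sigma> i = Suc m" by (metis count_greater_zero_iff gr0_implies_Suc)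
    have R: "?R = (\<Prod>j\<in>{..<r} - {i}. (u j - t j) ^ count (\<sigma> - {#i#}) j / fact (count (\<sigma> - {#i#}) j))"
      by (rule prod.cong) auto
    have "monomial r t (\<sigma> - {#i#}) u = (u i - t i) ^ m / fact m * ?R"
      unfolding monomial_def R by (subst prod.remove[of _ i]) (use assms m in auto)
    moreover have "real (Suc m) * x / fact (Suc m) = x / fact m" for x :: real
      unfolding fact_Suc of_nat_mult by simp
    ultimately show ?thesis using True m by simp
  next
    case False
    then have "count \<sigma> i = 0" by (simp add: not_in_iff)
    then show ?thesis using False by simp
  qed
  finally show ?thesis by (simp only: eq)
qed

lemma pd_monomial:
  "i < r \<Longrightarrow> pd i (monomial r t \<sigma>) u = (if i \<in># \<sigma> then monomial r t (\<sigma> - {#i#}) u else 0)"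
  by (rule pd_eqI) (rule DERIV_monomial)

lemma smooth_on_monomial: "smooth_on {..<r} W (monomial r t \<sigma>)"
proof (rule smooth_onI)
  fix k show "Ck k {..<r} W (monomial r t \<sigma>)"
  proof (induction k arbitrary: \<sigma>)
    case 0
    have "continuous_on W (monomial r t \<sigma>)"
      unfolding monomial_def
      by (intro continuous_intros continuous_on_subset[OF continuous_on_product_coordinates subset_UNIV]) auto
    moreover have "(\<lambda>s. monomial r t \<sigma> (u(i := s))) differentiable (at (u i))" if "i < r" for u i
      unfolding real_differentiable_def using DERIV_monomial[OF that] by blast
    ultimately show ?case by simp
  next
    case (Suc k)
    have "Ck k {..<r} W (pd i (monomial r t \<sigma>))" if "i < r" for i
    proof -
      have "pd i (monomial r t \<sigma>) = (if i \<in># \<sigma> then monomial r t (\<sigma> - {#i#}) else (\<lambda>_. 0))"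
        by (rule ext) (simp add: pd_monomial[OF that])
      then show ?thesis using Suc Ck_const[of k "{..<r}" W 0] by simp
    qed
    then show ?case using Ck_0[OF Suc] by simp
  qed
qed

lemma pds_monomial:
  assumes "set is \<subseteq> {..<r}"
  shows "foldr pd is (monomial r t \<sigma>) = (if mset is \<subseteq># \<sigma> then monomial r t (\<sigma> - mset is) else (\<lambda>_. 0))"
  using assms
proof (induction "is")
  case (Cons i "is")
  then have IH: "foldr pd is (monomial r t \<sigma>) = (if mset is \<subseteq># \<sigma> then monomial r t (\<sigma> - mset is) else (\<lambda>_. 0))"
    and i: "i < r" by auto
  show ?case
  proof (cases "mset is \<subseteq># \<sigma>")
    case True
    have "add_mset i (mset is) \<subseteq># \<sigma> \<longleftrightarrow> i \<in># \<sigma> - mset is"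
    proof -
      obtain D where "\<sigma> = mset is + D" using True by (metis subset_mset.add_diff_inverse)
      then show ?thesis
        using mset_subset_eq_mono_add_left_cancel[of "mset is" "{#i#}" D] by simp
    qed
    then show ?thesis
      using True IH i by (intro ext) (simp add: pd_monomial)
  next
    case False
    then have "\<not> add_mset i (mset is) \<subseteq># \<sigma>" by (meson mset_subset_eq_insertD subset_mset.less_imp_le)
    moreover have "pd i (\<lambda>_. 0) = (\<lambda>_::nat \<Rightarrow> real. 0)" by (rule ext) (rule pd_const)
    ultimately show ?thesis using False IH by simp
  qed
qed simp

lemma monomial_at:
  assumes "\<sigma> \<in> mindices r"
  shows "monomial r t \<sigma> t = (if \<sigma> = {#} then 1 else 0)"
proof (cases "\<sigma> = {#}")
  case False
  then obtain j where "j \<in># \<sigma>" by auto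
  then have "j < r" "count \<sigma> j \<noteq> 0" using assms by (auto simp: mindices_def)
  then have "\<exists>j\<in>{..<r}. (t j - t j) ^ count \<sigma> j / fact (count \<sigma> j) = 0" by (intro bexI[of _ j]) auto
  then show ?thesis using False unfolding monomial_def by (simp add: prod_zero)
qed (simp add: monomial_def)

lemma pds_monomial_at:
  assumes "\<sigma> \<in> mindices r" "\<tau> \<in> mindices r"
  shows "foldr pd (sorted_list_of_multiset \<tau>) (monomial r t \<sigma>) t = (if \<sigma> = \<tau> then 1 else 0)"
proof (cases "\<tau> \<subseteq># \<sigma>")
  case True
  then obtain D where D: "\<sigma> = \<tau> + D" by (metis subset_mset.add_diff_inverse)
  then have "D \<in> mindices r" using assms(1) by (auto simp: mindices_def)
  then show ?thesis
    unfolding pds_monomial[OF set_sorted_mindices[OF assms(2)]] using D by (simp add: monomial_at)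
qed (auto simp: pds_monomial[OF set_sorted_mindices[OF assms(2)]])

section \<open>Jets of sections\<close>

locale mfd =
  fixes M :: "'m mfd"
  assumes smooth_manifold: "smooth_manifold M"
begin

abbreviation n :: nat where "n \<equiv> mdim M"

lemma chart_inj: "c \<in> atlas M \<Longrightarrow> inj_on (snd c) (fst c)"
  and chart_open: "c \<in> atlas M \<Longrightarrow> openin (mtop M) (fst c)"
  and chart_homeo: "c \<in> atlas M \<Longrightarrow> homeomorphic_map (subtopology (mtop M) (fst c))
        (subtopology (Euclidean_space n) (snd c ` fst c)) (snd c)"
  and chart_image_open: "c \<in> atlas M \<Longrightarrow> openin (Euclidean_space n) (snd c ` fst c)"
proof -
  assume "c \<in> atlas M"
  then show 1: "openin (mtop M) (fst c)"
    and 2: "homeomorphic_map (subtopology (mtop M) (fst c))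
        (subtopology (Euclidean_space n) (snd c ` fst c)) (snd c)"
    and "openin (Euclidean_space n) (snd c ` fst c)"
    using smooth_manifold unfolding smooth_manifold_def by auto
  show "inj_on (snd c) (fst c)"
    using homeomorphic_imp_injective_map[OF 2] openin_subset[OF 1] by (simp add: Int_absorb1)
qed

lemma overlap_open:
  assumes "c \<in> atlas M" "c' \<in> atlas M"
  shows "openin (Euclidean_space n) (snd c ` (fst c \<inter> fst c'))"
proof -
  have "openin (subtopology (mtop M) (fst c)) (fst c \<inter> fst c')"
    using chart_open[OF assms(2)] by (simp add: openin_subtopology_Int2 Int_commute)
  then have "openin (subtopology (Euclidean_space n) (snd c ` fst c)) (snd c ` (fst c \<inter> fst c'))"
    using homeomorphic_imp_open_map[OF chart_homeo[OF assms(1)]] unfolding open_map_def by blast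
  then show ?thesis
    using openin_trans_full chart_image_open[OF assms(1)] by blast
qed

lemma transition_smooth:
  assumes "c \<in> atlas M" "c' \<in> atlas M" "b < n"
  shows "smooth_on {..<n} (snd c ` (fst c \<inter> fst c')) (\<lambda>x. snd c' (inv_into (fst c) (snd c) x) b)"
proof -
  have *: "\<forall>(U, \<phi>) \<in> atlas M. \<forall>(V, \<psi>) \<in> atlas M. \<forall>b < mdim M.
      smooth_on {..<mdim M} (\<phi> ` (U \<inter> V)) (\<lambda>x. \<psi> (inv_into U \<phi> x) b)"
    using smooth_manifold unfolding smooth_manifold_def by (elim conjE)
  show ?thesis
    using bspec[OF *, OF assms(1)] assms(2,3) by (cases c; cases c') fastforce
qed

lemma chart_zero: "c \<in> atlas M \<Longrightarrow> p \<in> fst c \<Longrightarrow> i \<ge> n \<Longrightarrow> snd c p i = 0"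
  using openin_Euclidean_zero[OF chart_image_open] by blast

lemma continuous_chart_comp:
  assumes "c \<in> atlas M" "s ` W \<subseteq> fst c" "\<And>a. a < n \<Longrightarrow> continuous_on W (\<lambda>u. snd c (s u) a)"
  shows "continuous_on W (\<lambda>u. snd c (s u))"
proof (rule continuous_on_coordinatewise_then_product)
  fix a
  show "continuous_on W (\<lambda>u. snd c (s u) a)"
  proof (cases "a < n")
    case False
    have "continuous_on W (\<lambda>u. 0::real)" by (rule continuous_on_const)
    then show ?thesis
      by (rule continuous_on_cong[THEN iffD1, rotated -1])
         (use chart_zero[OF assms(1)] assms(2) False in auto)
  qed (rule assms(3))
qed

definition smooth_rep :: "nat \<Rightarrow> 'm chart \<Rightarrow> (nat \<Rightarrow> real) set \<Rightarrow> ((nat \<Rightarrow> real) \<Rightarrow> 'm) \<Rightarrow> bool" where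
  "smooth_rep r c W s \<longleftrightarrow> openin (Euclidean_space r) W \<and> s ` W \<subseteq> fst c \<and>
    (\<forall>a<n. smooth_on {..<r} W (\<lambda>u. snd c (s u) a))"

lemma smooth_repD:
  "smooth_rep r c W s \<Longrightarrow> openin (Euclidean_space r) W"
  "smooth_rep r c W s \<Longrightarrow> s ` W \<subseteq> fst c"
  "smooth_rep r c W s \<Longrightarrow> a < n \<Longrightarrow> smooth_on {..<r} W (\<lambda>u. snd c (s u) a)"
  unfolding smooth_rep_def by simp_all

lemma smooth_rep_subset:
  assumes "smooth_rep r c W s" "openin (Euclidean_space r) W'" "W' \<subseteq> W"
  shows "smooth_rep r c W' s"
  unfolding smooth_rep_def
proof (intro conjI allI impI assms(2))
  show "s ` W' \<subseteq> fst c" using smooth_repD(2)[OF assms(1)] assms(3) by blast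
  show "smooth_on {..<r} W' (\<lambda>u. snd c (s u) a)" if "a < n" for a
    by (rule smooth_on_subset[OF smooth_repD(3)[OF assms(1) that] assms(3)])
qed

lemma smooth_near_iff: "smooth_near M r t s \<longleftrightarrow> (\<exists>c\<in>atlas M. \<exists>W. t \<in> W \<and> smooth_rep r c W s)"
  unfolding smooth_near_def smooth_rep_def split_def
  by (intro bex_cong refl ex_cong1) (simp only: conj_ac)

lemma smooth_rep_germs:
  assumes "c \<in> atlas M" "smooth_rep r c W s" "u \<in> W"
  shows "(u, s) \<in> germs M r"
proof -
  have "u \<in> topspace (Euclidean_space r)"
    using openin_subset[OF smooth_repD(1)[OF assms(2)]] assms(3) by blast
  moreover have "smooth_near M r u s" unfolding smooth_near_iff using assms by blast
  ultimately show ?thesis by (simp add: germs_def)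
qed

lemma smooth_rep_continuous:
  assumes "c \<in> atlas M" "smooth_rep r c W s"
  shows "continuous_on W (\<lambda>u. snd c (s u))"
  by (rule continuous_chart_comp[OF assms(1) smooth_repD(2)[OF assms(2)]])
     (rule smooth_on_continuous[OF smooth_repD(3)[OF assms(2)]])

text \<open>\<open>smooth_near\<close> provides some chart only. The domain is shrunk to the
  preimage of the overlap, which is open by continuity, and the representative is composed with the
  smooth change of charts. Thus a germ may be studied in any chart around its value.\<close>

lemma germs_smooth_rep:
  assumes "(t, s) \<in> germs M r" "s t \<in> fst c" "c \<in> atlas M"
  obtains W where "smooth_rep r c W s" "t \<in> W"
proof -
  obtain c' W0 where c': "c' \<in> atlas M" and W0: "smooth_rep r c' W0 s" "t \<in> W0"
    using assms(1) unfolding germs_def smooth_near_iff by blast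
  let ?V = "snd c' ` (fst c' \<inter> fst c)"
  define W where "W = {u \<in> W0. snd c' (s u) \<in> ?V}"
  have cont: "continuous_on W0 (\<lambda>u. snd c' (s u))" by (rule smooth_rep_continuous[OF c' W0(1)])
  have W: "openin (Euclidean_space r) W"
    unfolding W_def
    by (rule openin_Euclidean_preimage[OF _ cont _ overlap_open[OF c' assms(3)]])
       (use W0(1) chart_zero[OF c'] in \<open>auto simp: smooth_rep_def\<close>)
  have sub: "s u \<in> fst c" "s u \<in> fst c'" if "u \<in> W" for u
  proof -
    show "s u \<in> fst c'" using that W0(1) by (auto simp: W_def smooth_rep_def)
    moreover have "\<exists>p. p \<in> fst c' \<and> p \<in> fst c \<and> snd c' (s u) = snd c' p"
      using that unfolding W_def by blast
    ultimately show "s u \<in> fst c" using inj_onD[OF chart_inj[OF c']] by metis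
  qed
  have "smooth_on {..<r} W (\<lambda>u. snd c (s u) a)" if a: "a < n" for a
  proof (rule smooth_on_cong[OF coord_open_Euclidean[OF W]])
    show "smooth_on {..<r} W (\<lambda>u. (\<lambda>x. snd c (inv_into (fst c') (snd c') x) a) (snd c' (s u)))"
    proof (rule smooth_on_comp[where K = "{..<n}" and F = "{..<n}" and S = ?V
          and \<gamma> = "\<lambda>u. snd c' (s u)" and f = "\<lambda>x. snd c (inv_into (fst c') (snd c') x) a"])
      show "coord_open {..<n} ?V" by (rule coord_open_Euclidean[OF overlap_open[OF c' assms(3)]])
      show "coord_open {..<r} W" by (rule coord_open_Euclidean[OF W])
      show "depends_on {..<n} ?V (\<lambda>x. snd c (inv_into (fst c') (snd c') x) a)"
        by (rule depends_on_Euclidean[OF overlap_open[OF c' assms(3)]])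
      show "smooth_on {..<n} ?V (\<lambda>x. snd c (inv_into (fst c') (snd c') x) a)"
        by (rule transition_smooth[OF c' assms(3) a])
      show "continuous_on W (\<lambda>u. snd c' (s u))"
        by (rule continuous_on_subset[OF cont]) (auto simp: W_def)
      show "smooth_on {..<r} W (\<lambda>u. snd c' (s u) j)" if "j \<in> {..<n}" for j
        by (rule smooth_on_subset[OF smooth_repD(3)[OF W0(1)]]) (use that in \<open>auto simp: W_def\<close>)
    qed (auto simp: W_def)
  qed (simp add: inv_into_f_f[OF chart_inj[OF c']] sub)
  then have "smooth_rep r c W s" using W sub unfolding smooth_rep_def by blast
  moreover have "t \<in> W" using W0 assms(2) by (auto simp: W_def smooth_rep_def)
  ultimately show thesis by (rule that)
qed

text \<open>The part of \<open>J\<^sub>(\<^sub>r\<^sub>)\<close> over the overlap of two charts, in the coordinates of the first.\<close>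

definition JJ :: "nat \<Rightarrow> 'm chart \<Rightarrow> 'm chart \<Rightarrow> pt set" where
  "JJ r c c' = {jet M r c (t, s) | t s. (t, s) \<in> germs M r \<and> s t \<in> fst c \<inter> fst c'}"

lemma JJ_I: "(t, s) \<in> germs M r \<Longrightarrow> s t \<in> fst c \<inter> fst c' \<Longrightarrow> jet M r c (t, s) \<in> JJ r c c'"
  unfolding JJ_def by blast

lemma JJ_E:
  assumes "z \<in> JJ r c c'"
  obtains t s where "(t, s) \<in> germs M r" "s t \<in> fst c \<inter> fst c'" "z = jet M r c (t, s)"
  using assms unfolding JJ_def by blast

lemma J_eq_JJ: "J M r c = JJ r c c"
  by (simp add: J_def JJ_def)

lemma JJ_subset_J: "JJ r c c' \<subseteq> J M r c"
  by (auto simp: J_def JJ_def)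

text \<open>Padded with zeros so that it is a point of \<open>Euclidean_space n\<close>, namely the
  chart image of the value of the section (\<open>base_jet\<close>).\<close>

definition base :: "pt \<Rightarrow> nat \<Rightarrow> real" where
  "base z = (\<lambda>a. if a < n then z (X a {#}) else 0)"

lemma jet_T [simp]: "jet M r c (t, s) (T i) = t i"
  by (simp add: jet_def)

lemma jet_X: "a < n \<Longrightarrow> \<sigma> \<in> mindices r \<Longrightarrow>
    jet M r c (t, s) (X a \<sigma>) = foldr pd (sorted_list_of_multiset \<sigma>) (\<lambda>u. snd c (s u) a) t"
  by (simp add: jet_def)

lemma jet_0: "\<not> (a < n \<and> \<sigma> \<in> mindices r) \<Longrightarrow> jet M r c (t, s) (X a \<sigma>) = 0"
  by (auto simp: jet_def)

lemma base_jet: "c \<in> atlas M \<Longrightarrow> s t \<in> fst c \<Longrightarrow> base (jet M r c (t, s)) = snd c (s t)"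
  unfolding base_def by (rule ext) (auto simp: jet_X chart_zero)

lemma JJ_zero: "z \<in> JJ r c c' \<Longrightarrow> y \<notin> jcoords n r \<Longrightarrow> z y = 0"
  by (cases y) (auto simp: JJ_def germs_def topspace_Euclidean_space jet_0)

lemma base_JJ: "c \<in> atlas M \<Longrightarrow> z \<in> JJ r c c' \<Longrightarrow> base z \<in> snd c ` (fst c \<inter> fst c')"
  by (auto simp: JJ_def base_jet)

text \<open>The coordinate x^a_\<sigma> is an iterated derivative in sorted order, and
  differentiating once more puts the new index in front. Symmetry of second derivatives carries it
  to its sorted place.\<close>

lemma holonomic_jet:
  assumes "c \<in> atlas M" "smooth_rep r c W s" "s ` W \<subseteq> fst c'"
  shows "holonomic n r (JJ r c c') W (\<lambda>u. jet M r c (u, s))"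
proof -
  have W: "openin (Euclidean_space r) W" and f: "\<And>a. a < n \<Longrightarrow> smooth_on {..<r} W (\<lambda>u. snd c (s u) a)"
    and sW: "s ` W \<subseteq> fst c"
    using assms(2) by (auto simp: smooth_rep_def)
  have coW: "coord_open {..<r} W" by (rule coord_open_Euclidean[OF W])
  have jW: "jet M r c (u, s) \<in> JJ r c c'" if "u \<in> W" for u
  proof -
    have "s u \<in> fst c \<inter> fst c'" using that assms(3) sW by auto
    with smooth_rep_germs[OF assms(1,2) that] show ?thesis unfolding JJ_def by blast
  qed
  have smX: "smooth_on {..<r} W (\<lambda>u. jet M r c (u, s) (X a \<sigma>))" for a \<sigma>
  proof (cases "a < n \<and> \<sigma> \<in> mindices r")
    case True
    then have "smooth_on {..<r} W (foldr pd (sorted_list_of_multiset \<sigma>) (\<lambda>u. snd c (s u) a))"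
      by (intro smooth_on_pds f) (auto dest: set_sorted_mindices)
    then show ?thesis using True by (simp add: jet_X)
  qed (simp add: jet_0 smooth_on_const)
  have sm: "smooth_on {..<r} W (\<lambda>u. jet M r c (u, s) y)" for y
    by (cases y) (simp_all add: smooth_on_coord smX)
  have pdX: "pd i (\<lambda>u. jet M r c (u, s) (X a \<sigma>)) u = jet M r c (u, s) (X a (add_mset i \<sigma>))"
    if "u \<in> W" "i < r" "a < n" "\<sigma> \<in> mindices r" for u i a \<sigma>
  proof -
    have "foldr pd (insort i (sorted_list_of_multiset \<sigma>)) (\<lambda>u. snd c (s u) a) u =
        pd i (foldr pd (sorted_list_of_multiset \<sigma>) (\<lambda>u. snd c (s u) a)) u"
    proof (rule foldr_insort[where P = "smooth_on {..<r} W" and I = "{..<r}" and S = W])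
      show "pd i (pd j f) z = pd j (pd i f) z"
        if "smooth_on {..<r} W f" "i \<in> {..<r}" "j \<in> {..<r}" "z \<in> W" for f i j z
        by (rule pd_commute[OF coW that])
      show "pd i f z = pd i g z" if "\<And>z. z \<in> W \<Longrightarrow> f z = g z" "i \<in> {..<r}" "z \<in> W" for f g i z
        by (rule pd_cong[OF coW that(3,2,1)])
    qed (use that f set_sorted_mindices in \<open>auto intro: smooth_on_pd\<close>)
    then show ?thesis using that by (simp add: jet_X)
  qed
  have "continuous_on W (\<lambda>u. jet M r c (u, s))"
    by (rule continuous_on_coordinatewise_then_product) (rule smooth_on_continuous[OF sm])
  then show ?thesis
    unfolding holonomic_def using coW jW sm pdX by (auto simp: pd_coord)
qed

text \<open>Translating the argument of a section moves the base point and keeps all derivatives.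
  This serves to change a coordinate t^i of a jet and to carry jets to the origin.\<close>

lemma jet_translate:
  "jet M r c (t, \<lambda>u. s (\<lambda>k. u k + h k)) = (\<lambda>y. case y of T i \<Rightarrow> t i | X a \<sigma> \<Rightarrow> jet M r c (\<lambda>k. t k + h k, s) (X a \<sigma>))"
proof
  fix y
  show "jet M r c (t, \<lambda>u. s (\<lambda>k. u k + h k)) y =
      (case y of T i \<Rightarrow> t i | X a \<sigma> \<Rightarrow> jet M r c (\<lambda>k. t k + h k, s) (X a \<sigma>))"
  proof (cases y)
    case (X a \<sigma>)
    then show ?thesis
      using pds_translate[of "sorted_list_of_multiset \<sigma>" "\<lambda>u. snd c (s u) a" h t]
      by (simp add: jet_def)
  qed simp
qed

lemma germs_translate:
  assumes "(\<lambda>k. t k + h k, s) \<in> germs M r" "\<And>k. k \<ge> r \<Longrightarrow> h k = 0"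
  shows "(t, \<lambda>u. s (\<lambda>k. u k + h k)) \<in> germs M r"
proof -
  let ?\<tau> = "\<lambda>u k. u k + h k"
  obtain c W where c: "c \<in> atlas M" and W: "smooth_rep r c W s" "?\<tau> t \<in> W"
    using assms(1) unfolding germs_def smooth_near_iff by blast
  have W': "openin (Euclidean_space r) W" using W(1) by (simp add: smooth_rep_def)
  let ?E = "topspace (Euclidean_space r)"
  have cont: "continuous_on A ?\<tau>" for A
    by (intro continuous_on_coordinatewise_then_product continuous_on_add continuous_on_const
        continuous_on_subset[OF continuous_on_product_coordinates subset_UNIV])
  have E: "openin (Euclidean_space r) {u \<in> ?E. ?\<tau> u \<in> W}"
    by (rule openin_Euclidean_preimage[OF openin_topspace cont _ W'])
       (use assms(2) in \<open>auto simp: topspace_Euclidean_space\<close>)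
  have "smooth_rep r c {u \<in> ?E. ?\<tau> u \<in> W} (\<lambda>u. s (?\<tau> u))"
    unfolding smooth_rep_def
  proof (intro conjI allI impI E)
    fix a assume a: "a < n"
    show "smooth_on {..<r} {u \<in> ?E. ?\<tau> u \<in> W} (\<lambda>u. snd c (s (?\<tau> u)) a)"
    proof (rule smooth_on_comp[where K = "{..<r}" and F = "{..<r}" and S = W and \<gamma> = ?\<tau>
          and f = "\<lambda>u. snd c (s u) a"])
      show "smooth_on {..<r} {u \<in> ?E. ?\<tau> u \<in> W} (\<lambda>u. u j + h j)" for j
        by (intro smooth_on_add coord_open_Euclidean[OF E] smooth_on_coord smooth_on_const)
    qed (use W(1) a cont coord_open_Euclidean[OF E] coord_open_Euclidean[OF W'] depends_on_Euclidean[OF W']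
          in \<open>auto simp: smooth_rep_def\<close>)
  qed (use W(1) in \<open>auto simp: smooth_rep_def\<close>)
  moreover have "t \<in> {u \<in> ?E. ?\<tau> u \<in> W}"
  proof -
    have "t i = 0" if "i \<ge> r" for i
      using openin_Euclidean_zero[OF W' W(2) that] assms(2)[OF that] by simp
    then show ?thesis using W(2) by (auto simp: topspace_Euclidean_space)
  qed
  ultimately show ?thesis using smooth_rep_germs[OF c] by blast
qed

text \<open>A coordinate \<open>x\<^sup>a\<^sub>\<sigma>\<close> of a jet is changed by adding a multiple of a monomial to the section. Borel's
  lemma is not needed because only finitely many coordinates change at a time.\<close>

lemma JJ_upd:
  assumes c: "c \<in> atlas M" "c' \<in> atlas M" and z: "z \<in> JJ r c c'" and y: "y \<in> jcoords n r"
    and b: "base (z(y := v)) \<in> snd c ` (fst c \<inter> fst c')"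
  shows "z(y := v) \<in> JJ r c c'"
proof -
  obtain t s where g: "(t, s) \<in> germs M r" "s t \<in> fst c \<inter> fst c'" and zj: "z = jet M r c (t, s)"
    by (rule JJ_E[OF z])
  show ?thesis
  proof (cases y)
    case (T i)
    then have i: "i < r" using y by simp
    \<comment> \<open>At \<open>?t\<close> the translated section has the values and derivatives
      that \<open>s\<close> has at \<open>t\<close>, so only the coordinate t^i changes.\<close>
    define h where "h = (\<lambda>k. if k = i then t i - v else 0)"
    let ?t = "t(i := v)"
    have th: "(\<lambda>k. ?t k + h k) = t" by (auto simp: h_def)
    have "(?t, \<lambda>u. s (\<lambda>k. u k + h k)) \<in> germs M r"
      by (rule germs_translate) (use g i th in \<open>auto simp: h_def\<close>)
    moreover have "jet M r c (?t, \<lambda>u. s (\<lambda>k. u k + h k)) = z(y := v)"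
      unfolding jet_translate th zj T by (auto simp: fun_eq_iff split: coord.split)
    moreover have "s (\<lambda>k. ?t k + h k) \<in> fst c \<inter> fst c'" using th g(2) by simp
    ultimately show ?thesis using JJ_I[of "t(i := v)" "\<lambda>u. s (\<lambda>k. u k + h k)" r c c'] by simp
  next
    case (X a \<sigma>)
    then have a: "a < n" and \<sigma>: "\<sigma> \<in> mindices r" using y by auto
    obtain W where W: "smooth_rep r c W s" "t \<in> W" by (rule germs_smooth_rep[OF g(1) IntD1[OF g(2)] c(1)])
    have W': "openin (Euclidean_space r) W" using W(1) by (simp add: smooth_rep_def)
    define e where "e = v - z y"
    \<comment> \<open>Chart representative of the new section: \<open>e\<close> is the required
      change of the coordinate, and the monomial affects no other coordinate of the jet at
      \<open>t\<close>.\<close>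
    define \<psi> where "\<psi> u = (\<lambda>b. snd c (s u) b + (if b = a then e * monomial r t \<sigma> u else 0))" for u
    let ?V = "snd c ` (fst c \<inter> fst c')"
    define W1 where "W1 = {u \<in> W. \<psi> u \<in> ?V}"
    have contc: "continuous_on W (\<lambda>u. snd c (s u))" by (rule smooth_rep_continuous[OF c(1) W(1)])
    have cont: "continuous_on W \<psi>"
    proof (rule continuous_on_coordinatewise_then_product)
      fix b
      have "continuous_on W (\<lambda>u. snd c (s u) b)"
        by (rule continuous_on_product_then_coordinatewise[OF contc])
      then show "continuous_on W (\<lambda>u. \<psi> u b)"
        unfolding \<psi>_def using smooth_on_continuous[OF smooth_on_monomial[where r = r and W = W and t = t and \<sigma> = \<sigma>]]
        by (cases "b = a") (auto intro!: continuous_intros)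
    qed
    have W1: "openin (Euclidean_space r) W1"
      unfolding W1_def
      by (rule openin_Euclidean_preimage[OF W' cont _ overlap_open[OF c]])
         (use a W(1) chart_zero[OF c(1)] in \<open>auto simp: \<psi>_def smooth_rep_def\<close>)
    have coW1: "coord_open {..<r} W1" by (rule coord_open_Euclidean[OF W1])
    have mono0: "monomial r t \<sigma> t = (if \<sigma> = {#} then 1 else 0)" by (rule monomial_at[OF \<sigma>])
    \<comment> \<open>The base point moves only if \<open>\<sigma>\<close> is empty. In either case
      hypothesis \<open>b\<close> keeps it in the overlap, so \<open>t\<close> survives the
      shrinking to \<open>W1\<close>.\<close>
    have "\<psi> t = base (z(y := v))"
    proof
      fix b
      show "\<psi> t b = base (z(y := v)) b"
        using chart_zero[OF c(1), of "s t" b] g(2) a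
        by (cases "b = a"; cases "\<sigma> = {#}"; cases "b < n") (simp_all add: \<psi>_def base_def X zj e_def jet_X mono0 monomial_at)
    qed
    then have t1: "t \<in> W1" using b W(2) by (simp add: W1_def)
    define s' where "s' u = inv_into (fst c) (snd c) (\<psi> u)" for u
    have s': "s' u \<in> fst c \<inter> fst c'" "snd c (s' u) = \<psi> u" if "u \<in> W1" for u
    proof -
      have "\<psi> u \<in> ?V" using that by (simp add: W1_def)
      then obtain p where p: "\<psi> u = snd c p" "p \<in> fst c \<inter> fst c'" by (rule imageE)
      then have "s' u = p" by (simp add: s'_def inv_into_f_f[OF chart_inj[OF c(1)]])
      then show "s' u \<in> fst c \<inter> fst c'" "snd c (s' u) = \<psi> u" using p by auto
    qed
    have sm: "smooth_on {..<r} W1 (\<lambda>u. snd c (s u) b)" if "b < n" for b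
      by (rule smooth_on_subset[OF smooth_repD(3)[OF W(1) that]]) (auto simp: W1_def)
    have sm\<psi>: "smooth_on {..<r} W1 (\<lambda>u. \<psi> u b)" if "b < n" for b
      unfolding \<psi>_def using sm[OF that]
      by (cases "b = a") (auto intro!: smooth_on_add smooth_on_cmult coW1 smooth_on_monomial)
    have rep: "smooth_rep r c W1 s'"
      unfolding smooth_rep_def
    proof (intro conjI allI impI W1)
      show "s' ` W1 \<subseteq> fst c" using s'(1) by blast
      show "smooth_on {..<r} W1 (\<lambda>u. snd c (s' u) b)" if "b < n" for b
        by (rule smooth_on_cong[OF coW1 _ sm\<psi>[OF that]]) (simp add: s'(2))
    qed
    have jet: "jet M r c (t, s') = z(y := v)"
    proof
      fix x
      show "jet M r c (t, s') x = (z(y := v)) x"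
      proof (cases x)
        case T': (T i)
        then show ?thesis by (simp add: X zj)
      next
        case X': (X b \<tau>)
        show ?thesis
        proof (cases "b < n \<and> \<tau> \<in> mindices r")
          case True
          then have b: "b < n" and \<tau>: "\<tau> \<in> mindices r" by auto
          let ?l = "sorted_list_of_multiset \<tau>"
          have "jet M r c (t, s') x = foldr pd ?l (\<lambda>u. snd c (s' u) b) t"
            unfolding X' by (rule jet_X[OF b \<tau>])
          also have "\<dots> = foldr pd ?l (\<lambda>u. snd c (s u) b + (if b = a then e else 0) * monomial r t \<sigma> u) t"
            by (rule pds_cong[OF coW1 set_sorted_mindices[OF \<tau>] t1]) (simp add: s'(2), simp add: \<psi>_def)
          also have "\<dots> = z x + (if b = a then e else 0) * (if \<sigma> = \<tau> then 1 else 0)"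
            using pds_add_cmult[OF coW1 sm[OF b] smooth_on_monomial set_sorted_mindices[OF \<tau>] t1]
            by (simp add: pds_monomial_at[OF \<sigma> \<tau>] zj X' jet_X[OF b \<tau>])
          finally show ?thesis by (auto simp: X X' e_def)
        next
          case False
          then show ?thesis using a \<sigma> by (auto simp: X X' zj jet_0)
        qed
      qed
    qed
    show ?thesis
      unfolding jet[symmetric] by (rule JJ_I[OF smooth_rep_germs[OF c(1) rep t1] s'(1)[OF t1]])
  qed
qed

text \<open>The coordinates in \<open>F\<close> are changed one at a time by \<open>JJ_upd\<close>.
  Only the base point restricts these changes, so one \<open>e\<close>, taken from the openness of
  the overlap in \<real>^n, serves every finite \<open>F\<close>.\<close>

lemma coord_open_JJ:
  assumes c: "c \<in> atlas M" "c' \<in> atlas M"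
  shows "coord_open (jcoords n r) (JJ r c c')"
  unfolding coord_open_def
proof (intro ballI allI impI)
  fix z F assume z: "z \<in> JJ r c c'" and F: "finite F" "F \<subseteq> jcoords n r"
  let ?V = "snd c ` (fst c \<inter> fst c')"
  obtain e where e: "e > 0" "\<forall>x. near {..<n} e (base z) x \<longrightarrow> x \<in> ?V"
    by (rule coord_openD[OF coord_open_Euclidean[OF overlap_open[OF c]] base_JJ[OF c(1) z] finite_lessThan subset_refl])
  have bnear: "base z' \<in> ?V" if "near F e z z'" for z' F
  proof -
    have "\<bar>z' y - z y\<bar> < e" for y
      using that e(1) by (cases "y \<in> F") (auto simp: near_def)
    then have "near {..<n} e (base z) (base z')" by (auto simp: near_def base_def)
    then show ?thesis using e(2) by blast
  qed
  have "z' \<in> JJ r c c'" if "near F e z z'" for z'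
    using F that
  proof (induction F arbitrary: z' rule: finite_induct)
    case empty
    then have "z' = z" by (auto simp: near_def)
    then show ?case using z by simp
  next
    case (insert y F)
    \<comment> \<open>With coordinate \<open>y\<close> restored, the induction hypothesis applies to
      \<open>?w\<close>; setting \<open>y\<close> to its new value is then a single update.\<close>
    let ?w = "z'(y := z y)"
    have "near F e z ?w" using insert.prems insert.hyps by (auto simp: near_def)
    then have w: "?w \<in> JJ r c c'" using insert.IH insert.prems(1) by simp
    have "?w(y := z' y) \<in> JJ r c c'"
    proof (rule JJ_upd[OF c w])
      have "?w(y := z' y) = z'" by simp
      then show "base (?w(y := z' y)) \<in> ?V" using bnear[OF insert.prems(2)] by simp
    qed (use insert.prems in simp)
    then show ?case by simp
  qed
  then show "\<exists>e>0. \<forall>z'. near F e z z' \<longrightarrow> z' \<in> JJ r c c'" using e(1) by blast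
qed

lemma jet_domain_JJ:
  assumes c: "c \<in> atlas M" "c' \<in> atlas M"
  shows "jet_domain n r (JJ r c c')"
proof (rule jet_domain.intro)
  show "coord_open (jcoords n r) (JJ r c c')" by (rule coord_open_JJ[OF c])
  show "z y = 0" if "z \<in> JJ r c c'" "y \<notin> jcoords n r" for z y by (rule JJ_zero[OF that])
  show "\<exists>W t j. t \<in> W \<and> j t = z \<and> holonomic n r (JJ r c c') W j" if z: "z \<in> JJ r c c'" for z
  proof -
    obtain t s where g: "(t, s) \<in> germs M r" "s t \<in> fst c \<inter> fst c'" and zj: "z = jet M r c (t, s)"
      by (rule JJ_E[OF z])
    obtain W where W: "smooth_rep r c W s" "t \<in> W" by (rule germs_smooth_rep[OF g(1) IntD1[OF g(2)] c(1)])
    obtain W' where W': "smooth_rep r c' W' s" "t \<in> W'" by (rule germs_smooth_rep[OF g(1) IntD2[OF g(2)] c(2)])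
    have "smooth_rep r c (W \<inter> W') s"
      by (rule smooth_rep_subset[OF W(1) openin_Int[OF smooth_repD(1)[OF W(1)] smooth_repD(1)[OF W'(1)]]]) simp
    moreover have "s ` (W \<inter> W') \<subseteq> fst c'" using smooth_repD(2)[OF W'(1)] by blast
    ultimately have "holonomic n r (JJ r c c') (W \<inter> W') (\<lambda>u. jet M r c (u, s))"
      by (rule holonomic_jet[OF c(1)])
    then show ?thesis
      using W(2) W'(2) zj by (intro exI[of _ "W \<inter> W'"] exI[of _ t] exI[of _ "\<lambda>u. jet M r c (u, s)"]) simp
  qed
qed

lemma jet_domain_J: "c \<in> atlas M \<Longrightarrow> jet_domain n r (J M r c)"
  unfolding J_eq_JJ by (rule jet_domain_JJ)

section \<open>Projections of jets: to jets at the origin and to fewer independent variables\<close>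

definition drop_T :: "pt \<Rightarrow> pt" where
  "drop_T z = (\<lambda>y. case y of T i \<Rightarrow> 0 | X a \<sigma> \<Rightarrow> z (X a \<sigma>))"

lemma drop_T_simps [simp]: "drop_T z (T i) = 0" "drop_T z (X a \<sigma>) = z (X a \<sigma>)"
  by (simp_all add: drop_T_def)

lemma on_J_eq: "on_J L c z = L c (drop_T z)"
  by (simp add: on_J_def drop_T_def)

lemma TJ_subset_J: "TJ M r c \<subseteq> J M r c"
  by (auto simp: TJ_def J_def)

lemma germs_zero:
  assumes "(t, s) \<in> germs M r"
  shows "(\<lambda>_. 0, \<lambda>u. s (\<lambda>k. u k + t k)) \<in> germs M r"
  by (rule germs_translate) (use assms in \<open>auto simp: germs_def topspace_Euclidean_space\<close>)

lemma drop_T_jet: "drop_T (jet M r c (t, s)) = jet M r c (\<lambda>_. 0, \<lambda>u. s (\<lambda>k. u k + t k))"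
  unfolding jet_translate by (auto simp: drop_T_def fun_eq_iff split: coord.split)

lemma drop_T_in_TJ:
  assumes "z \<in> J M r c"
  shows "drop_T z \<in> TJ M r c"
proof -
  obtain t s where z: "(t, s) \<in> germs M r" "s t \<in> fst c" "z = jet M r c (t, s)"
    using assms by (auto simp: J_def)
  then show ?thesis
    unfolding TJ_def z(3) drop_T_jet using germs_zero[OF z(1)] z(2) by auto
qed

lemma TJ_T: "z \<in> TJ M r c \<Longrightarrow> z (T i) = 0"
  by (auto simp: TJ_def)

text \<open>The projected jet is the jet of the section restricted to the slice through
  \<open>t\<close> on which the last variable is constant. The last coordinate of the base point
  itself becomes 0, as required of points of \<open>Euclidean_space r\<close>.\<close>

lemma proj_in_J:
  assumes "z \<in> J M (Suc r) c" "c \<in> atlas M"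
  shows "proj n r z \<in> J M r c"
proof -
  obtain t s where g: "(t, s) \<in> germs M (Suc r)" "s t \<in> fst c" and z: "z = jet M (Suc r) c (t, s)"
    using assms by (auto simp: J_def)
  obtain W where W: "smooth_rep (Suc r) c W s" "t \<in> W" by (rule germs_smooth_rep[OF g assms(2)])
  have W': "openin (Euclidean_space (Suc r)) W" using W(1) by (simp add: smooth_rep_def)
  let ?\<tau> = "\<lambda>u. u(r := t r)"
  let ?E = "topspace (Euclidean_space r)"
  have cont: "continuous_on A ?\<tau>" for A
  proof (rule continuous_on_coordinatewise_then_product)
    fix i show "continuous_on A (\<lambda>u. (u(r := t r)) i)"
      by (cases "i = r") (auto intro: continuous_on_subset[OF continuous_on_product_coordinates subset_UNIV])
  qed
  have E: "openin (Euclidean_space r) {u \<in> ?E. ?\<tau> u \<in> W}"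
    by (rule openin_Euclidean_preimage[OF openin_topspace cont _ W'])
       (auto simp: topspace_Euclidean_space)
  have tt: "?\<tau> (t(r := 0)) = t" by auto
  have rep: "smooth_rep r c {u \<in> ?E. ?\<tau> u \<in> W} (\<lambda>u. s (?\<tau> u))"
    unfolding smooth_rep_def
  proof (intro conjI allI impI E)
    fix a assume a: "a < n"
    show "smooth_on {..<r} {u \<in> ?E. ?\<tau> u \<in> W} (\<lambda>u. snd c (s (?\<tau> u)) a)"
    proof (rule smooth_on_comp[where K = "{..<Suc r}" and F = "{..<Suc r}" and S = W and \<gamma> = ?\<tau>
          and f = "\<lambda>u. snd c (s u) a"])
      show "smooth_on {..<r} {u \<in> ?E. ?\<tau> u \<in> W} (\<lambda>u. (u(r := t r)) j)" for j
        by (cases "j = r") (auto intro: smooth_on_coord smooth_on_const)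
    qed (use W(1) a cont coord_open_Euclidean[OF E] coord_open_Euclidean[OF W'] depends_on_Euclidean[OF W']
          in \<open>auto simp: smooth_rep_def\<close>)
  qed (use W(1) in \<open>auto simp: smooth_rep_def\<close>)
  have t': "t(r := 0) \<in> {u \<in> ?E. ?\<tau> u \<in> W}"
    using W(2) openin_Euclidean_zero[OF W' W(2)] tt
    by (auto simp: topspace_Euclidean_space Suc_le_eq)
  have mi: "\<sigma> \<in> mindices (Suc r)" if "\<sigma> \<in> mindices r" for \<sigma>
    using that by (auto simp: mindices_def)
  have eq: "proj n r z = jet M r c (t(r := 0), \<lambda>u. s (?\<tau> u))"
  proof
    fix y
    show "proj n r z y = jet M r c (t(r := 0), \<lambda>u. s (?\<tau> u)) y"
    proof (cases y)
      case (T i)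
      then show ?thesis using openin_Euclidean_zero[OF W' W(2), of i] by (auto simp: proj_def z)
    next
      case (X a \<sigma>)
      show ?thesis
      proof (cases "a < n \<and> \<sigma> \<in> mindices r")
        case True
        have "r \<notin> set (sorted_list_of_multiset \<sigma>)" using True by (auto simp: mindices_def)
        from pds_restrict[OF this, of "\<lambda>u. snd c (s u) a" "t r" "t(r := 0)"]
        show ?thesis using True mi by (simp add: X proj_def z jet_X)
      qed (auto simp: X proj_def jet_0)
    qed
  qed
  show ?thesis
    unfolding eq J_eq_JJ
    by (rule JJ_I[OF smooth_rep_germs[OF assms(2) rep t']]) (use g(2) in simp)
qed

subsection \<open>Change of charts\<close>

definition trans_coord :: "'m chart \<Rightarrow> 'm chart \<Rightarrow> nat \<Rightarrow> pt \<Rightarrow> real" where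
  "trans_coord c c' b z = snd c' (inv_into (fst c) (snd c) (base z)) b"

lemma reg_trans_coord:
  assumes c: "c \<in> atlas M" "c' \<in> atlas M" and b: "b < n"
  shows "jet_domain.reg n r (JJ r c c') 0 (trans_coord c c' b)"
proof -
  interpret jet_domain n r "JJ r c c'" by (rule jet_domain_JJ[OF c])
  let ?V = "snd c ` (fst c \<inter> fst c')"
  have sm: "smooth_on (jcoords n r) (JJ r c c') (\<lambda>z. base z a)" for a
    unfolding base_def by (cases "a < n") (auto intro: smooth_on_coord smooth_on_const)
  have "smooth_on (jcoords n r) (JJ r c c') (\<lambda>z. (\<lambda>x. snd c' (inv_into (fst c) (snd c) x) b) (base z))"
  proof (rule smooth_on_comp[where K = "{..<n}" and F = "{..<n}" and S = ?V and \<gamma> = base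
        and f = "\<lambda>x. snd c' (inv_into (fst c) (snd c) x) b"])
    show "coord_open {..<n} ?V" by (rule coord_open_Euclidean[OF overlap_open[OF c]])
    show "depends_on {..<n} ?V (\<lambda>x. snd c' (inv_into (fst c) (snd c) x) b)"
      by (rule depends_on_Euclidean[OF overlap_open[OF c]])
    show "smooth_on {..<n} ?V (\<lambda>x. snd c' (inv_into (fst c) (snd c) x) b)"
      by (rule transition_smooth[OF c b])
    show "continuous_on (JJ r c c') base"
      by (rule continuous_on_coordinatewise_then_product) (rule smooth_on_continuous[OF sm])
  qed (use sm coord_open base_JJ[OF c(1)] in auto)
  moreover have "depends_on {y. corder y \<le> 0} (JJ r c c') (trans_coord c c' b)"
  proof (rule depends_onI)
    fix z z' :: pt assume "\<forall>y\<in>{y. corder y \<le> 0}. z y = z' y"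
    then have "base z = base z'" by (auto simp: base_def fun_eq_iff)
    then show "trans_coord c c' b z = trans_coord c c' b z'" by (simp add: trans_coord_def)
  qed
  ultimately show ?thesis by (simp add: reg_def order_le_iff trans_coord_def[abs_def])
qed

text \<open>The prolongation formula x'^b_\<tau> = D_\<tau> x'^b: along the jet of a section,
  partial derivatives of x'^b are total derivatives by \<open>Dtot_holonomic\<close>. It expresses
  the new jet coordinates by the old ones with order at most the length of \<tau>.\<close>

lemma jet_change_chart:
  assumes c: "c \<in> atlas M" "c' \<in> atlas M" and g: "(t, s) \<in> germs M r" "s t \<in> fst c \<inter> fst c'"
    and b: "b < n" "\<tau> \<in> mindices r"
  shows "jet M r c' (t, s) (X b \<tau>) = Dtots n r \<tau> (trans_coord c c' b) (jet M r c (t, s))"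
proof -
  interpret jet_domain n r "JJ r c c'" by (rule jet_domain_JJ[OF c])
  obtain W1 where W1: "smooth_rep r c W1 s" "t \<in> W1" by (rule germs_smooth_rep[OF g(1) IntD1[OF g(2)] c(1)])
  obtain W2 where W2: "smooth_rep r c' W2 s" "t \<in> W2" by (rule germs_smooth_rep[OF g(1) IntD2[OF g(2)] c(2)])
  define W where "W = W1 \<inter> W2"
  have W: "openin (Euclidean_space r) W" using W1(1) W2(1) by (auto simp: smooth_rep_def W_def)
  have coW: "coord_open {..<r} W" by (rule coord_open_Euclidean[OF W])
  have rep: "smooth_rep r c W s" using smooth_rep_subset[OF W1(1) W] by (auto simp: W_def)
  have sub: "s ` W \<subseteq> fst c" "s ` W \<subseteq> fst c'" using W1(1) W2(1) by (auto simp: smooth_rep_def W_def)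
  have hol: "holonomic n r (JJ r c c') W (\<lambda>u. jet M r c (u, s))"
    by (rule holonomic_jet[OF c(1) rep sub(2)])
  have t: "t \<in> W" using W1 W2 by (simp add: W_def)
  have "\<exists>k. reg k (foldr (Dtot n r) xs (trans_coord c c' b))" if "set xs \<subseteq> {..<r}" for xs
    using that
  proof (induction xs)
    case Nil
    then show ?case using reg_trans_coord[OF c b(1)] by auto
  next
    case (Cons x xs)
    then show ?case using reg_Dtot by auto
  qed
  then have "foldr pd xs (\<lambda>u. snd c' (s u) b) u = foldr (Dtot n r) xs (trans_coord c c' b) (jet M r c (u, s))"
    if "set xs \<subseteq> {..<r}" "u \<in> W" for xs u
    using that
  proof (induction xs arbitrary: u)
    case Nil
    then have "s u \<in> fst c" using sub by auto
    then show ?case by (simp add: trans_coord_def base_jet[OF c(1)] inv_into_f_f[OF chart_inj[OF c(1)]])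
  next
    case (Cons x xs)
    obtain k where k: "reg k (foldr (Dtot n r) xs (trans_coord c c' b))" using Cons.prems by auto
    have "pd x (foldr pd xs (\<lambda>u. snd c' (s u) b)) u =
        pd x (\<lambda>u. foldr (Dtot n r) xs (trans_coord c c' b) (jet M r c (u, s))) u"
      by (rule pd_cong[OF coW]) (use Cons in auto)
    also have "\<dots> = Dtot n r x (foldr (Dtot n r) xs (trans_coord c c' b)) (jet M r c (u, s))"
      by (rule Dtot_holonomic[OF k _ hol]) (use Cons.prems in auto)
    finally show ?case by simp
  qed
  from this[OF set_sorted_mindices[OF b(2)] t] show ?thesis
    using b by (simp add: jet_X Dtots_def)
qed

text \<open>Different germs may have the same jet. By the prolongation formula the jet in one chart
  fixes the jet in the other, which gives the uniqueness demanded by \<open>THE\<close> in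
  \<open>transition\<close>.\<close>

lemma jet_determines:
  assumes c: "c \<in> atlas M" "c' \<in> atlas M" and g: "(t, s) \<in> germs M r" "s t \<in> fst c \<inter> fst c'"
    and g': "(t', s') \<in> germs M r" "s' t' \<in> fst c \<inter> fst c'"
    and eq: "jet M r c (t, s) = jet M r c (t', s')"
  shows "jet M r c' (t, s) = jet M r c' (t', s')"
proof
  fix y
  show "jet M r c' (t, s) y = jet M r c' (t', s') y"
  proof (cases y)
    case (T i)
    then show ?thesis using fun_cong[OF eq, of "T i"] by simp
  next
    case (X b \<tau>)
    then show ?thesis
      using jet_change_chart[OF c g, of b \<tau>] jet_change_chart[OF c g', of b \<tau>] eq
      by (cases "b < n \<and> \<tau> \<in> mindices r") (auto simp: jet_0)
  qed
qed

lemma transition_jet: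
  assumes c: "c \<in> atlas M" "c' \<in> atlas M" and g: "(t, s) \<in> germs M r" "s t \<in> fst c \<inter> fst c'"
  shows "transition M r c c' (jet M r c (t, s)) = jet M r c' (t, s)"
  unfolding transition_def
proof (rule the_equality)
  fix z' assume "\<exists>t' s'. (t', s') \<in> germs M r \<and> s' t' \<in> fst c \<inter> fst c' \<and>
     jet M r c (t, s) = jet M r c (t', s') \<and> z' = jet M r c' (t', s')"
  then show "z' = jet M r c' (t, s)" using jet_determines[OF c g] by metis
qed (use g in blast)

lemma transition_in:
  assumes c: "c \<in> atlas M" "c' \<in> atlas M" and "z \<in> JJ r c c'"
  shows "transition M r c c' z \<in> JJ r c' c"
  using assms transition_jet[OF c] by (fastforce simp: JJ_def)

lemma transition_T:
  assumes c: "c \<in> atlas M" "c' \<in> atlas M" and "z \<in> JJ r c c'"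
  shows "transition M r c c' z (T i) = z (T i)"
  using assms transition_jet[OF c] by (fastforce simp: JJ_def)

lemma transition_X:
  assumes c: "c \<in> atlas M" "c' \<in> atlas M" and "z \<in> JJ r c c'" and b: "b < n" "\<tau> \<in> mindices r"
  shows "transition M r c c' z (X b \<tau>) = Dtots n r \<tau> (trans_coord c c' b) z"
  using assms transition_jet[OF c] jet_change_chart[OF c _ _ b] by (fastforce simp: JJ_def)

lemma reg_transition_X:
  assumes c: "c \<in> atlas M" "c' \<in> atlas M" and b: "b < n" "\<tau> \<in> mindices r"
  shows "jet_domain.reg n r (JJ r c c') (size \<tau>) (\<lambda>z. transition M r c c' z (X b \<tau>))"
proof -
  interpret jet_domain n r "JJ r c c'" by (rule jet_domain_JJ[OF c])
  show ?thesis
    by (rule reg_cong[OF _ reg_Dtots[OF reg_trans_coord[OF c b(1)] b(2), simplified]])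
       (simp add: transition_X[OF c _ b])
qed

end

section \<open>Differential forms on the jet space\<close>

lemma length_filter_mset: "length (filter P xs) = size (filter_mset P (mset xs))"
  by (metis mset_filter size_mset)

lemma sum'_cmult:
  assumes "F \<subseteq> A" "finite F" "\<And>x. x \<in> A \<Longrightarrow> x \<notin> F \<Longrightarrow> f x = (0::real)"
  shows "sum' (\<lambda>x. c * f x) A = c * sum' f A"
  using sum'_eq_sum[OF assms(1,2), of f] sum'_eq_sum[OF assms(1,2), of "\<lambda>x. c * f x"] assms(3)
  by (simp add: sum_distrib_left)

lemma sum'_uminus: "sum' (\<lambda>x. - f x) A = - sum' f (A :: 'x set)" for f :: "'x \<Rightarrow> real"
  unfolding sum.G_def by (simp add: sum_negf)

lemma sum'_reindex:
  assumes "inj_on h A"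
  shows "sum' f (h ` A) = sum' (f \<circ> h) A"
proof -
  have eq: "{x \<in> h ` A. f x \<noteq> 0} = h ` {p \<in> A. (f \<circ> h) p \<noteq> 0}" by auto
  have inj: "inj_on h {p \<in> A. (f \<circ> h) p \<noteq> 0}" by (rule inj_on_subset[OF assms]) blast
  show ?thesis
    unfolding sum.G_def eq finite_image_iff[OF inj] sum.reindex[OF inj] ..
qed

lemma sum'_nonzero: "sum' f A \<noteq> 0 \<Longrightarrow> \<exists>x\<in>A. f x \<noteq> 0"
  using sum'_0[of A f] by blast

definition gens_le :: "nat \<Rightarrow> nat \<Rightarrow> nat \<Rightarrow> gen set" where
  "gens_le n r k = Dt ` {..<r} \<union> (\<lambda>(a, \<sigma>). Gam a \<sigma>) ` ({..<n} \<times> mindices_le r k)"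

lemma finite_gens_le: "finite (gens_le n r k)"
  by (simp add: gens_le_def finite_mindices_le)

lemma gens_le_subset: "gens_le n r k \<subseteq> gens n r"
  by (auto simp: gens_le_def gens_def mindices_le_def)

lemma gens_not_le: "g \<in> gens n r \<Longrightarrow> g \<notin> gens_le n r k \<Longrightarrow> \<exists>a \<sigma>. g = Gam a \<sigma> \<and> size \<sigma> > k"
  by (auto simp: gens_le_def gens_def mindices_le_def)

lemma wedge_one_vertical:
  assumes "\<And>g. g \<in> set xs \<union> set ys \<Longrightarrow> is_Dt g"
  shows "wedge (Gam b \<tau>) \<Omega> (xs @ Gam a \<sigma> # ys) z =
    (if (b, \<tau>) = (a, \<sigma>) then (-1) ^ length xs * \<Omega> (xs @ ys) z else 0)"
  using assms
proof (induction xs arbitrary: \<Omega>)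
  case Nil
  have "wedge (Gam b \<tau>) (\<lambda>hs. \<Omega> (Gam a \<sigma> # hs)) ys z = 0"
  proof (rule wedge_zero_if)
    fix hs assume "mset ys = add_mset (Gam b \<tau>) (mset hs)"
    then have "Gam b \<tau> \<in> set ys" by (metis set_mset_mset union_single_eq_member)
    then show "\<Omega> (Gam a \<sigma> # hs) z = 0" using Nil by fastforce
  qed
  then show ?case by (auto simp: wedge_Cons)
next
  case (Cons x xs)
  have "x \<noteq> Gam b \<tau>" using Cons.prems[of x] by auto
  moreover have "wedge (Gam b \<tau>) (\<lambda>hs. \<Omega> (x # hs)) (xs @ Gam a \<sigma> # ys) z =
      (if (b, \<tau>) = (a, \<sigma>) then (-1) ^ length xs * \<Omega> (x # xs @ ys) z else 0)"
    by (rule Cons.IH) (use Cons.prems in auto)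
  ultimately show ?case by (simp add: wedge_Cons)
qed

context jet_domain
begin

lemma lvert_one_vertical:
  assumes "\<And>g. g \<in> set xs \<union> set ys \<Longrightarrow> is_Dt g" and a: "a < n" "\<sigma> \<in> mindices r"
  shows "lvert n r \<omega> (xs @ Gam a \<sigma> # ys) z = (-1) ^ length xs * pd (X a \<sigma>) (\<omega> (xs @ ys)) z"
proof -
  have "lvert n r \<omega> (xs @ Gam a \<sigma> # ys) z =
      sum' (\<lambda>(b, \<tau>). if (b, \<tau>) = (a, \<sigma>) then (-1) ^ length xs * pd (X b \<tau>) (\<omega> (xs @ ys)) z else 0)
        ({..<n} \<times> mindices r)"
    unfolding lvert_def
  proof (rule sum.cong'[OF refl])
    fix p :: "nat \<times> nat multiset"
    show "(case p of (b, \<tau>) \<Rightarrow> wedge (Gam b \<tau>) (\<lambda>hs. pd (X b \<tau>) (\<omega> hs)) (xs @ Gam a \<sigma> # ys) z) =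
      (case p of (b, \<tau>) \<Rightarrow> if (b, \<tau>) = (a, \<sigma>) then (-1) ^ length xs * pd (X b \<tau>) (\<omega> (xs @ ys)) z else 0)"
      using wedge_one_vertical[OF assms(1), of xs ys "fst p" "snd p" "\<lambda>hs. pd (X (fst p) (snd p)) (\<omega> hs)" a \<sigma> z]
      by (cases p) simp
  qed
  also have "\<dots> = sum (\<lambda>(b, \<tau>). if (b, \<tau>) = (a, \<sigma>) then (-1) ^ length xs * pd (X b \<tau>) (\<omega> (xs @ ys)) z else 0) {(a, \<sigma>)}"
    by (rule sum'_eq_sum) (use a in \<open>auto split: if_splits\<close>)
  finally show ?thesis by simp
qed

lemma lvert_support:
  assumes "lvert n r \<omega> gs z \<noteq> 0"
  obtains a \<sigma> hs where "a < n" "\<sigma> \<in> mindices r" "mset gs = add_mset (Gam a \<sigma>) (mset hs)"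
    "pd (X a \<sigma>) (\<omega> hs) z \<noteq> 0"
proof -
  obtain p where p: "p \<in> {..<n} \<times> mindices r"
    "(case p of (a, \<sigma>) \<Rightarrow> wedge (Gam a \<sigma>) (\<lambda>hs. pd (X a \<sigma>) (\<omega> hs)) gs z) \<noteq> 0"
    using sum'_nonzero assms unfolding lvert_def by blast
  then have "wedge (Gam (fst p) (snd p)) (\<lambda>hs. pd (X (fst p) (snd p)) (\<omega> hs)) gs z \<noteq> 0"
    by (simp add: split_def)
  then show thesis
    by (rule wedge_support) (rule that[of "fst p" "snd p"], use p(1) in auto)
qed

lemma alternating_lvert:
  assumes "alternating \<omega>" "\<And>hs. reg k (\<omega> hs)" "z \<in> S"
  shows "lvert n r \<omega> (gs @ g # h # hs) z = - lvert n r \<omega> (gs @ h # g # hs) z"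
proof -
  have "wedge (Gam a \<sigma>) (\<lambda>hs. pd (X a \<sigma>) (\<omega> hs)) (gs @ g # h # hs) z =
      - wedge (Gam a \<sigma>) (\<lambda>hs. pd (X a \<sigma>) (\<omega> hs)) (gs @ h # g # hs) z"
    if a: "a < n" "\<sigma> \<in> mindices r" for a \<sigma>
  proof -
    \<comment> \<open>\<open>alternating\<close> speaks about all points, while the sign rule for
      the derivatives is known on \<open>S\<close> only; the cut-off reconciles the two.\<close>
    let ?P = "\<lambda>hs z. if z \<in> S then pd (X a \<sigma>) (\<omega> hs) z else 0"
    have "alternating ?P"
      unfolding alternating_def
    proof (intro allI)
      fix gs g h hs z
      have "pd (X a \<sigma>) (\<omega> (gs @ g # h # hs)) z = - pd (X a \<sigma>) (\<omega> (gs @ h # g # hs)) z" if z: "z \<in> S"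
      proof -
        have "\<omega> (gs @ g # h # hs) = (\<lambda>z. (-1) * \<omega> (gs @ h # g # hs) z)"
          using alternatingD[OF assms(1), of gs g h hs] by (intro ext) (simp only: mult_minus1)
        then show ?thesis
          using pd_cmult[OF reg_Ck[OF assms(2)[of "gs @ h # g # hs"]], of "X a \<sigma>" z "-1"] a z by simp
      qed
      then show "?P (gs @ g # h # hs) z = - ?P (gs @ h # g # hs) z" by simp
    qed
    from alternatingD[OF alternating_wedge[OF this]]
    have "wedge (Gam a \<sigma>) ?P (gs @ g # h # hs) z = - wedge (Gam a \<sigma>) ?P (gs @ h # g # hs) z" .
    moreover have "wedge (Gam a \<sigma>) ?P ys z = wedge (Gam a \<sigma>) (\<lambda>hs. pd (X a \<sigma>) (\<omega> hs)) ys z" for ys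
      by (rule wedge_cong) (simp add: assms(3))
    ultimately show ?thesis by simp
  qed
  then have "lvert n r \<omega> (gs @ g # h # hs) z =
      sum' (\<lambda>p. - (case p of (a, \<sigma>) \<Rightarrow> wedge (Gam a \<sigma>) (\<lambda>hs. pd (X a \<sigma>) (\<omega> hs)) (gs @ h # g # hs) z)) ({..<n} \<times> mindices r)"
    unfolding lvert_def by (intro sum.cong' refl) (simp add: split_def mem_Times_iff)
  then show ?thesis unfolding sum'_uminus lvert_def .
qed

lemma lvert_add:
  assumes "\<And>hs. reg k (\<omega> hs)" "\<And>hs. reg k (\<omega>' hs)" "z \<in> S"
  shows "lvert n r (\<lambda>hs z. \<omega> hs z + \<omega>' hs z) gs z = lvert n r \<omega> gs z + lvert n r \<omega>' gs z"
proof -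
  have o: "order_le k S (\<omega> hs)" "order_le k S (\<omega>' hs)" "order_le k S (\<lambda>z. \<omega> hs z + \<omega>' hs z)" for hs
    using assms(1,2) reg_add[OF assms(1,2)] unfolding reg_def by auto
  have p: "pd (X (fst p) (snd p)) (\<lambda>z. \<omega> hs z + \<omega>' hs z) z =
      pd (X (fst p) (snd p)) (\<omega> hs) z + pd (X (fst p) (snd p)) (\<omega>' hs) z"
    if "p \<in> {..<n} \<times> mindices_le r k" for p hs
    by (rule pd_add[OF reg_Ck[OF assms(1)] reg_Ck[OF assms(2)] _ assms(3)])
       (use that in \<open>auto simp: mindices_le_def\<close>)
  show ?thesis
    unfolding lvert_eq[of k \<omega>, OF o(1) assms(3) order_refl] lvert_eq[of k \<omega>', OF o(2) assms(3) order_refl]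
      lvert_eq[of k "\<lambda>hs z. \<omega> hs z + \<omega>' hs z", OF o(3) assms(3) order_refl] split_def
      sum.distrib[symmetric] wedge_add[symmetric]
    by (intro sum.cong refl wedge_cong p)
qed

text \<open>The finite range here comes from the argument list instead of an order bound: only a
  generator that occurs in \<open>gs\<close> can be wedged off.\<close>

lemma Dtot_form_eq:
  "Dtot_form n r i \<omega> gs z = Dtot n r i (\<omega> gs) z +
    (\<Sum>p\<in>{p \<in> {..<n} \<times> mindices r. Gam (fst p) (add_mset i (snd p)) \<in> set gs}.
      wedge (Gam (fst p) (add_mset i (snd p))) (gderiv (Gam (fst p) (snd p)) \<omega>) gs z)"
proof -
  let ?F = "{p \<in> {..<n} \<times> mindices r. Gam (fst p) (add_mset i (snd p)) \<in> set gs}"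
  let ?h = "\<lambda>p. Gam (fst p) (add_mset i (snd p))"
  have "inj_on ?h ?F" by (auto simp: inj_on_def)
  moreover have "?h ` ?F \<subseteq> set gs" by auto
  ultimately have F: "finite ?F" by (meson List.finite_set inj_on_finite)
  have z0: "wedge (?h p) (gderiv (Gam (fst p) (snd p)) \<omega>) gs z = 0" if "?h p \<notin> set gs" for p
  proof (rule wedge_zero_if)
    fix hs assume "mset gs = add_mset (?h p) (mset hs)"
    then have "?h p \<in> set gs" by (metis set_mset_mset union_single_eq_member)
    then show "gderiv (Gam (fst p) (snd p)) \<omega> hs z = 0" using that by simp
  qed
  show ?thesis
    unfolding Dtot_form_def split_def
    by (intro arg_cong2[where f = "(+)"] refl sum'_eq_sum F) (use z0 in auto)
qed

lemma lhor_add: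
  assumes "\<And>hs. reg k (\<omega> hs)" "\<And>hs. reg k (\<omega>' hs)" "z \<in> S"
  shows "lhor n r (\<lambda>hs z. \<omega> hs z + \<omega>' hs z) gs z = lhor n r \<omega> gs z + lhor n r \<omega>' gs z"
proof -
  have "Dtot_form n r i (\<lambda>hs z. \<omega> hs z + \<omega>' hs z) hs z = Dtot_form n r i \<omega> hs z + Dtot_form n r i \<omega>' hs z"
    if "i < r" for i hs
    unfolding Dtot_form_eq Dtot_add[OF assms(1,2,3) that] gderiv_def wedge_add sum.distrib by simp
  then have "wedge (Dt i) (Dtot_form n r i (\<lambda>hs z. \<omega> hs z + \<omega>' hs z)) gs z =
      wedge (Dt i) (\<lambda>hs z. Dtot_form n r i \<omega> hs z + Dtot_form n r i \<omega>' hs z) gs z" if "i < r" for i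
    using that by (intro wedge_cong) simp
  then show ?thesis by (simp add: lhor_def wedge_add sum.distrib)
qed

lemma lhor_cmult:
  assumes "\<And>hs. reg k (\<omega> hs)" "z \<in> S"
  shows "lhor n r (\<lambda>hs z. x * \<omega> hs z) gs z = x * lhor n r \<omega> gs z"
proof -
  have "Dtot_form n r i (\<lambda>hs z. x * \<omega> hs z) hs z = x * Dtot_form n r i \<omega> hs z" if "i < r" for i hs
    unfolding Dtot_form_eq Dtot_cmult[OF assms(1,2) that] gderiv_def
      wedge_cmult[where c = "\<lambda>_. x"] sum_distrib_left[symmetric] by (simp add: distrib_left)
  then have "wedge (Dt i) (Dtot_form n r i (\<lambda>hs z. x * \<omega> hs z)) gs z =
      wedge (Dt i) (\<lambda>hs z. x * Dtot_form n r i \<omega> hs z) gs z" if "i < r" for i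
    using that by (intro wedge_cong) simp
  then show ?thesis by (simp add: lhor_def wedge_cmult[where c = "\<lambda>_. x"] sum_distrib_left)
qed

lemma lhor_cong:
  assumes "\<And>hs z. hs \<in> lists (gens n r) \<Longrightarrow> z \<in> S \<Longrightarrow> \<omega> hs z = \<omega>' hs z"
    and "z \<in> S" "gs \<in> lists (gens n r)"
  shows "lhor n r \<omega> gs z = lhor n r \<omega>' gs z"
  unfolding lhor_def
proof (intro sum.cong refl wedge_cong)
  fix i j assume i: "i \<in> {..<r}"
  let ?hs = "take j gs @ drop (Suc j) gs"
  have hs: "?hs \<in> lists (gens n r)" by (rule take_drop_lists[OF assms(3)])
  have "Dtot n r i (\<omega> ?hs) z = Dtot n r i (\<omega>' ?hs) z"
    by (rule Dtot_cong[OF assms(1)[OF hs] assms(2)]) (use i in auto)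
  moreover have "wedge (Gam (fst p) (add_mset i (snd p))) (gderiv (Gam (fst p) (snd p)) \<omega>) ?hs z =
      wedge (Gam (fst p) (add_mset i (snd p))) (gderiv (Gam (fst p) (snd p)) \<omega>') ?hs z"
    if "p \<in> {..<n} \<times> mindices r" for p
    unfolding gderiv_def
    by (intro wedge_cong assms(1,2) Cons_in_lists_iff[THEN iffD2] conjI take_drop_lists[OF hs]) (use that in auto)
  ultimately show "Dtot_form n r i \<omega> ?hs z = Dtot_form n r i \<omega>' ?hs z"
    unfolding Dtot_form_eq by (intro arg_cong2[where f = "(+)"] sum.cong refl) auto
qed

end

subsection \<open>Coefficient families\<close>

lemma cut_cut [simp]: "cut M r (cut M r \<omega>) = cut M r \<omega>"
  by (intro ext) (simp add: cut_def)

lemma alternating_cut: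
  assumes "\<And>gs g h hs z. c \<in> atlas M \<Longrightarrow> z \<in> J M r c \<Longrightarrow> gs @ g # h # hs \<in> lists (gens (mdim M) r) \<Longrightarrow>
    \<omega> c (gs @ g # h # hs) z = - \<omega> c (gs @ h # g # hs) z"
  shows "cut M r \<omega> c (gs @ g # h # hs) z = - cut M r \<omega> c (gs @ h # g # hs) z"
  using assms[of z gs g h hs] unfolding cut_def by auto

context mfd
begin

abbreviation regJ :: "nat \<Rightarrow> 'm chart \<Rightarrow> nat \<Rightarrow> (pt \<Rightarrow> real) \<Rightarrow> bool" where
  "regJ r c \<equiv> jet_domain.reg n r (J M r c)"

lemma regJ_iff: "c \<in> atlas M \<Longrightarrow> regJ r c k f \<longleftrightarrow> smooth_on (jcoords n r) (J M r c) f \<and> order_le k (J M r c) f"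
  using jet_domain.reg_def[OF jet_domain_J] .

text \<open>The transformation law of \<open>forms\<close> with jets replaced by points of the
  overlap and the second jet by \<open>transition\<close>. This form can be differentiated in the
  coordinates.\<close>

definition tensorial :: "nat \<Rightarrow> 'm form \<Rightarrow> bool" where
  "tensorial r \<omega> \<longleftrightarrow> (\<forall>c \<in> atlas M. \<forall>c' \<in> atlas M. \<forall>z \<in> JJ r c c'. \<forall>gs \<in> lists (gens n r).
     \<omega> c gs z = sum' (\<lambda>hs. \<omega> c' hs (transition M r c c' z) *
         (\<Prod>j<length gs. jac M r c c' (hs ! j) (gs ! j) z)) {hs \<in> lists (gens n r). length hs = length gs})"

text \<open>One number \<open>k\<close> bounds, in all charts, the order of the coefficients and the
  length of the multi-indices of the generators that occur.\<close>

definition bounded_regular :: "nat \<Rightarrow> nat \<Rightarrow> 'm form \<Rightarrow> bool" where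
  "bounded_regular r k \<omega> \<longleftrightarrow> (\<forall>c\<in>atlas M. \<forall>gs. regJ r c k (\<omega> c gs) \<and>
     (\<forall>z a \<sigma>. Gam a \<sigma> \<in> set gs \<longrightarrow> size \<sigma> > k \<longrightarrow> \<omega> c gs z = 0))"

definition bidegree :: "int \<Rightarrow> int \<Rightarrow> 'm form \<Rightarrow> bool" where
  "bidegree p q \<omega> \<longleftrightarrow> (\<forall>c gs z. \<omega> c gs z \<noteq> 0 \<longrightarrow>
        int (length (filter (Not \<circ> is_Dt) gs)) = p \<and> int (length (filter is_Dt gs)) = q)"

lemma forms_iff:
  "\<omega> \<in> forms M r p q \<longleftrightarrow> cut M r \<omega> = \<omega> \<and> bidegree p q \<omega> \<and> (\<forall>c. alternating (\<omega> c)) \<and>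
    (\<exists>k. bounded_regular r k \<omega>) \<and> tensorial r \<omega>"
proof -
  have 1: "(\<forall>c\<in>atlas M. \<forall>c'\<in>atlas M. \<forall>(t, s)\<in>germs M r. s t \<in> fst c \<inter> fst c' \<longrightarrow>
        (\<forall>gs \<in> lists (gens (mdim M) r).
           \<omega> c gs (jet M r c (t, s)) =
             sum' (\<lambda>hs. \<omega> c' hs (jet M r c' (t, s)) *
                 (\<Prod>j<length gs. jac M r c c' (hs ! j) (gs ! j) (jet M r c (t, s))))
               {hs \<in> lists (gens (mdim M) r). length hs = length gs})) \<longleftrightarrow> tensorial r \<omega>" (is "?L \<longleftrightarrow> _")
  proof
    assume L: ?L
    show "tensorial r \<omega>"
      unfolding tensorial_def
    proof (intro ballI)
      fix c c' z gs assume c: "c \<in> atlas M" "c' \<in> atlas M" and z: "z \<in> JJ r c c'" and gs: "gs \<in> lists (gens n r)"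
      obtain t s where g: "(t, s) \<in> germs M r" "s t \<in> fst c \<inter> fst c'" and zj: "z = jet M r c (t, s)"
        by (rule JJ_E[OF z])
      from bspec[OF bspec[OF bspec[OF L c(1)] c(2)] g(1)] g(2) gs
      show "\<omega> c gs z = sum' (\<lambda>hs. \<omega> c' hs (transition M r c c' z) *
         (\<Prod>j<length gs. jac M r c c' (hs ! j) (gs ! j) z)) {hs \<in> lists (gens n r). length hs = length gs}"
        unfolding zj transition_jet[OF c g] by simp
    qed
  next
    assume R: "tensorial r \<omega>"
    show ?L
    proof (intro ballI)
      fix c c' g assume c: "c \<in> atlas M" "c' \<in> atlas M" and g: "g \<in> germs M r"
      obtain t s where ts: "g = (t, s)" by (cases g)
      have "\<omega> c gs (jet M r c (t, s)) =
             sum' (\<lambda>hs. \<omega> c' hs (jet M r c' (t, s)) *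
                 (\<Prod>j<length gs. jac M r c c' (hs ! j) (gs ! j) (jet M r c (t, s))))
               {hs \<in> lists (gens (mdim M) r). length hs = length gs}"
        if "s t \<in> fst c \<inter> fst c'" "gs \<in> lists (gens n r)" for gs
        using R[unfolded tensorial_def, rule_format, OF c JJ_I[OF g[unfolded ts] that(1)] that(2)]
        unfolding transition_jet[OF c g[unfolded ts] that(1)] .
      then show "case g of (t, s) \<Rightarrow> s t \<in> fst c \<inter> fst c' \<longrightarrow>
        (\<forall>gs \<in> lists (gens (mdim M) r).
           \<omega> c gs (jet M r c (t, s)) =
             sum' (\<lambda>hs. \<omega> c' hs (jet M r c' (t, s)) *
                 (\<Prod>j<length gs. jac M r c c' (hs ! j) (gs ! j) (jet M r c (t, s))))
               {hs \<in> lists (gens (mdim M) r). length hs = length gs})"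
        unfolding ts by simp
    qed
  qed
  have 2: "(\<exists>k. \<forall>c \<in> atlas M. \<forall>gs. order_le k (J M r c) (\<omega> c gs) \<and>
        (\<forall>z a \<sigma>. Gam a \<sigma> \<in> set gs \<and> \<omega> c gs z \<noteq> 0 \<longrightarrow> size \<sigma> \<le> k)) \<and>
     (\<forall>c \<in> atlas M. \<forall>gs. smooth_on (jcoords (mdim M) r) (J M r c) (\<omega> c gs)) \<longleftrightarrow>
     (\<exists>k. bounded_regular r k \<omega>)"
  proof
    assume "(\<exists>k. \<forall>c \<in> atlas M. \<forall>gs. order_le k (J M r c) (\<omega> c gs) \<and>
        (\<forall>z a \<sigma>. Gam a \<sigma> \<in> set gs \<and> \<omega> c gs z \<noteq> 0 \<longrightarrow> size \<sigma> \<le> k)) \<and>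
     (\<forall>c \<in> atlas M. \<forall>gs. smooth_on (jcoords (mdim M) r) (J M r c) (\<omega> c gs))"
    then obtain k where k: "\<forall>c \<in> atlas M. \<forall>gs. order_le k (J M r c) (\<omega> c gs) \<and>
        (\<forall>z a \<sigma>. Gam a \<sigma> \<in> set gs \<and> \<omega> c gs z \<noteq> 0 \<longrightarrow> size \<sigma> \<le> k)"
      and sm: "\<forall>c \<in> atlas M. \<forall>gs. smooth_on (jcoords (mdim M) r) (J M r c) (\<omega> c gs)"
      by (elim exE conjE) (rule that)
    have "bounded_regular r k \<omega>"
      unfolding bounded_regular_def
    proof (intro ballI allI conjI impI)
      fix c gs assume c: "c \<in> atlas M"
      show "regJ r c k (\<omega> c gs)" using k sm c by (simp add: regJ_iff)
      fix z a \<sigma> assume "Gam a \<sigma> \<in> set gs" "size \<sigma> > k"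
      then show "\<omega> c gs z = 0" using k c by (metis not_le)
    qed
    then show "\<exists>k. bounded_regular r k \<omega>" by (rule exI)
  next
    assume "\<exists>k. bounded_regular r k \<omega>"
    then obtain k where "bounded_regular r k \<omega>" by (elim exE) (rule that)
    then have k: "\<forall>c\<in>atlas M. \<forall>gs. regJ r c k (\<omega> c gs) \<and>
      (\<forall>z a \<sigma>. Gam a \<sigma> \<in> set gs \<longrightarrow> size \<sigma> > k \<longrightarrow> \<omega> c gs z = 0)"
      by (simp only: bounded_regular_def)
    show "(\<exists>k. \<forall>c \<in> atlas M. \<forall>gs. order_le k (J M r c) (\<omega> c gs) \<and>
        (\<forall>z a \<sigma>. Gam a \<sigma> \<in> set gs \<and> \<omega> c gs z \<noteq> 0 \<longrightarrow> size \<sigma> \<le> k)) \<and>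
     (\<forall>c \<in> atlas M. \<forall>gs. smooth_on (jcoords (mdim M) r) (J M r c) (\<omega> c gs))"
    proof (intro conjI exI[of _ k] ballI allI impI)
      fix c gs assume c: "c \<in> atlas M"
      have "regJ r c k (\<omega> c gs)" using k c by blast
      then show "order_le k (J M r c) (\<omega> c gs)" "smooth_on (jcoords (mdim M) r) (J M r c) (\<omega> c gs)"
        using c by (simp_all add: regJ_iff)
      fix z a \<sigma> assume "Gam a \<sigma> \<in> set gs \<and> \<omega> c gs z \<noteq> 0"
      then show "size \<sigma> \<le> k" using k c by (metis not_le)
    qed
  qed
  show ?thesis
    unfolding forms_def mem_Collect_eq 1 bidegree_def alternating_def 2[symmetric]
    by (simp only: conj_assoc all_simps ex_simps)
qed

lemma formsD:
  assumes "\<omega> \<in> forms M r p q"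
  shows "cut M r \<omega> = \<omega>" "bidegree p q \<omega>" "alternating (\<omega> c)" "tensorial r \<omega>"
  using assms unfolding forms_iff by blast+

lemma bounded_regularD:
  assumes "bounded_regular r k \<omega>" "c \<in> atlas M"
  shows "regJ r c k (\<omega> c gs)" "Gam a \<sigma> \<in> set gs \<Longrightarrow> size \<sigma> > k \<Longrightarrow> \<omega> c gs z = 0"
  using assms unfolding bounded_regular_def by blast+

lemma bounded_regular_mono:
  assumes "bounded_regular r k \<omega>" "k \<le> l"
  shows "bounded_regular r l \<omega>"
  unfolding bounded_regular_def
proof (intro ballI allI conjI impI)
  fix c gs assume c: "c \<in> atlas M"
  show "regJ r c l (\<omega> c gs)"
    by (rule jet_domain.reg_mono[OF jet_domain_J[OF c] bounded_regularD(1)[OF assms(1) c] assms(2)])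
  show "\<omega> c gs z = 0" if "Gam a \<sigma> \<in> set gs" "size \<sigma> > l" for z a \<sigma>
    by (rule bounded_regularD(2)[OF assms(1) c that(1)]) (use that(2) assms(2) in simp)
qed

lemma tensorial_eq:
  assumes "bounded_regular r k \<omega>" "c \<in> atlas M" "c' \<in> atlas M"
  shows "sum' (\<lambda>hs. \<omega> c' hs z' * (\<Prod>j<length gs. jac M r c c' (hs ! j) (gs ! j) z))
      {hs \<in> lists (gens n r). length hs = length gs} =
    (\<Sum>hs | set hs \<subseteq> gens_le n r k \<and> length hs = length gs.
      \<omega> c' hs z' * (\<Prod>j<length gs. jac M r c c' (hs ! j) (gs ! j) z))"
proof (rule sum'_eq_sum)
  show "{hs. set hs \<subseteq> gens_le n r k \<and> length hs = length gs} \<subseteq> {hs \<in> lists (gens n r). length hs = length gs}"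
    using gens_le_subset by blast
  show "finite {hs. set hs \<subseteq> gens_le n r k \<and> length hs = length gs}"
    by (rule finite_lists_length_eq[OF finite_gens_le])
  fix hs assume hs: "hs \<in> {hs \<in> lists (gens n r). length hs = length gs}"
    "hs \<notin> {hs. set hs \<subseteq> gens_le n r k \<and> length hs = length gs}"
  then obtain g where g: "g \<in> set hs" "g \<notin> gens_le n r k" by blast
  moreover have "g \<in> gens n r" using g(1) hs(1) by auto
  ultimately obtain a \<sigma> where "g = Gam a \<sigma>" "size \<sigma> > k" using gens_not_le by blast
  then show "\<omega> c' hs z' * (\<Prod>j<length gs. jac M r c c' (hs ! j) (gs ! j) z) = 0"
    using bounded_regularD(2)[OF assms(1,3), of a \<sigma> hs z'] g(1) by simp
qed

section \<open>Linear structure of the spaces of forms\<close>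

lemma zero_in_forms: "(\<lambda>c gs z. 0) \<in> forms M r p q"
proof -
  have "bounded_regular r 0 (\<lambda>c gs z. 0)"
    unfolding bounded_regular_def using jet_domain.reg_const[OF jet_domain_J] by simp
  then show ?thesis
    unfolding forms_iff
    by (auto simp: cut_def[abs_def] bidegree_def alternating_def tensorial_def sum'_0)
qed

lemma add_in_forms:
  assumes "\<omega> \<in> forms M r p q" "\<omega>' \<in> forms M r p q"
  shows "(\<lambda>c gs z. \<omega> c gs z + \<omega>' c gs z) \<in> forms M r p q"
proof -
  obtain k1 k2 where "bounded_regular r k1 \<omega>" "bounded_regular r k2 \<omega>'"
    using assms unfolding forms_iff by blast
  then obtain k where k: "bounded_regular r k \<omega>" "bounded_regular r k \<omega>'"
    using bounded_regular_mono[of r k1 \<omega> "max k1 k2"] bounded_regular_mono[of r k2 \<omega>' "max k1 k2"] by auto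
  have B: "bounded_regular r k (\<lambda>c gs z. \<omega> c gs z + \<omega>' c gs z)"
    unfolding bounded_regular_def
  proof (intro ballI allI conjI impI)
    fix c gs assume c: "c \<in> atlas M"
    show "regJ r c k (\<lambda>z. \<omega> c gs z + \<omega>' c gs z)"
      by (rule jet_domain.reg_add[OF jet_domain_J[OF c]]) (rule bounded_regularD(1)[OF k(1) c], rule bounded_regularD(1)[OF k(2) c])
    show "\<omega> c gs z + \<omega>' c gs z = 0" if "Gam a \<sigma> \<in> set gs" "size \<sigma> > k" for z a \<sigma>
      using bounded_regularD(2)[OF k(1) c that] bounded_regularD(2)[OF k(2) c that] by simp
  qed
  have "cut M r (\<lambda>c gs z. \<omega> c gs z + \<omega>' c gs z) = (\<lambda>c gs z. cut M r \<omega> c gs z + cut M r \<omega>' c gs z)"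
    by (intro ext) (simp add: cut_def)
  then have "cut M r (\<lambda>c gs z. \<omega> c gs z + \<omega>' c gs z) = (\<lambda>c gs z. \<omega> c gs z + \<omega>' c gs z)"
    unfolding formsD(1)[OF assms(1)] formsD(1)[OF assms(2)] .
  moreover have "bidegree p q (\<lambda>c gs z. \<omega> c gs z + \<omega>' c gs z)"
    unfolding bidegree_def
  proof (intro allI impI)
    fix c gs z assume "\<omega> c gs z + \<omega>' c gs z \<noteq> 0"
    then have "\<omega> c gs z \<noteq> 0 \<or> \<omega>' c gs z \<noteq> 0" by auto
    then show "int (length (filter (Not \<circ> is_Dt) gs)) = p \<and> int (length (filter is_Dt gs)) = q"
      using formsD(2)[OF assms(1)] formsD(2)[OF assms(2)] unfolding bidegree_def by blast
  qed
  moreover have "alternating (\<lambda>gs z. \<omega> c gs z + \<omega>' c gs z)" for c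
    unfolding alternating_def
  proof (intro allI)
    fix gs g h hs z
    show "\<omega> c (gs @ g # h # hs) z + \<omega>' c (gs @ g # h # hs) z =
        - (\<omega> c (gs @ h # g # hs) z + \<omega>' c (gs @ h # g # hs) z)"
      using alternatingD[OF formsD(3)[OF assms(1)], of c gs g h hs z]
        alternatingD[OF formsD(3)[OF assms(2)], of c gs g h hs z] by linarith
  qed
  moreover have "tensorial r (\<lambda>c gs z. \<omega> c gs z + \<omega>' c gs z)"
    unfolding tensorial_def
  proof (intro ballI)
    fix c c' z gs assume c: "c \<in> atlas M" "c' \<in> atlas M" and z: "z \<in> JJ r c c'" and gs: "gs \<in> lists (gens n r)"
    note t1 = formsD(4)[OF assms(1), unfolded tensorial_def, rule_format, OF c z gs]
    note t2 = formsD(4)[OF assms(2), unfolded tensorial_def, rule_format, OF c z gs]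
    show "\<omega> c gs z + \<omega>' c gs z =
        sum' (\<lambda>hs. (\<omega> c' hs (transition M r c c' z) + \<omega>' c' hs (transition M r c c' z)) *
          (\<Prod>j<length gs. jac M r c c' (hs ! j) (gs ! j) z)) {hs \<in> lists (gens n r). length hs = length gs}"
      unfolding t1 t2 tensorial_eq[OF k(1) c] tensorial_eq[OF k(2) c] tensorial_eq[OF B c]
      by (simp add: distrib_right sum.distrib)
  qed
  ultimately show ?thesis using B unfolding forms_iff by blast
qed

lemma cmult_in_forms:
  assumes "\<omega> \<in> forms M r p q"
  shows "(\<lambda>c gs z. x * \<omega> c gs z) \<in> forms M r p q"
proof -
  obtain k where k: "bounded_regular r k \<omega>" using assms unfolding forms_iff by blast
  have B: "bounded_regular r k (\<lambda>c gs z. x * \<omega> c gs z)"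
    unfolding bounded_regular_def
  proof (intro ballI allI conjI impI)
    fix c gs assume c: "c \<in> atlas M"
    show "regJ r c k (\<lambda>z. x * \<omega> c gs z)"
      by (rule jet_domain.reg_cmult[OF jet_domain_J[OF c]]) (rule bounded_regularD(1)[OF k c])
    show "x * \<omega> c gs z = 0" if "Gam a \<sigma> \<in> set gs" "size \<sigma> > k" for z a \<sigma>
      using bounded_regularD(2)[OF k c that] by simp
  qed
  have "cut M r (\<lambda>c gs z. x * \<omega> c gs z) = (\<lambda>c gs z. x * cut M r \<omega> c gs z)"
    by (intro ext) (simp add: cut_def)
  then have "cut M r (\<lambda>c gs z. x * \<omega> c gs z) = (\<lambda>c gs z. x * \<omega> c gs z)"
    unfolding formsD(1)[OF assms(1)] .
  moreover have "bidegree p q (\<lambda>c gs z. x * \<omega> c gs z)"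
    unfolding bidegree_def
  proof (intro allI impI)
    fix c gs z assume "x * \<omega> c gs z \<noteq> 0"
    then have "\<omega> c gs z \<noteq> 0" by auto
    then show "int (length (filter (Not \<circ> is_Dt) gs)) = p \<and> int (length (filter is_Dt gs)) = q"
      using formsD(2)[OF assms(1)] unfolding bidegree_def by blast
  qed
  moreover have "alternating (\<lambda>gs z. x * \<omega> c gs z)" for c
    unfolding alternating_def
  proof (intro allI)
    fix gs g h hs z
    show "x * \<omega> c (gs @ g # h # hs) z = - (x * \<omega> c (gs @ h # g # hs) z)"
      unfolding alternatingD[OF formsD(3)[OF assms(1)], of c gs g h hs z] by (rule mult_minus_right)
  qed
  moreover have "tensorial r (\<lambda>c gs z. x * \<omega> c gs z)"
    unfolding tensorial_def
  proof (intro ballI)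
    fix c c' z gs assume c: "c \<in> atlas M" "c' \<in> atlas M" and z: "z \<in> JJ r c c'" and gs: "gs \<in> lists (gens n r)"
    note t1 = formsD(4)[OF assms(1), unfolded tensorial_def, rule_format, OF c z gs]
    show "x * \<omega> c gs z =
        sum' (\<lambda>hs. x * \<omega> c' hs (transition M r c c' z) *
          (\<Prod>j<length gs. jac M r c c' (hs ! j) (gs ! j) z)) {hs \<in> lists (gens n r). length hs = length gs}"
      unfolding t1 tensorial_eq[OF k c] tensorial_eq[OF B c]
      by (simp add: sum_distrib_left mult.assoc)
  qed
  ultimately show ?thesis using B unfolding forms_iff by blast
qed

section \<open>The transformation law and horizontal arguments\<close>

lemma jac_is_Dt: "jac M r c c' h g z \<noteq> 0 \<Longrightarrow> is_Dt h = is_Dt g"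
  by (cases h; cases g) auto

lemma jac_Dt: "jac M r c c' h (Dt i) z \<noteq> 0 \<Longrightarrow> h = Dt i"
  by (cases h) (auto split: if_splits)

lemma jac_prod_nonzero:
  assumes "(\<Prod>j<length gs. jac M r c c' (hs ! j) (gs ! j) z) \<noteq> 0" "length hs = length gs" "j < length gs"
  shows "jac M r c c' (hs ! j) (gs ! j) z \<noteq> 0"
  using assms by (auto simp: prod_zero_iff)

lemma map_is_Dt_eq:
  assumes "(\<Prod>j<length gs. jac M r c c' (hs ! j) (gs ! j) z) \<noteq> 0" "length hs = length gs"
  shows "map is_Dt hs = map is_Dt gs"
  by (rule nth_equalityI) (use assms jac_is_Dt[OF jac_prod_nonzero[OF assms]] in auto)

text \<open>The Jacobian is the identity on the dt^i and does not mix them with vertical generators.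
  For a horizontal list only the term with the same list survives, so the coefficients transform
  like functions.\<close>

lemma tensorial_horizontal:
  assumes "\<And>c gs g. g \<in> set gs \<Longrightarrow> \<not> is_Dt g \<Longrightarrow> \<omega> c gs = (\<lambda>z. 0)"
  shows "tensorial r \<omega> \<longleftrightarrow> (\<forall>c \<in> atlas M. \<forall>c' \<in> atlas M. \<forall>z \<in> JJ r c c'. \<forall>gs \<in> lists (Dt ` {..<r}).
    \<omega> c gs z = \<omega> c' gs (transition M r c c' z))"
proof -
  have eq: "sum' (\<lambda>hs. \<omega> c' hs z' * (\<Prod>j<length gs. jac M r c c' (hs ! j) (gs ! j) z))
      {hs \<in> lists (gens n r). length hs = length gs} = \<omega> c' gs z'" if gs: "gs \<in> lists (gens n r)" for c c' z z' gs
  proof (cases "\<forall>g\<in>set gs. is_Dt g")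
    case True
    have "sum' (\<lambda>hs. \<omega> c' hs z' * (\<Prod>j<length gs. jac M r c c' (hs ! j) (gs ! j) z))
      {hs \<in> lists (gens n r). length hs = length gs} =
      sum (\<lambda>hs. \<omega> c' hs z' * (\<Prod>j<length gs. jac M r c c' (hs ! j) (gs ! j) z)) {gs}"
    proof (rule sum'_eq_sum)
      fix hs assume hs: "hs \<in> {hs \<in> lists (gens n r). length hs = length gs}" "hs \<notin> {gs}"
      have "(\<Prod>j<length gs. jac M r c c' (hs ! j) (gs ! j) z) = 0"
      proof (rule ccontr)
        assume ne: "(\<Prod>j<length gs. jac M r c c' (hs ! j) (gs ! j) z) \<noteq> 0"
        have "hs ! j = gs ! j" if j: "j < length gs" for j
        proof -
          obtain i where "gs ! j = Dt i" using True j by (metis is_Dt.elims(2) nth_mem)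
          then show ?thesis using jac_Dt jac_prod_nonzero[OF ne _ j] hs(1) by auto
        qed
        then have "hs = gs" using hs(1) by (intro nth_equalityI) auto
        then show False using hs(2) by simp
      qed
      then show "\<omega> c' hs z' * (\<Prod>j<length gs. jac M r c c' (hs ! j) (gs ! j) z) = 0" by simp
    qed (use gs in auto)
    moreover have "(\<Prod>j<length gs. jac M r c c' (gs ! j) (gs ! j) z) = 1"
    proof (rule prod.neutral, intro ballI)
      fix j assume "j \<in> {..<length gs}"
      then obtain i where "gs ! j = Dt i" using True by (metis is_Dt.elims(2) lessThan_iff nth_mem)
      then show "jac M r c c' (gs ! j) (gs ! j) z = 1" by simp
    qed
    ultimately show ?thesis by simp
  next
    case False
    then obtain g where g: "g \<in> set gs" "\<not> is_Dt g" by blast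
    have "sum' (\<lambda>hs. \<omega> c' hs z' * (\<Prod>j<length gs. jac M r c c' (hs ! j) (gs ! j) z))
      {hs \<in> lists (gens n r). length hs = length gs} = 0"
    proof (rule sum'_0)
      fix hs assume hs: "hs \<in> {hs \<in> lists (gens n r). length hs = length gs}"
      show "\<omega> c' hs z' * (\<Prod>j<length gs. jac M r c c' (hs ! j) (gs ! j) z) = 0"
      proof (cases "(\<Prod>j<length gs. jac M r c c' (hs ! j) (gs ! j) z) = 0")
        case False
        then have "map is_Dt hs = map is_Dt gs" using map_is_Dt_eq hs by blast
        then have "is_Dt ` set hs = is_Dt ` set gs" by (metis list.set_map)
        then have "False \<in> is_Dt ` set hs" using g by (metis (full_types) imageI)
        then obtain h where "h \<in> set hs" "\<not> is_Dt h" by auto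
        then show ?thesis using assms by simp
      qed simp
    qed
    then show ?thesis using assms[OF g] by simp
  qed
  show ?thesis
  proof
    assume T: "tensorial r \<omega>"
    show "\<forall>c \<in> atlas M. \<forall>c' \<in> atlas M. \<forall>z \<in> JJ r c c'. \<forall>gs \<in> lists (Dt ` {..<r}).
      \<omega> c gs z = \<omega> c' gs (transition M r c c' z)"
    proof (intro ballI)
      fix c c' z gs assume c: "c \<in> atlas M" "c' \<in> atlas M" "z \<in> JJ r c c'" and "gs \<in> lists (Dt ` {..<r})"
      then have gs: "gs \<in> lists (gens n r)" by auto
      show "\<omega> c gs z = \<omega> c' gs (transition M r c c' z)"
        using T[unfolded tensorial_def, rule_format, OF c gs] eq[OF gs] by simp
    qed
  next
    assume H: "\<forall>c \<in> atlas M. \<forall>c' \<in> atlas M. \<forall>z \<in> JJ r c c'. \<forall>gs \<in> lists (Dt ` {..<r}).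
      \<omega> c gs z = \<omega> c' gs (transition M r c c' z)"
    show "tensorial r \<omega>"
      unfolding tensorial_def
    proof (intro ballI)
      fix c c' z gs assume c: "c \<in> atlas M" "c' \<in> atlas M" "z \<in> JJ r c c'" and gs: "gs \<in> lists (gens n r)"
      have "\<omega> c gs z = \<omega> c' gs (transition M r c c' z)"
      proof (cases "\<forall>g\<in>set gs. is_Dt g")
        case True
        then have "gs \<in> lists (Dt ` {..<r})" using gs by (fastforce simp: gens_def)
        then show ?thesis using H c by blast
      next
        case False
        then obtain g where g: "g \<in> set gs" "\<not> is_Dt g" by blast
        show ?thesis by (simp add: assms[OF g])
      qed
      then show "\<omega> c gs z = sum' (\<lambda>hs. \<omega> c' hs (transition M r c c' z) *
         (\<Prod>j<length gs. jac M r c c' (hs ! j) (gs ! j) z)) {hs \<in> lists (gens n r). length hs = length gs}"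
        unfolding eq[OF gs] .
    qed
  qed
qed

section \<open>Invariance of the vertical differential under changes of charts\<close>

lemma bidegree_0_vertical:
  assumes "bidegree 0 q \<omega>" "g \<in> set gs" "\<not> is_Dt g"
  shows "\<omega> c gs = (\<lambda>z. 0)"
proof (rule ext, rule ccontr)
  fix z assume "\<omega> c gs z \<noteq> 0"
  then have "filter (Not \<circ> is_Dt) gs = []" using assms(1) unfolding bidegree_def by fastforce
  then show False using assms(2,3) by (simp add: filter_empty_conv)
qed

lemma regJ_subset:
  assumes "c \<in> atlas M" "c' \<in> atlas M" "regJ r c k f"
  shows "jet_domain.reg n r (JJ r c c') k f"
proof -
  have "smooth_on (jcoords n r) (J M r c) f" "order_le k (J M r c) f" using assms regJ_iff by auto
  then have "smooth_on (jcoords n r) (JJ r c c') f" "order_le k (JJ r c c') f"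
    using smooth_on_subset[OF _ JJ_subset_J] JJ_subset_J[of r c c'] unfolding order_le_def by blast+
  then show ?thesis by (simp add: jet_domain.reg_def[OF jet_domain_JJ[OF assms(1,2)]])
qed

text \<open>Chain rule for \<open>f\<close> composed with the change of charts. The coordinates t^i
  are unchanged by it and hence contribute nothing to a derivative by x^a_\<sigma>; finite order
  makes the sum over the remaining ones finite.\<close>

lemma pd_transition:
  assumes c: "c \<in> atlas M" "c' \<in> atlas M" and f: "regJ r c' k f" and z: "z \<in> JJ r c c'"
    and a: "a < n" "\<sigma> \<in> mindices r"
    and g: "\<And>w. w \<in> JJ r c c' \<Longrightarrow> g w = f (transition M r c c' w)"
  shows "pd (X a \<sigma>) g z = sum' (\<lambda>(b, \<tau>). pd (X b \<tau>) f (transition M r c c' z) *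
      pd (X a \<sigma>) (\<lambda>w. transition M r c c' w (X b \<tau>)) z) ({..<n} \<times> mindices r)"
proof -
  interpret A: jet_domain n r "JJ r c c'" by (rule jet_domain_JJ[OF c])
  interpret B: jet_domain n r "JJ r c' c" by (rule jet_domain_JJ[OF c(2,1)])
  let ?t = "transition M r c c'"
  have f': "B.reg k f" by (rule regJ_subset[OF c(2,1) f])
  have y: "X a \<sigma> \<in> jcoords n r" using a by simp
  have T: "A.reg 0 (\<lambda>w. ?t w (T i))" for i
    by (rule A.reg_cong[of "\<lambda>w. w (T i)"]) (simp_all add: transition_T[OF c] A.reg_coord)
  have D: "Ck 0 (jcoords n r) (JJ r c c') (\<lambda>w. ?t w y)" if "y \<in> jcoords_le n r k" for y
  proof (cases y)
    case (T i)
    show ?thesis unfolding T by (rule A.reg_Ck[OF \<open>A.reg 0 (\<lambda>w. ?t w (coord.T i))\<close>])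
  next
    case (X b \<tau>)
    then have "b < n" "\<tau> \<in> mindices r" using that by (auto simp: jcoords_le_eq)
    then show ?thesis unfolding X by (rule A.reg_Ck[OF reg_transition_X[OF c]])
  qed
  have "pd (X a \<sigma>) g z = pd (X a \<sigma>) (\<lambda>w. f (?t w)) z"
    by (rule pd_cong[OF A.coord_open z y g])
  also have "\<dots> = (\<Sum>y\<in>jcoords_le n r k. pd y f (?t z) * pd (X a \<sigma>) (\<lambda>w. ?t w y) z)"
    by (rule pd_comp(2)[OF B.coord_open B.reg_Ck[OF f'] finite_jcoords_le jcoords_le_subset
          B.reg_depends[OF f'] A.coord_open transition_in[OF c] D z y])
  also have "\<dots> = (\<Sum>(b, \<tau>)\<in>{..<n} \<times> mindices_le r k. pd (X b \<tau>) f (?t z) * pd (X a \<sigma>) (\<lambda>w. ?t w (X b \<tau>)) z)"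
  proof -
    have "pd (X a \<sigma>) (\<lambda>w. ?t w (coord.T i)) z = pd (X a \<sigma>) (\<lambda>w. w (coord.T i)) z" for i
      by (rule pd_cong[OF A.coord_open z y transition_T[OF c]])
    then show ?thesis unfolding sum_jcoords_le by (simp add: pd_coord)
  qed
  also have "\<dots> = sum' (\<lambda>(b, \<tau>). pd (X b \<tau>) f (?t z) *
      pd (X a \<sigma>) (\<lambda>w. ?t w (X b \<tau>)) z) ({..<n} \<times> mindices r)"
  proof (rule sum'_eq_sum[symmetric])
    fix p assume p: "p \<in> {..<n} \<times> mindices r" "p \<notin> {..<n} \<times> mindices_le r k"
    have "pd (X (fst p) (snd p)) f (?t z) = 0"
      by (rule B.pd_above_order[of k]) (use f' p transition_in[OF c z] in \<open>auto simp: B.reg_def mindices_le_def\<close>)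
    then show "(case p of (b, \<tau>) \<Rightarrow> pd (X b \<tau>) f (?t z) * pd (X a \<sigma>) (\<lambda>w. ?t w (X b \<tau>)) z) = 0"
      by (simp add: split_def)
  qed (simp_all add: finite_mindices_le, auto simp: mindices_le_def)
  finally show ?thesis .
qed

lemma regJ_cut:
  assumes "c \<in> atlas M" "\<And>gs. gs \<in> lists (gens n r) \<Longrightarrow> regJ r c k (\<omega> c gs)"
  shows "regJ r c k (cut M r \<omega> c gs)"
proof (cases "gs \<in> lists (gens n r)")
  case True
  show ?thesis
    by (rule jet_domain.reg_cong[OF jet_domain_J[OF assms(1)] _ assms(2)[OF True]])
       (use True assms(1) in \<open>simp add: cut_def\<close>)
next
  case False
  then have "cut M r \<omega> c gs = (\<lambda>z. 0)" by (auto simp: cut_def fun_eq_iff)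
  then show ?thesis using jet_domain.reg_const[OF jet_domain_J[OF assms(1)]] by simp
qed

lemma vert_eq:
  "c \<in> atlas M \<Longrightarrow> z \<in> J M r c \<Longrightarrow> gs \<in> lists (gens n r) \<Longrightarrow> vert M r \<omega> c gs z = lvert n r (\<omega> c) gs z"
  by (simp add: vert_def cut_def)

lemma hor_eq:
  "c \<in> atlas M \<Longrightarrow> z \<in> J M r c \<Longrightarrow> gs \<in> lists (gens n r) \<Longrightarrow> hor M r \<omega> c gs z = lhor n r (\<omega> c) gs z"
  by (simp add: hor_def cut_def)

lemma bidegree_vert:
  assumes "bidegree 0 q \<omega>"
  shows "bidegree 1 q (vert M r \<omega>)"
  unfolding bidegree_def
proof (intro allI impI)
  fix c gs z assume ne: "vert M r \<omega> c gs z \<noteq> 0"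
  then have c: "c \<in> atlas M" "z \<in> J M r c" "gs \<in> lists (gens n r)"
    by (auto simp: vert_def cut_def split: if_splits)
  then have "lvert n r (\<omega> c) gs z \<noteq> 0" using ne by (simp add: vert_eq)
  then obtain a \<sigma> hs where gs: "mset gs = add_mset (Gam a \<sigma>) (mset hs)" and "pd (X a \<sigma>) (\<omega> c hs) z \<noteq> 0"
    by (rule jet_domain.lvert_support[OF jet_domain_J[OF c(1)]])
  then have "\<omega> c hs \<noteq> (\<lambda>z. 0)" by (auto simp: pd_const)
  then obtain w where "\<omega> c hs w \<noteq> 0" by blast
  then have "int (length (filter (Not \<circ> is_Dt) hs)) = 0" "int (length (filter is_Dt hs)) = q"
    using assms unfolding bidegree_def by blast+
  then show "int (length (filter (Not \<circ> is_Dt) gs)) = 1 \<and> int (length (filter is_Dt gs)) = q"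
    unfolding length_filter_mset gs by simp
qed

text \<open>For horizontal \<open>\<omega>\<close> the values of \<delta>\<omega> live on lists with
  exactly one vertical entry. The transformation law then sums only over the replacements of this
  entry, and it becomes the chain rule for the coefficients of \<open>\<omega>\<close>.\<close>

lemma vert_in_forms:
  assumes \<omega>: "\<omega> \<in> forms M r 0 q"
  shows "vert M r \<omega> \<in> forms M r 1 q"
proof -
  obtain k where k: "bounded_regular r k \<omega>" using \<omega> unfolding forms_iff by blast
  note deg = bidegree_vert[OF formsD(2)[OF \<omega>], of r]
  note vert0 = bidegree_0_vertical[OF formsD(2)[OF \<omega>]]
  have "cut M r (vert M r \<omega>) = vert M r \<omega>" by (simp add: vert_def)
  moreover have "alternating (vert M r \<omega> c)" for c
    unfolding alternating_def vert_def
  proof (intro allI alternating_cut)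
    fix gs g h hs z assume c: "c \<in> atlas M" and z: "z \<in> J M r c"
    show "lvert n r (\<omega> c) (gs @ g # h # hs) z = - lvert n r (\<omega> c) (gs @ h # g # hs) z"
      by (rule jet_domain.alternating_lvert[OF jet_domain_J[OF c] formsD(3)[OF \<omega>] bounded_regularD(1)[OF k c] z])
  qed
  moreover have "bounded_regular r k (vert M r \<omega>)"
    unfolding bounded_regular_def
  proof (intro ballI allI conjI impI)
    fix c gs assume c: "c \<in> atlas M"
    interpret jet_domain n r "J M r c" by (rule jet_domain_J[OF c])
    show "reg k (vert M r \<omega> c gs)"
      unfolding vert_def by (rule regJ_cut[OF c]) (rule reg_lvert[OF bounded_regularD(1)[OF k c]])
    fix z b \<tau> assume b: "Gam b \<tau> \<in> set gs" "size \<tau> > k"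
    show "vert M r \<omega> c gs z = 0"
    proof (rule ccontr)
      assume ne: "vert M r \<omega> c gs z \<noteq> 0"
      then have z: "z \<in> J M r c" "gs \<in> lists (gens n r)"
        by (auto simp: vert_def cut_def split: if_splits)
      then have "lvert n r (\<omega> c) gs z \<noteq> 0" using ne c by (simp add: vert_eq)
      then obtain a \<sigma> hs where a: "a < n" "\<sigma> \<in> mindices r" and gs: "mset gs = add_mset (Gam a \<sigma>) (mset hs)"
        and pd: "pd (X a \<sigma>) (\<omega> c hs) z \<noteq> 0"
        by (rule lvert_support)
      have "\<omega> c hs \<noteq> (\<lambda>z. 0)" using pd by (auto simp: pd_const)
      \<comment> \<open>The long generator can only be the one introduced by \<delta>, and there the
        coefficient is a derivative above the order of \<open>\<omega>\<close>.\<close>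
      then have "Gam b \<tau> \<notin> set hs" using vert0[of "Gam b \<tau>" hs c] by auto
      moreover have "Gam b \<tau> \<in># mset gs" using b(1) by simp
      ultimately have "Gam b \<tau> = Gam a \<sigma>" unfolding gs by auto
      then have "pd (X a \<sigma>) (\<omega> c hs) z = 0"
        using a b(2) z(1) bounded_regularD(1)[OF k c, of hs]
        by (intro pd_above_order[of k]) (auto simp: reg_def)
      then show False using pd by simp
    qed
  qed
  moreover have "tensorial r (vert M r \<omega>)"
    unfolding tensorial_def
  proof (intro ballI)
    fix c c' z gs assume c: "c \<in> atlas M" "c' \<in> atlas M" and z: "z \<in> JJ r c c'" and gs: "gs \<in> lists (gens n r)"
    let ?t = "transition M r c c'"
    let ?A = "{hs \<in> lists (gens n r). length hs = length gs}"
    let ?s = "\<lambda>hs. vert M r \<omega> c' hs (?t z) * (\<Prod>j<length gs. jac M r c c' (hs ! j) (gs ! j) z)"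
    have tz: "?t z \<in> JJ r c' c" by (rule transition_in[OF c z])
    then have tzJ: "?t z \<in> J M r c'" using JJ_subset_J by blast
    have zJ: "z \<in> J M r c" using z JJ_subset_J by blast
    interpret A: jet_domain n r "J M r c" by (rule jet_domain_J[OF c(1)])
    interpret B: jet_domain n r "J M r c'" by (rule jet_domain_J[OF c(2)])
    show "vert M r \<omega> c gs z = sum' ?s ?A"
    \<comment> \<open>With any other number of vertical entries both sides vanish, since nonzero
      Jacobian factors preserve which entries are horizontal.\<close>
    proof (cases "length (filter (Not \<circ> is_Dt) gs) = 1")
      case False
      have "vert M r \<omega> c gs z = 0" using deg False unfolding bidegree_def by fastforce
      moreover have "sum' ?s ?A = 0"
      proof (rule sum'_0)
        fix hs assume hs: "hs \<in> ?A"
        show "?s hs = 0"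
        proof (cases "(\<Prod>j<length gs. jac M r c c' (hs ! j) (gs ! j) z) = 0")
          case ne: False
          then have "map is_Dt hs = map is_Dt gs" using map_is_Dt_eq hs by blast
          moreover have "length (filter (Not \<circ> is_Dt) xs) = length (filter Not (map is_Dt xs))" for xs
            by (simp add: filter_map)
          ultimately have "length (filter (Not \<circ> is_Dt) hs) \<noteq> 1" using False by metis
          then show ?thesis using deg unfolding bidegree_def by fastforce
        qed simp
      qed
      ultimately show ?thesis by simp
    next
      case True
      then obtain g where "filter (Not \<circ> is_Dt) gs = [g]" by (metis One_nat_def length_0_conv length_Suc_conv)
      then obtain xs ys where split: "gs = xs @ g # ys" and xs: "\<forall>u\<in>set xs. \<not> (Not \<circ> is_Dt) u"
        and g: "(Not \<circ> is_Dt) g" and ys: "[] = filter (Not \<circ> is_Dt) ys"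
        unfolding filter_eq_Cons_iff by blast
      have Dts: "is_Dt h" if "h \<in> set xs \<union> set ys" for h
        using that xs ys[symmetric] by (auto simp: filter_empty_conv)
      obtain a \<sigma> where ga: "g = Gam a \<sigma>" using g by (cases g) auto
      have a: "a < n" "\<sigma> \<in> mindices r" and xys: "xs @ ys \<in> lists (gens n r)"
        using gs unfolding split ga by auto
      have xysD: "xs @ ys \<in> lists (Dt ` {..<r})"
        using xys Dts by (fastforce simp: gens_def)
      let ?h = "\<lambda>(b, \<tau>). xs @ Gam b \<tau> # ys"
      let ?P = "{..<n} \<times> mindices r"
      have inj: "inj_on ?h B" for B :: "(nat \<times> nat multiset) set" by (auto simp: inj_on_def)
      have sub: "?h ` ?P \<subseteq> ?A" using xys by (auto simp: split)
      \<comment> \<open>A nonzero product forces equality at every horizontal position and a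
        vertical entry at the remaining one.\<close>
      have out: "?s hs = 0" if hs: "hs \<in> ?A" "hs \<notin> ?h ` ?P" for hs
      proof -
        have "(\<Prod>j<length gs. jac M r c c' (hs ! j) (gs ! j) z) = 0"
        proof (rule ccontr)
          assume ne: "(\<Prod>j<length gs. jac M r c c' (hs ! j) (gs ! j) z) \<noteq> 0"
          have len: "length hs = length gs" using hs by simp
          let ?m = "length xs"
          have m: "?m < length gs" by (simp add: split)
          have other: "hs ! j = gs ! j" if j: "j < length gs" "j \<noteq> ?m" for j
          proof -
            have "gs ! j \<in> set xs \<union> set ys"
              using j unfolding split by (auto simp: nth_append nth_Cons')
            then obtain i where "gs ! j = Dt i" using Dts by (metis is_Dt.elims(2))
            then show ?thesis using jac_Dt jac_prod_nonzero[OF ne len j(1)] by auto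
          qed
          have "\<not> is_Dt (hs ! ?m)"
            using jac_is_Dt[OF jac_prod_nonzero[OF ne len m]] by (simp add: split ga)
          then obtain b \<tau> where b: "hs ! ?m = Gam b \<tau>" by (cases "hs ! ?m") auto
          have "hs = xs @ Gam b \<tau> # ys"
          proof (rule nth_equalityI)
            fix j assume "j < length hs"
            then show "hs ! j = (xs @ Gam b \<tau> # ys) ! j"
              using other[of j] b len unfolding split by (cases "j = ?m") (auto simp: nth_append nth_Cons')
          qed (simp add: len split)
          moreover have "(b, \<tau>) \<in> ?P"
          proof -
            have "hs ! ?m \<in> gens n r" using hs(1) m len by (metis (mono_tags, lifting) in_lists_conv_set mem_Collect_eq nth_mem)
            then show ?thesis by (simp add: b)
          qed
          ultimately show False using hs(2) by force
        qed
        then show ?thesis by simp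
      qed
      \<comment> \<open>Every horizontal position contributes the factor 1, leaving the one Jacobian
        entry of the vertical position.\<close>
      have prod: "(\<Prod>j<length gs. jac M r c c' ((xs @ Gam b \<tau> # ys) ! j) (gs ! j) z) =
          pd (X a \<sigma>) (\<lambda>w. ?t w (X b \<tau>)) z" for b \<tau>
      proof -
        have "(\<Prod>j<length gs. jac M r c c' ((xs @ Gam b \<tau> # ys) ! j) (gs ! j) z) =
            (\<Prod>j<length gs. if j = length xs then pd (X a \<sigma>) (\<lambda>w. ?t w (X b \<tau>)) z else 1)"
        proof (rule prod.cong[OF refl])
          fix j assume j: "j \<in> {..<length gs}"
          show "jac M r c c' ((xs @ Gam b \<tau> # ys) ! j) (gs ! j) z =
              (if j = length xs then pd (X a \<sigma>) (\<lambda>w. ?t w (X b \<tau>)) z else 1)"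
          proof (cases "j = length xs")
            case False
            have "gs ! j \<in> set xs \<union> set ys" "(xs @ Gam b \<tau> # ys) ! j = gs ! j"
              using j False unfolding split by (auto simp: nth_append nth_Cons')
            moreover from this obtain i where "gs ! j = Dt i" using Dts by (metis is_Dt.elims(2))
            ultimately show ?thesis using False by simp
          qed (simp add: split ga)
        qed
        then show ?thesis by (simp add: split)
      qed
      have "sum' ?s ?A = sum' ?s (?h ` ?P)"
        by (rule sum.mono_neutral_right'[OF sub]) (intro ballI, elim DiffE, rule out)
      also have "\<dots> = sum' (?s \<circ> ?h) ?P" by (rule sum'_reindex[OF inj])
      also have "\<dots> = sum' (\<lambda>p. (-1) ^ length xs * (case p of (b, \<tau>) \<Rightarrow> pd (X b \<tau>) (\<omega> c' (xs @ ys)) (?t z) *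
          pd (X a \<sigma>) (\<lambda>w. ?t w (X b \<tau>)) z)) ?P"
      proof (rule sum.cong'[OF refl])
        fix p assume p: "p \<in> ?P"
        then obtain b \<tau> where pb: "p = (b, \<tau>)" "b < n" "\<tau> \<in> mindices r" by auto
        have "vert M r \<omega> c' (xs @ Gam b \<tau> # ys) (?t z) = lvert n r (\<omega> c') (xs @ Gam b \<tau> # ys) (?t z)"
          by (rule vert_eq[OF c(2) tzJ]) (use xys pb in auto)
        also have "\<dots> = (-1) ^ length xs * pd (X b \<tau>) (\<omega> c' (xs @ ys)) (?t z)"
          by (rule B.lvert_one_vertical[OF Dts pb(2,3)])
        finally show "(?s \<circ> ?h) p = (-1) ^ length xs * (case p of (b, \<tau>) \<Rightarrow> pd (X b \<tau>) (\<omega> c' (xs @ ys)) (?t z) *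
          pd (X a \<sigma>) (\<lambda>w. ?t w (X b \<tau>)) z)"
          by (simp add: pb(1) prod)
      qed
      also have "\<dots> = (-1) ^ length xs * sum' (\<lambda>(b, \<tau>). pd (X b \<tau>) (\<omega> c' (xs @ ys)) (?t z) *
          pd (X a \<sigma>) (\<lambda>w. ?t w (X b \<tau>)) z) ?P"
      proof (rule sum'_cmult[where F = "{..<n} \<times> mindices_le r k"])
        fix p assume p: "p \<in> ?P" "p \<notin> {..<n} \<times> mindices_le r k"
        have "pd (X (fst p) (snd p)) (\<omega> c' (xs @ ys)) (?t z) = 0"
          by (rule B.pd_above_order[of k])
             (use bounded_regularD(1)[OF k c(2), of "xs @ ys"] p tzJ in \<open>auto simp: B.reg_def mindices_le_def\<close>)
        then show "(case p of (b, \<tau>) \<Rightarrow> pd (X b \<tau>) (\<omega> c' (xs @ ys)) (?t z) *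
          pd (X a \<sigma>) (\<lambda>w. ?t w (X b \<tau>)) z) = 0" by (simp add: split_def)
      qed (simp_all add: finite_mindices_le, auto simp: mindices_le_def)
      also have "\<dots> = (-1) ^ length xs * pd (X a \<sigma>) (\<omega> c (xs @ ys)) z"
      proof -
        have H: "\<forall>c \<in> atlas M. \<forall>c' \<in> atlas M. \<forall>z \<in> JJ r c c'. \<forall>gs \<in> lists (Dt ` {..<r}).
            \<omega> c gs z = \<omega> c' gs (transition M r c c' z)"
          by (rule tensorial_horizontal[THEN iffD1, OF vert0 formsD(4)[OF \<omega>]])
        have inv: "\<omega> c (xs @ ys) w = \<omega> c' (xs @ ys) (?t w)" if w: "w \<in> JJ r c c'" for w
          using H c w xysD by blast
        have "pd (X a \<sigma>) (\<omega> c (xs @ ys)) z = sum' (\<lambda>(b, \<tau>). pd (X b \<tau>) (\<omega> c' (xs @ ys)) (?t z) *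
            pd (X a \<sigma>) (\<lambda>w. ?t w (X b \<tau>)) z) ?P"
          by (rule pd_transition[OF c bounded_regularD(1)[OF k c(2)] z a inv])
        then show ?thesis by simp
      qed
      also have "\<dots> = lvert n r (\<omega> c) gs z"
        unfolding split ga by (rule A.lvert_one_vertical[OF Dts a, symmetric])
      also have "\<dots> = vert M r \<omega> c gs z" by (rule vert_eq[OF c(1) zJ gs, symmetric])
      finally show ?thesis by simp
    qed
  qed
  ultimately show ?thesis using deg unfolding forms_iff by blast
qed

end

section \<open>Lagrangians\<close>

context jet_domain
begin

text \<open>The coefficients of D_i are coordinates x^a_\<sigma>. Taking for \<open>K\<close> all of
  these shows that total derivatives create no dependence on the t^i.\<close>

lemma depends_on_Dtot:
  assumes "depends_on K S f" "i < r" "\<And>a \<sigma>. X a \<sigma> \<in> K"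
  shows "depends_on K S (Dtot n r i f)"
proof (rule depends_onI)
  fix z z' assume z: "z \<in> S" "z' \<in> S" "\<forall>y\<in>K. z y = z' y"
  have pd: "pd y f z = pd y f z'" if "y \<in> jcoords n r" for y
    by (rule depends_onD[OF depends_on_pd[OF coord_open assms(1) that]]) (use z in auto)
  have "sum' (\<lambda>(a, \<sigma>). z (X a (add_mset i \<sigma>)) * pd (X a \<sigma>) f z) ({..<n} \<times> mindices r) =
      sum' (\<lambda>(a, \<sigma>). z' (X a (add_mset i \<sigma>)) * pd (X a \<sigma>) f z') ({..<n} \<times> mindices r)"
    by (rule sum.cong'[OF refl]) (use pd z(3) assms(3) in auto)
  then show "Dtot n r i f z = Dtot n r i f z'"
    unfolding Dtot_def using pd[of "T i"] assms(2) by simp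
qed

lemma depends_on_Dtots:
  assumes "depends_on K S f" "\<sigma> \<in> mindices r" "\<And>a \<sigma>. X a \<sigma> \<in> K"
  shows "depends_on K S (Dtots n r \<sigma> f)"
proof -
  have "depends_on K S (foldr (Dtot n r) xs f)" if "set xs \<subseteq> {..<r}" for xs
    using that by (induction xs) (simp_all add: assms(1) depends_on_Dtot[OF _ _ assms(3)])
  then show ?thesis unfolding Dtots_def using set_sorted_mindices[OF assms(2)] by blast
qed

end

context mfd
begin

lemma coord_open_TJ:
  assumes "c \<in> atlas M"
  shows "coord_open {X a \<sigma> | a \<sigma>. a < n \<and> \<sigma> \<in> mindices r} (TJ M r c)"
  unfolding coord_open_def
proof (intro ballI allI impI)
  fix z F assume z: "z \<in> TJ M r c" and F: "finite F" "F \<subseteq> {X a \<sigma> | a \<sigma>. a < n \<and> \<sigma> \<in> mindices r}"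
  have FJ: "F \<subseteq> jcoords n r" using F(2) by auto
  have zJ: "z \<in> J M r c" using z TJ_subset_J by blast
  obtain e where e: "e > 0" "\<forall>z'. near F e z z' \<longrightarrow> z' \<in> J M r c"
    by (rule coord_openD[OF jet_domain.coord_open[OF jet_domain_J[OF assms]] zJ F(1) FJ])
  have "z' \<in> TJ M r c" if z': "near F e z z'" for z'
  proof -
    have "z' (T i) = 0" for i
    proof -
      have "T i \<notin> F" using F(2) by blast
      then show ?thesis using z' TJ_T[OF z] by (simp add: near_def)
    qed
    then have "drop_T z' = z'" by (auto simp: drop_T_def fun_eq_iff split: coord.split)
    moreover have "drop_T z' \<in> TJ M r c" using drop_T_in_TJ e(2) z' by blast
    ultimately show ?thesis by simp
  qed
  then show "\<exists>e>0. \<forall>z'. near F e z z' \<longrightarrow> z' \<in> TJ M r c" using e(1) by blast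
qed

lemma lagrangian_depends_on_X:
  "depends_on (range (case_prod X)) (J M r c) (on_J L c)"
proof (rule depends_onI)
  fix z z' :: pt assume "\<forall>y\<in>range (case_prod X). z y = z' y"
  then have "z (X a \<sigma>) = z' (X a \<sigma>)" for a \<sigma> by (metis case_prod_conv rangeI)
  then have "drop_T z = drop_T z'" by (auto simp: drop_T_def fun_eq_iff split: coord.split)
  then show "on_J L c z = on_J L c z'" by (simp add: on_J_eq)
qed

text \<open>A Lagrangian is smooth in the x coordinates on jets at 0, so its pullback is a composite
  with \<open>drop_T\<close>, whose components are coordinates or 0.\<close>

lemma regJ_lagrangian:
  assumes c: "c \<in> atlas M" and k: "order_le k (TJ M r c) (L c)"
    and sm: "smooth_on {X a \<sigma> | a \<sigma>. a < n \<and> \<sigma> \<in> mindices r} (TJ M r c) (L c)"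
  shows "regJ r c k (on_J L c)"
proof -
  let ?K = "{X a \<sigma> | a \<sigma>. a < n \<and> \<sigma> \<in> mindices r}"
  let ?F = "jcoords_le n r k \<inter> ?K"
  have "smooth_on (jcoords n r) (J M r c) (\<lambda>z. L c (drop_T z))"
  proof (rule smooth_on_comp[where K = ?K and F = ?F and S = "TJ M r c" and \<gamma> = drop_T and f = "L c"])
    show "coord_open ?K (TJ M r c)" by (rule coord_open_TJ[OF c])
    show "finite ?F" using finite_jcoords_le by blast
    show "coord_open (jcoords n r) (J M r c)" by (rule jet_domain.coord_open[OF jet_domain_J[OF c]])
    have coord: "smooth_on (jcoords n r) (J M r c) (\<lambda>z. drop_T z y)" for y
      by (cases y) (simp_all add: smooth_on_coord smooth_on_const)
    then show "smooth_on (jcoords n r) (J M r c) (\<lambda>z. drop_T z y)" if "y \<in> ?F" for y .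
    show "continuous_on (J M r c) drop_T"
      by (rule continuous_on_coordinatewise_then_product) (rule smooth_on_continuous[OF coord])
    show "depends_on ?F (TJ M r c) (L c)"
    proof (rule depends_onI)
      fix z z' assume z: "z \<in> TJ M r c" "z' \<in> TJ M r c" "\<forall>y\<in>?F. z y = z' y"
      show "L c z = L c z'"
      proof (rule depends_onD[OF k[unfolded order_le_iff] z(1,2)])
        fix y assume y: "y \<in> {y. corder y \<le> k}"
        show "z y = z' y"
        proof (cases y)
          case (T i)
          then show ?thesis using TJ_T[OF z(1)] TJ_T[OF z(2)] by simp
        next
          case (X a \<sigma>)
          show ?thesis
          proof (cases "y \<in> jcoords n r")
            case True
            then have "y \<in> ?F" using y X by (auto simp: jcoords_le_eq)
            then show ?thesis using z(3) by blast
          next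
            case False
            have "z y = 0" "z' y = 0"
              using jet_domain.zero[OF jet_domain_J[OF c] _ False] z(1,2) TJ_subset_J by blast+
            then show ?thesis by simp
          qed
        qed
      qed
    qed
  qed (use drop_T_in_TJ sm in auto)
  moreover have "order_le k (J M r c) (\<lambda>z. L c (drop_T z))"
    unfolding order_le_iff
  proof (rule depends_onI)
    fix z z' assume z: "z \<in> J M r c" "z' \<in> J M r c" "\<forall>y\<in>{y. corder y \<le> k}. z y = z' y"
    show "L c (drop_T z) = L c (drop_T z')"
    proof (rule depends_onD[OF k[unfolded order_le_iff] drop_T_in_TJ[OF z(1)] drop_T_in_TJ[OF z(2)]])
      fix y assume "y \<in> {y. corder y \<le> k}"
      then show "drop_T z y = drop_T z' y" using z(3) by (cases y) auto
    qed
  qed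
  moreover have "on_J L c = (\<lambda>z. L c (drop_T z))" by (rule ext) (rule on_J_eq)
  ultimately show ?thesis by (simp add: regJ_iff[OF c])
qed

text \<open>Forgetting the t^i of a jet at \<open>t\<close> yields the jet at 0 of the translated
  section, and for jets at 0 the invariance is part of the definition of Lagrangians.\<close>

lemma on_J_invariant:
  assumes L: "L \<in> lagrangians M r" and c: "c \<in> atlas M" "c' \<in> atlas M" and z: "z \<in> JJ r c c'"
  shows "on_J L c z = on_J L c' (transition M r c c' z)"
proof -
  obtain t s where g: "(t, s) \<in> germs M r" "s t \<in> fst c \<inter> fst c'" and zj: "z = jet M r c (t, s)"
    by (rule JJ_E[OF z])
  have inv: "\<forall>c \<in> atlas M. \<forall>c' \<in> atlas M. \<forall>s. ((\<lambda>_. 0), s) \<in> germs M r \<longrightarrow>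
        s (\<lambda>_. 0) \<in> fst c \<inter> fst c' \<longrightarrow>
        L c (jet M r c ((\<lambda>_. 0), s)) = L c' (jet M r c' ((\<lambda>_. 0), s))"
    using L unfolding lagrangians_def by blast
  have "L c (jet M r c (\<lambda>_. 0, \<lambda>u. s (\<lambda>k. u k + t k))) = L c' (jet M r c' (\<lambda>_. 0, \<lambda>u. s (\<lambda>k. u k + t k)))"
    by (rule inv[rule_format, OF c germs_zero[OF g(1)]]) (use g(2) in simp_all)
  then show ?thesis
    unfolding on_J_eq zj transition_jet[OF c g] drop_T_jet .
qed

lemma vol_form_eq:
  "c \<in> atlas M \<Longrightarrow> z \<in> J M r c \<Longrightarrow> gs \<in> lists (gens n r) \<Longrightarrow>
    vol_form M r f c gs z = lsign (rev [0..<r]) gs * f c z"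
  by (simp add: vol_form_def cut_def lvol_eq)

lemma lsign_lists: "lsign (rev [0..<r]) gs \<noteq> 0 \<Longrightarrow> gs \<in> lists (Dt ` {..<r})"
proof -
  assume "lsign (rev [0..<r]) gs \<noteq> 0"
  then have "set_mset (mset gs) = set_mset (mset (map Dt (rev [0..<r])))"
    using lsign_support by metis
  then show ?thesis by auto
qed

lemma vol_form_in_forms:
  assumes L: "L \<in> lagrangians M r"
  shows "vol_form M r (on_J L) \<in> forms M r 0 (int r)"
proof -
  let ?\<omega> = "vol_form M r (on_J L)"
  obtain k where k: "\<forall>c\<in>atlas M. order_le k (TJ M r c) (L c)"
    using L unfolding lagrangians_def by blast
  have sm: "\<forall>c\<in>atlas M. smooth_on {X a \<sigma> | a \<sigma>. a < n \<and> \<sigma> \<in> mindices r} (TJ M r c) (L c)"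
    using L unfolding lagrangians_def by blast
  have ne: "c \<in> atlas M" "z \<in> J M r c" "lsign (rev [0..<r]) gs \<noteq> 0" if "?\<omega> c gs z \<noteq> 0" for c gs z
    using that by (auto simp: vol_form_def cut_def lvol_eq split: if_splits)
  have vert0: "?\<omega> c gs = (\<lambda>z. 0)" if g: "g \<in> set gs" "\<not> is_Dt g" for c gs g
  proof (rule ext, rule ccontr)
    fix z assume "?\<omega> c gs z \<noteq> 0"
    then have "gs \<in> lists (Dt ` {..<r})" by (rule lsign_lists[OF ne(3)])
    then show False using g by auto
  qed
  have "bidegree 0 (int r) ?\<omega>"
    unfolding bidegree_def
  proof (intro allI impI)
    fix c gs z assume "?\<omega> c gs z \<noteq> 0"
    then have gs: "mset gs = mset (map Dt (rev [0..<r]))" by (rule lsign_support[OF ne(3)])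
    have "filter (Not \<circ> is_Dt) (map Dt (rev [0..<r])) = []" "filter is_Dt (map Dt (rev [0..<r])) = map Dt (rev [0..<r])"
      by (auto simp: filter_empty_conv filter_id_conv)
    moreover have "length (filter P gs) = length (filter P (map Dt (rev [0..<r])))" for P
      by (simp only: length_filter_mset gs)
    ultimately show "int (length (filter (Not \<circ> is_Dt) gs)) = 0 \<and> int (length (filter is_Dt gs)) = int r"
      by simp
  qed
  moreover have "cut M r ?\<omega> = ?\<omega>" by (simp add: vol_form_def)
  moreover have "alternating (?\<omega> c)" for c
    unfolding alternating_def vol_form_def
    by (intro allI alternating_cut) (rule alternatingD[OF alternating_lvol])
  moreover have "bounded_regular r k ?\<omega>"
    unfolding bounded_regular_def
  proof (intro ballI allI conjI impI)
    fix c gs assume c: "c \<in> atlas M"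
    have reg: "regJ r c k (on_J L c)" by (rule regJ_lagrangian[OF c]) (use k sm c in auto)
    have "lvol r (on_J L c) gs = (\<lambda>z. lsign (rev [0..<r]) gs * on_J L c z)" for gs
      by (rule ext) (rule lvol_eq)
    then have "regJ r c k (lvol r (on_J L c) gs)" for gs
      using jet_domain.reg_cmult[OF jet_domain_J[OF c] reg] by simp
    then show "regJ r c k (?\<omega> c gs)"
      unfolding vol_form_def by (intro regJ_cut[OF c])
    fix z a \<sigma> assume "Gam a \<sigma> \<in> set gs"
    then show "?\<omega> c gs z = 0" using vert0[of "Gam a \<sigma>" gs c] by simp
  qed
  moreover have "tensorial r ?\<omega>"
  proof (rule tensorial_horizontal[THEN iffD2, OF vert0])
    show "\<forall>c \<in> atlas M. \<forall>c' \<in> atlas M. \<forall>z \<in> JJ r c c'. \<forall>gs \<in> lists (Dt ` {..<r}).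
      ?\<omega> c gs z = ?\<omega> c' gs (transition M r c c' z)"
    proof (intro ballI)
      fix c c' z gs assume c: "c \<in> atlas M" "c' \<in> atlas M" and z: "z \<in> JJ r c c'" and "gs \<in> lists (Dt ` {..<r})"
      then have gs: "gs \<in> lists (gens n r)" by auto
      have "z \<in> J M r c" "transition M r c c' z \<in> J M r c'"
        using z transition_in[OF c z] JJ_subset_J by blast+
      then show "?\<omega> c gs z = ?\<omega> c' gs (transition M r c c' z)"
        using vol_form_eq[OF c(1) _ gs] vol_form_eq[OF c(2) _ gs] on_J_invariant[OF L c z] by simp
    qed
  qed
  ultimately show ?thesis unfolding forms_iff by blast
qed

section \<open>Forms modulo horizontal coboundaries\<close>

lemma hor_add:
  assumes "\<eta> \<in> forms M r p q" "\<eta>' \<in> forms M r p q"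
  shows "hor M r (\<lambda>c gs z. \<eta> c gs z + \<eta>' c gs z) c gs z = hor M r \<eta> c gs z + hor M r \<eta>' c gs z"
proof (cases "c \<in> atlas M \<and> z \<in> J M r c \<and> gs \<in> lists (gens n r)")
  case True
  then have c: "c \<in> atlas M" and z: "z \<in> J M r c" and gs: "gs \<in> lists (gens n r)" by auto
  obtain k1 k2 where "bounded_regular r k1 \<eta>" "bounded_regular r k2 \<eta>'"
    using assms unfolding forms_iff by blast
  then obtain k where k: "bounded_regular r k \<eta>" "bounded_regular r k \<eta>'"
    using bounded_regular_mono[of r k1 \<eta> "max k1 k2"] bounded_regular_mono[of r k2 \<eta>' "max k1 k2"] by simp
  show ?thesis
    unfolding hor_eq[OF c z gs]
    by (rule jet_domain.lhor_add[OF jet_domain_J[OF c] bounded_regularD(1)[OF k(1) c] bounded_regularD(1)[OF k(2) c] z])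
qed (auto simp: hor_def cut_def)

lemma hor_cmult:
  assumes "\<eta> \<in> forms M r p q"
  shows "hor M r (\<lambda>c gs z. x * \<eta> c gs z) c gs z = x * hor M r \<eta> c gs z"
proof (cases "c \<in> atlas M \<and> z \<in> J M r c \<and> gs \<in> lists (gens n r)")
  case True
  then have c: "c \<in> atlas M" and z: "z \<in> J M r c" and gs: "gs \<in> lists (gens n r)" by auto
  obtain k where k: "bounded_regular r k \<eta>" using assms unfolding forms_iff by blast
  show ?thesis
    unfolding hor_eq[OF c z gs]
    by (rule jet_domain.lhor_cmult[OF jet_domain_J[OF c] bounded_regularD(1)[OF k c] z])
qed (auto simp: hor_def cut_def)

lemma hrelD:
  assumes "(\<omega>, \<omega>') \<in> hrel M r p"
  obtains \<eta> where "\<omega> \<in> forms M r p (int r)" "\<omega>' \<in> forms M r p (int r)" "\<eta> \<in> forms M r p (int r - 1)"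
    "\<forall>c gs z. \<omega>' c gs z = \<omega> c gs z + hor M r \<eta> c gs z"
  using assms unfolding hrel_def by blast

lemma hrelI:
  assumes "\<omega> \<in> forms M r p (int r)" "\<omega>' \<in> forms M r p (int r)" "\<eta> \<in> forms M r p (int r - 1)"
    "\<And>c gs z. \<omega>' c gs z = \<omega> c gs z + hor M r \<eta> c gs z"
  shows "(\<omega>, \<omega>') \<in> hrel M r p"
  using assms unfolding hrel_def by blast

lemma hrel_refl:
  assumes "\<omega> \<in> forms M r p (int r)"
  shows "(\<omega>, \<omega>) \<in> hrel M r p"
  by (rule hrelI[OF assms assms zero_in_forms])
     (use hor_cmult[OF zero_in_forms[of r p "int r - 1"], of 0] in simp)

lemma hrel_sym:
  assumes "(\<omega>, \<omega>') \<in> hrel M r p"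
  shows "(\<omega>', \<omega>) \<in> hrel M r p"
proof -
  obtain \<eta> where \<eta>: "\<omega> \<in> forms M r p (int r)" "\<omega>' \<in> forms M r p (int r)" "\<eta> \<in> forms M r p (int r - 1)"
    "\<forall>c gs z. \<omega>' c gs z = \<omega> c gs z + hor M r \<eta> c gs z"
    by (rule hrelD[OF assms])
  show ?thesis
  proof (rule hrelI[OF \<eta>(2,1) cmult_in_forms[OF \<eta>(3), of "-1"]])
    fix c gs z
    show "\<omega> c gs z = \<omega>' c gs z + hor M r (\<lambda>c gs z. - 1 * \<eta> c gs z) c gs z"
      unfolding hor_cmult[OF \<eta>(3)] using \<eta>(4)[rule_format, of c gs z] by linarith
  qed
qed

lemma hrel_trans:
  assumes "(\<omega>, \<omega>') \<in> hrel M r p" "(\<omega>', \<omega>'') \<in> hrel M r p"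
  shows "(\<omega>, \<omega>'') \<in> hrel M r p"
proof -
  obtain \<eta> where \<eta>: "\<omega> \<in> forms M r p (int r)" "\<omega>' \<in> forms M r p (int r)" "\<eta> \<in> forms M r p (int r - 1)"
    "\<forall>c gs z. \<omega>' c gs z = \<omega> c gs z + hor M r \<eta> c gs z"
    by (rule hrelD[OF assms(1)])
  obtain \<eta>' where \<eta>': "\<omega>'' \<in> forms M r p (int r)" "\<eta>' \<in> forms M r p (int r - 1)"
    "\<forall>c gs z. \<omega>'' c gs z = \<omega>' c gs z + hor M r \<eta>' c gs z"
    by (rule hrelD[OF assms(2)])
  show ?thesis
  proof (rule hrelI[OF \<eta>(1) \<eta>'(1) add_in_forms[OF \<eta>(3) \<eta>'(2)]])
    fix c gs z
    show "\<omega>'' c gs z = \<omega> c gs z + hor M r (\<lambda>c gs z. \<eta> c gs z + \<eta>' c gs z) c gs z"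
      unfolding hor_add[OF \<eta>(3) \<eta>'(2)]
      using \<eta>(4)[rule_format, of c gs z] \<eta>'(3)[rule_format, of c gs z] by linarith
  qed
qed

lemma hclass_eq:
  assumes "(\<omega>, \<omega>') \<in> hrel M r p"
  shows "hclass M r p \<omega>' = hclass M r p \<omega>"
  unfolding hclass_def using hrel_trans[OF assms] hrel_trans[OF hrel_sym[OF assms]] by blast

text \<open>Since D\<delta> = -\<delta>D, representatives that differ by D\<eta> are mapped to
  representatives that differ by D(-\<delta>\<eta>).\<close>

lemma vert_hrel:
  assumes "(\<omega>, \<omega>') \<in> hrel M r 0"
  shows "(vert M r \<omega>, vert M r \<omega>') \<in> hrel M r 1"
proof -
  obtain \<eta> where \<eta>: "\<omega> \<in> forms M r 0 (int r)" "\<omega>' \<in> forms M r 0 (int r)" "\<eta> \<in> forms M r 0 (int r - 1)"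
    "\<forall>c gs z. \<omega>' c gs z = \<omega> c gs z + hor M r \<eta> c gs z"
    by (rule hrelD[OF assms])
  let ?\<theta> = "\<lambda>c gs z. - 1 * vert M r \<eta> c gs z"
  have v\<eta>: "vert M r \<eta> \<in> forms M r 1 (int r - 1)" by (rule vert_in_forms[OF \<eta>(3)])
  show ?thesis
  proof (rule hrelI[OF vert_in_forms[OF \<eta>(1)] vert_in_forms[OF \<eta>(2)] cmult_in_forms[OF v\<eta>, of "-1"]])
    fix c gs z
    show "vert M r \<omega>' c gs z = vert M r \<omega> c gs z + hor M r ?\<theta> c gs z"
    proof (cases "c \<in> atlas M \<and> z \<in> J M r c \<and> gs \<in> lists (gens n r)")
      case True
      then have c: "c \<in> atlas M" and z: "z \<in> J M r c" and gs: "gs \<in> lists (gens n r)" by auto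
      interpret jet_domain n r "J M r c" by (rule jet_domain_J[OF c])
      obtain k1 k2 k3 where "bounded_regular r k1 \<omega>" "bounded_regular r k2 \<omega>'" "bounded_regular r k3 \<eta>"
        using \<eta>(1-3) unfolding forms_iff by blast
      then obtain k where k: "bounded_regular r k \<omega>" "bounded_regular r k \<omega>'" "bounded_regular r k \<eta>"
        using bounded_regular_mono[of r k1 \<omega> "max k1 (max k2 k3)"] bounded_regular_mono[of r k2 \<omega>' "max k1 (max k2 k3)"]
          bounded_regular_mono[of r k3 \<eta> "max k1 (max k2 k3)"] by simp
      note reg = bounded_regularD(1)[OF k(1) c] bounded_regularD(1)[OF k(2) c] bounded_regularD(1)[OF k(3) c]
      \<comment> \<open>\<open>lvert_add\<close> asks for regularity on every argument list. The
        difference of the two given forms has it; only afterwards is it replaced by D\<eta>, with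
        which it agrees on the chart domain and on lists of generators.\<close>
      let ?d = "\<lambda>hs z. \<omega>' c hs z + - 1 * \<omega> c hs z"
      have regd: "reg k (?d hs)" for hs by (rule reg_add[OF reg(2) reg_cmult[OF reg(1)]])
      have "vert M r \<omega>' c gs z = lvert n r (\<lambda>hs z. \<omega> c hs z + ?d hs z) gs z"
        by (simp add: vert_eq[OF c z gs])
      also have "\<dots> = lvert n r (\<omega> c) gs z + lvert n r ?d gs z"
        by (rule lvert_add[OF reg(1) regd z])
      also have "lvert n r ?d gs z = lvert n r (lhor n r (\<eta> c)) gs z"
        by (rule lvert_cong[OF _ z gs]) (simp add: \<eta>(4) hor_eq[OF c])
      also have "\<dots> = - lhor n r (lvert n r (\<eta> c)) gs z"
        by (rule lvert_lhor[OF reg(3) bidegree_0_vertical[OF formsD(2)[OF \<eta>(3)]] z])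
      also have "lhor n r (lvert n r (\<eta> c)) gs z = lhor n r (vert M r \<eta> c) gs z"
        by (rule lhor_cong[OF _ z gs]) (simp add: vert_eq[OF c])
      also have "\<dots> = hor M r (vert M r \<eta>) c gs z"
        by (rule hor_eq[OF c z gs, symmetric])
      finally show ?thesis
        unfolding hor_cmult[OF v\<eta>] by (simp add: vert_eq[OF c z gs])
    qed (auto simp: vert_def hor_def cut_def)
  qed
qed

text \<open>\<open>lcanon\<close> sees a form only through the Euler operator of its vertical
  coefficients, and this is unaffected by coboundaries
  (\<open>euler_vcoeff_add_lhor\<close>).\<close>

lemma canon_hrel:
  assumes "(\<omega>, \<omega>') \<in> hrel M r 1"
  shows "canon M r \<omega>' = canon M r \<omega>"
proof (intro ext)
  fix c gs z
  obtain \<eta> where \<eta>: "\<omega> \<in> forms M r 1 (int r)" "\<omega>' \<in> forms M r 1 (int r)" "\<eta> \<in> forms M r 1 (int r - 1)"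
    "\<forall>c gs z. \<omega>' c gs z = \<omega> c gs z + hor M r \<eta> c gs z"
    by (rule hrelD[OF assms])
  show "canon M r \<omega>' c gs z = canon M r \<omega> c gs z"
  proof (cases "c \<in> atlas M \<and> z \<in> J M r c \<and> gs \<in> lists (gens n r)")
    case True
    then have c: "c \<in> atlas M" and z: "z \<in> J M r c" by auto
    interpret jet_domain n r "J M r c" by (rule jet_domain_J[OF c])
    obtain k1 k2 where "bounded_regular r k1 \<omega>" "bounded_regular r k2 \<eta>"
      using \<eta>(1,3) unfolding forms_iff by blast
    then obtain k where k: "bounded_regular r k \<omega>" "bounded_regular r k \<eta>"
      using bounded_regular_mono[of r k1 \<omega> "max k1 k2"] bounded_regular_mono[of r k2 \<eta> "max k1 k2"] by simp
    have E: "euler (vcoeff (\<omega>' c) a) z = euler (vcoeff (\<omega> c) a) z" if a: "a < n" for a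
    proof (rule euler_vcoeff_add_lhor[where \<eta> = "\<eta> c" and k = k])
      show "\<omega> c (Gam b \<sigma> # hs) w = 0" if "size \<sigma> > k" for b \<sigma> hs w
        by (rule bounded_regularD(2)[where a = b, OF k(1) c _ that]) simp
      show "\<eta> c (Gam b \<sigma> # hs) w = 0" if "size \<sigma> > k" for b \<sigma> hs w
        by (rule bounded_regularD(2)[where a = b, OF k(2) c _ that]) simp
      show "\<omega>' c hs w = \<omega> c hs w + lhor n r (\<eta> c) hs w" if "hs \<in> lists (gens n r)" "w \<in> J M r c" for hs w
        unfolding hor_eq[OF c that(2,1), symmetric] using \<eta>(4) by blast
    qed (use a z bounded_regularD(1)[OF k(1) c] bounded_regularD(1)[OF k(2) c] in auto)
    have "lcanon n r (\<omega>' c) gs z = lcanon n r (\<omega> c) gs z"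
      unfolding lcanon_eq by (intro sum.cong refl wedge_cong) (simp add: lvol_eq E)
    then show ?thesis by (simp add: canon_def cut_def)
  qed (auto simp: canon_def cut_def)
qed

text \<open>All representatives give the same class, and reflexivity shows that there is at least
  one; so the image is a singleton and \<open>the_elem\<close> returns its element.\<close>

lemma vert_class_hclass:
  assumes "\<omega> \<in> forms M r 0 (int r)"
  shows "vert_class M r 0 (hclass M r 0 \<omega>) = hclass M r 1 (vert M r \<omega>)"
proof -
  have "hclass M r 1 (vert M r \<omega>') = hclass M r 1 (vert M r \<omega>)" if "\<omega>' \<in> hclass M r 0 \<omega>" for \<omega>'
    by (rule hclass_eq[OF vert_hrel]) (use that in \<open>simp add: hclass_def\<close>)
  moreover have "\<omega> \<in> hclass M r 0 \<omega>" using hrel_refl[OF assms] by (simp add: hclass_def)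
  ultimately have "(\<lambda>\<omega>. hclass M r 1 (vert M r \<omega>)) ` hclass M r 0 \<omega> = {hclass M r 1 (vert M r \<omega>)}"
    by blast
  then show ?thesis by (simp add: vert_class_def)
qed

lemma rho_hclass:
  assumes "\<omega> \<in> forms M r 1 (int r)"
  shows "rho M r (hclass M r 1 \<omega>) = canon M r \<omega>"
proof -
  have "canon M r \<omega>' = canon M r \<omega>" if "\<omega>' \<in> hclass M r 1 \<omega>" for \<omega>'
    by (rule canon_hrel) (use that in \<open>simp add: hclass_def\<close>)
  moreover have "\<omega> \<in> hclass M r 1 \<omega>" using hrel_refl[OF assms] by (simp add: hclass_def)
  ultimately have "canon M r ` hclass M r 1 \<omega> = {canon M r \<omega>}" by blast
  then show ?thesis by (simp add: rho_def)
qed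

subsection \<open>The variational differential\<close>

text \<open>The arguments in \<open>vcoeff\<close> stand in the order of the volume form, where
  \<open>lsign\<close> is 1. The coefficient of Gamma^a_\<sigma> is therefore
  \<partial>f/\<partial>x^a_\<sigma> without any sign.\<close>

lemma euler_vert_vol_form:
  assumes c: "c \<in> atlas M" and a: "a < n" and z: "z \<in> J M r c"
  shows "jet_domain.euler n r (jet_domain.vcoeff r (vert M r (vol_form M r f) c) a) z = var_deriv n r a (f c) z"
proof -
  interpret jet_domain n r "J M r c" by (rule jet_domain_J[OF c])
  have ds: "map Dt (rev [0..<r]) \<in> lists (gens n r)" by auto
  have "euler (vcoeff (vert M r (vol_form M r f) c) a) z = euler (\<lambda>\<sigma>. pd (X a \<sigma>) (f c)) z"
  proof (rule euler_cong[OF _ z])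
    fix \<sigma> w assume \<sigma>: "\<sigma> \<in> mindices r" and w: "w \<in> J M r c"
    have "vcoeff (vert M r (vol_form M r f) c) a \<sigma> w =
        lvert n r (vol_form M r f c) ([] @ Gam a \<sigma> # map Dt (rev [0..<r])) w"
      unfolding vcoeff_def using ds a \<sigma> by (simp add: vert_eq[OF c w])
    also have "\<dots> = pd (X a \<sigma>) (vol_form M r f c (map Dt (rev [0..<r]))) w"
      by (subst lvert_one_vertical[OF _ a \<sigma>]) auto
    also have "\<dots> = pd (X a \<sigma>) (f c) w"
      by (rule pd_cong[OF coord_open w]) (use a \<sigma> in \<open>simp_all add: vol_form_eq[OF c _ ds] lsign_self\<close>)
    finally show "vcoeff (vert M r (vol_form M r f) c) a \<sigma> w = pd (X a \<sigma>) (f c) w" .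
  qed
  then show ?thesis by (simp add: euler_def var_deriv_def)
qed

text \<open>With the vertical argument in front this is the derivative by Gamma^a_\<sigma>, which is
  what \<kappa> extracts.\<close>

lemma canon_vertical:
  assumes c: "c \<in> atlas M" and a: "a < n" "\<sigma> \<in> mindices r" and z: "z \<in> J M r c"
  shows "canon M r \<omega> c (Gam a \<sigma> # hs) z =
    (if \<sigma> = {#} then lsign (rev [0..<r]) hs * jet_domain.euler n r (jet_domain.vcoeff r (\<omega> c) a) z else 0)"
proof -
  interpret jet_domain n r "J M r c" by (rule jet_domain_J[OF c])
  let ?ds = "rev [0..<r]"
  have Gam0: "lsign ?ds (Gam a \<sigma> # ys) = 0" for ys
    using lsign_lists[of r "Gam a \<sigma> # ys"] by auto
  have "wedge (Gam b {#}) (lvol r (euler (vcoeff (\<omega> c) b))) (Gam a \<sigma> # hs) z =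
      (if b = a then (if \<sigma> = {#} then lsign ?ds hs * euler (vcoeff (\<omega> c) a) z else 0) else 0)" for b
  proof -
    have "wedge (Gam b {#}) (\<lambda>ys. lvol r (euler (vcoeff (\<omega> c) b)) (Gam a \<sigma> # ys)) hs z = 0"
      by (rule wedge_zero_if) (simp add: lvol_eq Gam0)
    then show ?thesis by (auto simp: wedge_Cons lvol_eq)
  qed
  then have l: "lcanon n r (\<omega> c) (Gam a \<sigma> # hs) z =
      (if \<sigma> = {#} then lsign ?ds hs * euler (vcoeff (\<omega> c) a) z else 0)"
    unfolding lcanon_eq using a by simp
  show ?thesis
  proof (cases "hs \<in> lists (gens n r)")
    case True
    then show ?thesis using l c z a by (simp add: canon_def cut_def)
  next
    case False
    then have "lsign ?ds hs = 0" using lsign_lists[of r hs] by (auto simp: gens_def)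
    then show ?thesis using False by (auto simp: canon_def cut_def)
  qed
qed

text \<open>A Lagrangian does not depend on the t^i, and neither partial nor total derivatives
  introduce such a dependence. This reconciles the variational differential, evaluated at jets at 0,
  with the right-hand side, evaluated at arbitrary jets.\<close>

lemma var_deriv_drop_T:
  assumes c: "c \<in> atlas M" and z: "z \<in> J M r c" "z' \<in> J M r c" and eq: "\<And>a \<sigma>. z (X a \<sigma>) = z' (X a \<sigma>)"
    and a: "a < n"
  shows "var_deriv n r a (on_J L c) z = var_deriv n r a (on_J L c) z'"
proof -
  interpret jet_domain n r "J M r c" by (rule jet_domain_J[OF c])
  let ?K = "range (case_prod X)"
  have K: "X b \<tau> \<in> ?K" for b \<tau> by (metis case_prod_conv rangeI)
  have "Dtots n r \<sigma> (pd (X a \<sigma>) (on_J L c)) z = Dtots n r \<sigma> (pd (X a \<sigma>) (on_J L c)) z'" if \<sigma>: "\<sigma> \<in> mindices r" for \<sigma>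
  proof (rule depends_onD[OF _ z])
    show "depends_on ?K (J M r c) (Dtots n r \<sigma> (pd (X a \<sigma>) (on_J L c)))"
      by (rule depends_on_Dtots[OF depends_on_pd[OF coord_open lagrangian_depends_on_X] \<sigma> K]) (use a \<sigma> in simp)
    show "z y = z' y" if "y \<in> ?K" for y using that eq by auto
  qed
  then show ?thesis unfolding var_deriv_def by (intro sum.cong') auto
qed

lemma proj_X: "proj n r z (X a \<sigma>) = (if a < n \<and> \<sigma> \<in> mindices r then z (X a \<sigma>) else 0)"
  by (simp add: proj_def)

lemma on_J_var_diff:
  assumes c: "c \<in> atlas M" and z: "z \<in> J M (Suc r) c"
  shows "on_J (var_diff M r L) c z = (\<Sum>a<n. z (X a {#r#}) * var_deriv n r a (on_J L c) (proj n r z))"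
proof -
  have d: "drop_T z \<in> TJ M (Suc r) c" by (rule drop_T_in_TJ[OF z])
  then have d': "drop_T z \<in> J M (Suc r) c" using TJ_subset_J by blast
  have "var_deriv n r a (on_J L c) (proj n r (drop_T z)) = var_deriv n r a (on_J L c) (proj n r z)"
    if "a < n" for a
    by (rule var_deriv_drop_T[OF c proj_in_J[OF d' c] proj_in_J[OF z c] _ that]) (simp add: proj_X)
  then show ?thesis
    using c d by (simp add: on_J_eq var_diff_def)
qed

lemma vol_form_var_diff:
  assumes L: "L \<in> lagrangians M r"
  shows "vol_form M (Suc r) (on_J (var_diff M r L)) =
    chi M r (vert_class M r 0 (hclass M r 0 (vol_form M r (on_J L))))"
proof -
  let ?\<omega> = "vol_form M r (on_J L)"
  let ?\<kappa> = "canon M r (vert M r ?\<omega>)"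
  let ?ds = "rev [0..<r]"
  have \<omega>: "?\<omega> \<in> forms M r 0 (int r)" by (rule vol_form_in_forms[OF L])
  have "vol_form M (Suc r) (on_J (var_diff M r L)) c gs z = kappa M r ?\<kappa> c gs z" for c gs z
  proof (cases "c \<in> atlas M \<and> z \<in> J M (Suc r) c \<and> gs \<in> lists (gens n (Suc r))")
    case True
    then have c: "c \<in> atlas M" and z: "z \<in> J M (Suc r) c" and gs: "gs \<in> lists (gens n (Suc r))" by auto
    have pz: "proj n r z \<in> J M r c" by (rule proj_in_J[OF z c])
    let ?W = "\<Sum>a<n. z (X a {#r#}) * var_deriv n r a (on_J L c) (proj n r z)"
    have "sum' (\<lambda>(a, \<sigma>). z (X a (add_mset r \<sigma>)) * gderiv (Gam a \<sigma>) (?\<kappa> c) hs (proj n r z)) ({..<n} \<times> mindices r)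
        = ?W * lsign ?ds hs" for hs
    proof -
      let ?t = "\<lambda>(a, \<sigma>). z (X a (add_mset r \<sigma>)) * gderiv (Gam a \<sigma>) (?\<kappa> c) hs (proj n r z)"
      \<comment> \<open>The canonical representative contains only the generators with empty
        multi-index, so \<kappa> multiplies by x^a with the single index \<open>r\<close>.\<close>
      have t: "?t (a, \<sigma>) = (if \<sigma> = {#} then z (X a {#r#}) * var_deriv n r a (on_J L c) (proj n r z) * lsign ?ds hs else 0)"
        if "a < n" "\<sigma> \<in> mindices r" for a \<sigma>
        using canon_vertical[OF c that pz, of "vert M r ?\<omega>" hs] euler_vert_vol_form[OF c that(1) pz, of "on_J L"]
        by (simp add: gderiv_def)
      have "sum' ?t ({..<n} \<times> mindices r) = sum ?t ((\<lambda>a. (a, {#})) ` {..<n})"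
        by (rule sum'_eq_sum) (use t in auto)
      also have "\<dots> = (\<Sum>a<n. ?t (a, {#}))"
        by (subst sum.reindex) (auto simp: inj_on_def)
      also have "\<dots> = (\<Sum>a<n. z (X a {#r#}) * var_deriv n r a (on_J L c) (proj n r z) * lsign ?ds hs)"
        by (intro sum.cong refl) (use t in auto)
      finally show ?thesis by (simp add: sum_distrib_right)
    qed
    then have "kappa M r ?\<kappa> c gs z = wedge (Dt r) (\<lambda>hs _. ?W * lsign ?ds hs) gs z"
      unfolding kappa_def cut_def lkappa_def using True by (auto intro: wedge_cong)
    also have "\<dots> = ?W * lsign (r # ?ds) gs"
      unfolding wedge_cmult[where c = "\<lambda>_. ?W"] lsign_Cons[of r ?ds gs z] ..
    \<comment> \<open>\<open>rev [0..<Suc r]\<close> begins with \<open>r\<close>, so the new factor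
      in front completes the larger volume form without a sign.\<close>
    also have "\<dots> = vol_form M (Suc r) (on_J (var_diff M r L)) c gs z"
      unfolding vol_form_eq[OF c z gs] on_J_var_diff[OF c z] by simp
    finally show ?thesis by simp
  qed (auto simp: vol_form_def kappa_def cut_def)
  then have "vol_form M (Suc r) (on_J (var_diff M r L)) = kappa M r ?\<kappa>" by (intro ext)
  then show ?thesis
    by (simp add: chi_def vert_class_hclass[OF \<omega>] rho_hclass[OF vert_in_forms[OF \<omega>]])
qed

end

theorem proposition3p3:
  fixes M :: "'m mfd" and r :: nat and L :: "'m chart \<Rightarrow> pt \<Rightarrow> real"
  assumes "smooth_manifold M"
    and "L \<in> lagrangians M r"
  shows "vol_form M (Suc r) (on_J (var_diff M r L)) =
    chi M r (vert_class M r 0 (hclass M r 0 (vol_form M r (on_J L))))"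
  by (rule mfd.vol_form_var_diff[OF mfd.intro[OF assms(1)] assms(2)])

end
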